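(* Let $(M^n,(g_t)_{t\in[0,T_{\max})})$ be a Ricci flow solution. Suppose that there is a function $b$ such that $\mathrm{Scal}_{g_t}(p)=b(t)$ for every $t\in[0,T_{\max})$ and every $p\in M$. Let $T_0<T_{\max}$ and let $\Omega\subset M$ be a precompact domain with smooth nonempty boundary. (i) If $\mathrm{Ric}_{g_t}(v,v)\le 0$ for every $t\le T_0$, every $p\in M$ and every $v\in T_pM$, then $t\mapsto \mathcal{T}(\Omega_t)/\mathrm{V}(\Omega_t)$ is non-decreasing on $[0,T_0]$ and $t\mapsto \mathcal{T}(\Omega_t)/\mathrm{V}(\Omega_t)^3$ is non-increasing on $[0,T_0]$. (ii) If $\mathrm{Ric}_{g_t}(v,v)\ge 0$ for every $t\le T_0$, every $p\in M$ and every $v\in T_pM$, then $t\mapsto \mathcal{T}(\Omega_t)/\mathrm{V}(\Omega_t)$ is non-increasing on $[0,T_0]$ and $t\mapsto \mathcal{T}(\Omega_t)/\mathrm{V}(\Omega_t)^3$ is non-decreasing on $[0,T_0]$.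
   Context: A Ricci flow solution is a smooth family of Riemannian metrics $(g_t)_{t\in[0,T_{\max})}$ on $M$ with $\frac{\partial}{\partial t}g_t=-2\,\mathrm{Ric}_{g_t}$; $\mathrm{Ric}$ and $\mathrm{Scal}$ are the Ricci tensor and scalar curvature. $\mathrm{V}(\Omega_t)$ is the volume of $\Omega$ with respect to $g_t$, and the torsional rigidity is $\mathcal{T}(\Omega_t)=\int_\Omega E_t\,d\mathrm{V}_t$, where $d\mathrm{V}_t$ is the volume element of $g_t$ and $E_t$ solves $\Delta_{g_t}E_t=-1$ in $\Omega$, $E_t=0$ on $\partial\Omega$. *)

theory Defs
  imports "HOL-Analysis.Analysis"
begin

section \<open>Differentiability classes\<close>

text \<open>Meant for open sets \<open>S\<close> only.\<close>

fun Ck_on :: "nat \<Rightarrow> 'a::euclidean_space set \<Rightarrow> ('a \<Rightarrow> 'b::real_normed_vector) \<Rightarrow> bool" where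
  "Ck_on 0 S f \<longleftrightarrow> continuous_on S f"
| "Ck_on (Suc k) S f \<longleftrightarrow> (\<forall>x\<in>S. f differentiable (at x)) \<and>
     (\<forall>v\<in>Basis. Ck_on k S (\<lambda>x. frechet_derivative f (at x) v))"

text \<open>On a set that is not open, such as \<open>[0,T) \<times> U\<close>, smoothness means that \<open>f\<close> extends,
  locally around each point of the set, to a smooth function on an open set.\<close>

definition smooth_on :: "'a::euclidean_space set \<Rightarrow> ('a \<Rightarrow> 'b::real_normed_vector) \<Rightarrow> bool" where
  "smooth_on S f \<longleftrightarrow> (\<forall>x\<in>S. \<exists>W F. open W \<and> x \<in> W \<and> (\<forall>k. Ck_on k W F) \<and> (\<forall>y\<in>S \<inter> W. F y = f y))"

definition partial :: "'n::finite \<Rightarrow> (real^'n \<Rightarrow> real) \<Rightarrow> real^'n \<Rightarrow> real" where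
  "partial i f x = frechet_derivative f (at x) (axis i 1)"


section \<open>Smooth manifolds\<close>

text \<open>The manifold is the whole type \<open>'m\<close>, of class \<open>t2_space\<close> and
  \<open>second_countable_topology\<close>; its dimension is \<open>CARD('n)\<close>.\<close>

datatype ('m, 'n) chart = Chart (dom: "'m set") (coords: "'m \<Rightarrow> real^'n")

hide_const (open) Map.dom

definition point :: "('m, 'n::finite) chart \<Rightarrow> real^'n \<Rightarrow> 'm" where
  "point c = inv_into (dom c) (coords c)"

definition is_chart :: "('m::topological_space, 'n::finite) chart \<Rightarrow> bool" where
  "is_chart c \<longleftrightarrow> open (dom c) \<and> open (coords c ` dom c) \<and>
     homeomorphism (dom c) (coords c ` dom c) (coords c) (point c)"

definition transition :: "('m, 'n::finite) chart \<Rightarrow> ('m, 'n) chart \<Rightarrow> real^'n \<Rightarrow> real^'n" where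
  "transition c d = coords d \<circ> point c"

definition compatible :: "('m, 'n::finite) chart \<Rightarrow> ('m, 'n) chart \<Rightarrow> bool" where
  "compatible c d \<longleftrightarrow> smooth_on (coords c ` (dom c \<inter> dom d)) (transition c d) \<and>
                     smooth_on (coords d ` (dom c \<inter> dom d)) (transition d c)"

definition smooth_atlas :: "('m::topological_space, 'n::finite) chart set \<Rightarrow> bool" where
  "smooth_atlas A \<longleftrightarrow> (\<forall>c\<in>A. is_chart c) \<and> (\<Union>c\<in>A. dom c) = UNIV \<and>
     (\<forall>c\<in>A. \<forall>d\<in>A. compatible c d)"

definition charts_at :: "('m, 'n::finite) chart set \<Rightarrow> 'm \<Rightarrow> ('m, 'n) chart set" where
  "charts_at A p = {c \<in> A. p \<in> dom c}"

definition chart_at :: "('m, 'n::finite) chart set \<Rightarrow> 'm \<Rightarrow> ('m, 'n) chart" where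
  "chart_at A p = (SOME c. c \<in> charts_at A p)"

text \<open>A chart of the smooth structure generated by \<open>A\<close>, i.e. a member of the maximal atlas.\<close>

definition admissible_chart :: "('m::topological_space, 'n::finite) chart set \<Rightarrow> ('m, 'n) chart \<Rightarrow> bool" where
  "admissible_chart A c \<longleftrightarrow> is_chart c \<and> (\<forall>d\<in>A. compatible c d)"


section \<open>Tangent vectors and Riemannian metrics\<close>

text \<open>A tangent vector at \<open>p\<close> is the family of its coordinate vectors in all charts around \<open>p\<close>,
  related by the differentials of the transition maps (and set to 0 in all other charts).\<close>

type_synonym ('m, 'n) tangent = "('m, 'n) chart \<Rightarrow> real^'n"

definition tangent_space :: "('m, 'n::finite) chart set \<Rightarrow> 'm \<Rightarrow> ('m, 'n) tangent set" where
  "tangent_space A p = {v.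
     (\<forall>c\<in>charts_at A p. \<forall>d\<in>charts_at A p.
        v d = frechet_derivative (transition c d) (at (coords c p)) (v c)) \<and>
     (\<forall>c. c \<notin> charts_at A p \<longrightarrow> v c = 0)}"

definition coord_field :: "('m, 'n::finite) chart set \<Rightarrow> ('m, 'n) chart \<Rightarrow> 'n \<Rightarrow> 'm \<Rightarrow> ('m, 'n) tangent" where
  "coord_field A c i p = (\<lambda>d. if d \<in> charts_at A p
     then frechet_derivative (transition c d) (at (coords c p)) (axis i 1) else 0)"

type_synonym ('m, 'n) metric = "'m \<Rightarrow> ('m, 'n) tangent \<Rightarrow> ('m, 'n) tangent \<Rightarrow> real"

text \<open>The matrix \<open>(g\<^sub>i\<^sub>j)\<close> of the metric in the chart \<open>c\<close>, as a function on \<open>coords c ` dom c\<close>.\<close>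

definition gram :: "('m, 'n::finite) chart set \<Rightarrow> ('m, 'n) metric \<Rightarrow> ('m, 'n) chart \<Rightarrow> real^'n \<Rightarrow> real^'n^'n" where
  "gram A g c x = (\<chi> i j. g (point c x) (coord_field A c i (point c x)) (coord_field A c j (point c x)))"

definition inner_product_on :: "('m, 'n::finite) tangent set \<Rightarrow> (('m, 'n) tangent \<Rightarrow> ('m, 'n) tangent \<Rightarrow> real) \<Rightarrow> bool" where
  "inner_product_on V h \<longleftrightarrow>
     (\<forall>u\<in>V. \<forall>v\<in>V. h u v = h v u) \<and>
     (\<forall>u\<in>V. \<forall>v\<in>V. \<forall>w\<in>V. \<forall>a b. h (\<lambda>c. a *\<^sub>R u c + b *\<^sub>R v c) w = a * h u w + b * h v w) \<and>
     (\<forall>v\<in>V. v \<noteq> (\<lambda>c. 0) \<longrightarrow> h v v > 0)"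

definition riemannian_metric :: "('m, 'n::finite) chart set \<Rightarrow> ('m, 'n) metric \<Rightarrow> bool" where
  "riemannian_metric A g \<longleftrightarrow>
     (\<forall>p. inner_product_on (tangent_space A p) (g p)) \<and>
     (\<forall>c\<in>A. smooth_on (coords c ` dom c) (gram A g c))"

definition gram_inv :: "('m, 'n::finite) chart set \<Rightarrow> ('m, 'n) metric \<Rightarrow> ('m, 'n) chart \<Rightarrow> real^'n \<Rightarrow> real^'n^'n" where
  "gram_inv A g c x = matrix_inv (gram A g c x)"

definition vol_density :: "('m, 'n::finite) chart set \<Rightarrow> ('m, 'n) metric \<Rightarrow> ('m, 'n) chart \<Rightarrow> real^'n \<Rightarrow> real" where
  "vol_density A g c x = sqrt (det (gram A g c x))"


section \<open>Curvature\<close>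

text \<open>\<open>christoffel A g c k i j\<close> is \<open>\<Gamma>\<^sup>k\<^sub>i\<^sub>j\<close>.\<close>

definition christoffel :: "('m, 'n::finite) chart set \<Rightarrow> ('m, 'n) metric \<Rightarrow> ('m, 'n) chart
    \<Rightarrow> 'n \<Rightarrow> 'n \<Rightarrow> 'n \<Rightarrow> real^'n \<Rightarrow> real" where
  "christoffel A g c k i j x = 1/2 * (\<Sum>l\<in>UNIV. gram_inv A g c x $ k $ l *
     (partial i (\<lambda>y. gram A g c y $ j $ l) x + partial j (\<lambda>y. gram A g c y $ i $ l) x
      - partial l (\<lambda>y. gram A g c y $ i $ j) x))"

text \<open>\<open>riemann A g c l i j k\<close> is the \<open>\<partial>\<^sub>l\<close>-component of \<open>R(\<partial>\<^sub>i,\<partial>\<^sub>j)\<partial>\<^sub>k\<close>, where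
  \<open>R(X,Y)Z = \<nabla>\<^sub>X\<nabla>\<^sub>YZ - \<nabla>\<^sub>Y\<nabla>\<^sub>XZ - \<nabla>\<^sub>[\<^sub>X\<^sub>,\<^sub>Y\<^sub>]Z\<close>, and \<open>Ric(Y,Z)\<close> is the trace of
  \<open>X \<mapsto> R(X,Y)Z\<close>; with this convention round spheres have positive Ricci curvature.\<close>

definition riemann :: "('m, 'n::finite) chart set \<Rightarrow> ('m, 'n) metric \<Rightarrow> ('m, 'n) chart
    \<Rightarrow> 'n \<Rightarrow> 'n \<Rightarrow> 'n \<Rightarrow> 'n \<Rightarrow> real^'n \<Rightarrow> real" where
  "riemann A g c l i j k x =
     partial i (christoffel A g c l j k) x - partial j (christoffel A g c l i k) x +
     (\<Sum>m\<in>UNIV. christoffel A g c m j k x * christoffel A g c l i m x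
              - christoffel A g c m i k x * christoffel A g c l j m x)"

definition ricci_coeff :: "('m, 'n::finite) chart set \<Rightarrow> ('m, 'n) metric \<Rightarrow> ('m, 'n) chart
    \<Rightarrow> 'n \<Rightarrow> 'n \<Rightarrow> real^'n \<Rightarrow> real" where
  "ricci_coeff A g c j k x = (\<Sum>i\<in>UNIV. riemann A g c i i j k x)"

text \<open>The Ricci tensor and the scalar curvature at \<open>p\<close> do not depend on the chart used to
  compute them, so they are computed in an arbitrarily chosen one.\<close>

definition ricci :: "('m, 'n::finite) chart set \<Rightarrow> ('m, 'n) metric \<Rightarrow> 'm
    \<Rightarrow> ('m, 'n) tangent \<Rightarrow> ('m, 'n) tangent \<Rightarrow> real" where
  "ricci A g p u v = (let c = chart_at A p in
     \<Sum>i\<in>UNIV. \<Sum>j\<in>UNIV. ricci_coeff A g c i j (coords c p) * u c $ i * v c $ j)"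

definition scalar_curvature :: "('m, 'n::finite) chart set \<Rightarrow> ('m, 'n) metric \<Rightarrow> 'm \<Rightarrow> real" where
  "scalar_curvature A g p = (let c = chart_at A p in
     \<Sum>i\<in>UNIV. \<Sum>j\<in>UNIV. gram_inv A g c (coords c p) $ i $ j * ricci_coeff A g c i j (coords c p))"


section \<open>Ricci flow\<close>

text \<open>The final time may be infinite.\<close>

definition time_interval :: "ereal \<Rightarrow> real set" where
  "time_interval Tmax = {t. 0 \<le> t \<and> ereal t < Tmax}"

text \<open>At \<open>t = 0\<close> the time derivative is one-sided.\<close>

definition ricci_flow :: "('m, 'n::finite) chart set \<Rightarrow> ereal \<Rightarrow> (real \<Rightarrow> ('m, 'n) metric) \<Rightarrow> bool" where
  "ricci_flow A Tmax g \<longleftrightarrow>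
     (\<forall>t\<in>time_interval Tmax. riemannian_metric A (g t)) \<and>
     (\<forall>c\<in>A. smooth_on (time_interval Tmax \<times> coords c ` dom c) (\<lambda>(t, x). gram A (g t) c x)) \<and>
     (\<forall>t\<in>time_interval Tmax. \<forall>p. \<forall>u\<in>tangent_space A p. \<forall>v\<in>tangent_space A p.
        ((\<lambda>s. g s p u v) has_real_derivative - 2 * ricci A (g t) p u v) (at t within time_interval Tmax))"


section \<open>Riemannian volume, Laplacian and torsional rigidity\<close>

text \<open>The Riemannian measure is the unique Borel measure given by \<open>\<surd>(det (g\<^sub>i\<^sub>j)) dx\<close> in every chart.\<close>

definition vol_measure :: "('m::topological_space, 'n::finite) chart set \<Rightarrow> ('m, 'n) metric \<Rightarrow> 'm measure" where
  "vol_measure A g = (THE \<mu>. sets \<mu> = sets borel \<and>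
     (\<forall>c\<in>A. \<forall>B\<in>sets borel. B \<subseteq> dom c \<longrightarrow>
        emeasure \<mu> B = (\<integral>\<^sup>+x\<in>coords c ` B. ennreal (vol_density A g c x) \<partial>lborel)))"

definition volume :: "('m::topological_space, 'n::finite) chart set \<Rightarrow> ('m, 'n) metric \<Rightarrow> 'm set \<Rightarrow> real" where
  "volume A g \<Omega> = measure (vol_measure A g) \<Omega>"

text \<open>\<open>\<Delta>f(p) = L\<close>, where \<open>\<Delta>f = det(g)\<^bsup>-1/2\<^esup> \<partial>\<^sub>i(det(g)\<^bsup>1/2\<^esup> g\<^sup>i\<^sup>j \<partial>\<^sub>jf)\<close> in each chart
  (for \<open>f\<close> of class \<open>C\<^sup>2\<close> near \<open>p\<close> all charts around \<open>p\<close> give the same value).\<close>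

definition has_laplacian :: "('m, 'n::finite) chart set \<Rightarrow> ('m, 'n) metric \<Rightarrow> ('m \<Rightarrow> real) \<Rightarrow> 'm \<Rightarrow> real \<Rightarrow> bool" where
  "has_laplacian A g f p L \<longleftrightarrow> (\<forall>c\<in>charts_at A p.
     (\<Sum>i\<in>UNIV. partial i (\<lambda>x. vol_density A g c x *
         (\<Sum>j\<in>UNIV. gram_inv A g c x $ i $ j * partial j (f \<circ> point c) x)) (coords c p))
       / vol_density A g c (coords c p) = L)"

definition C2_on :: "('m, 'n::finite) chart set \<Rightarrow> 'm set \<Rightarrow> ('m \<Rightarrow> real) \<Rightarrow> bool" where
  "C2_on A \<Omega> f \<longleftrightarrow> (\<forall>c\<in>A. Ck_on 2 (coords c ` (dom c \<inter> \<Omega>)) (f \<circ> point c))"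

text \<open>Boundary smoothness: near each boundary point, some admissible chart maps \<open>\<Omega>\<close> onto the
  part of its image lying in an open coordinate half-space.\<close>

definition smooth_precompact_domain :: "('m::topological_space, 'n::finite) chart set \<Rightarrow> 'm set \<Rightarrow> bool" where
  "smooth_precompact_domain A \<Omega> \<longleftrightarrow>
     open \<Omega> \<and> connected \<Omega> \<and> compact (closure \<Omega>) \<and> frontier \<Omega> \<noteq> {} \<and>
     (\<forall>p\<in>frontier \<Omega>. \<exists>c k. admissible_chart A c \<and> p \<in> dom c \<and>
        (\<forall>q\<in>dom c. q \<in> \<Omega> \<longleftrightarrow> coords c q $ k > 0))"

text \<open>\<open>E\<close> is the classical solution of \<open>\<Delta>E = -1\<close> in \<open>\<Omega>\<close>, \<open>E = 0\<close> on \<open>\<partial>\<Omega>\<close>.\<close>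

definition torsion_function :: "('m::topological_space, 'n::finite) chart set \<Rightarrow> ('m, 'n) metric
    \<Rightarrow> 'm set \<Rightarrow> ('m \<Rightarrow> real) \<Rightarrow> bool" where
  "torsion_function A g \<Omega> E \<longleftrightarrow> C2_on A \<Omega> E \<and> continuous_on (closure \<Omega>) E \<and>
     (\<forall>p\<in>\<Omega>. has_laplacian A g E p (- 1)) \<and> (\<forall>p\<in>frontier \<Omega>. E p = 0)"

text \<open>To be used for the \<open>E\<close> with \<open>torsion_function A g \<Omega> E\<close>; it is unique on \<open>\<Omega>\<close> by the
  maximum principle.\<close>

definition torsional_rigidity :: "('m::topological_space, 'n::finite) chart set \<Rightarrow> ('m, 'n) metric
    \<Rightarrow> 'm set \<Rightarrow> ('m \<Rightarrow> real) \<Rightarrow> real" where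
  "torsional_rigidity A g \<Omega> E = (LINT p:\<Omega>|vol_measure A g. E p)"

end

theory Submission
  imports Defs
begin

text \<open>Since the scalar curvature is constant in space, \<open>det (g\<^sub>i\<^sub>j)\<close> solves the same linear
  differential equation at every point, so the Riemannian measures of \<open>g\<^sub>s\<close> and \<open>g\<^sub>t\<close> differ by a
  constant factor \<open>\<theta>(t) / \<theta>(s)\<close> with \<open>\<theta>' = - b \<theta>\<close>. If \<open>Ric\<close> has a sign, then \<open>g\<^sub>t\<close> is monotone in
  one direction, and \<open>g\<^sub>t / \<theta>(t)\<^sup>2\<close> in the other one because each eigenvalue of \<open>Ric\<close> lies between
  \<open>0\<close> and their sum \<open>b\<close>. Both claims thus follow from a comparison principle: if \<open>g\<^sub>s \<le> l g\<^sub>t\<close> and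
  the measures are proportional to \<open>\<mu>\<close>, then \<open>\<integral>E\<^sub>s d\<mu> \<le> l \<integral>E\<^sub>t d\<mu>\<close> over \<open>\<Omega>\<close>.

  As nothing is known about \<open>\<nabla>E\<close> near the boundary, the variational characterization of the
  torsional rigidity is replaced by Picone's identity for compactly supported functions: for a \<open>C\<^sup>1\<close>
  truncation \<open>\<phi>\<close> of \<open>E\<^sub>s\<close> with slope at most \<open>1\<close>, testing the two equations with \<open>\<phi>\<close> and with
  \<open>\<phi>\<^sup>2 / (l (E\<^sub>t + e))\<close> gives \<open>\<integral>\<phi>\<^sup>2 / (l (E\<^sub>t + e)) \<le> \<integral>\<phi>\<close>, hence \<open>\<integral>\<phi> \<le> l \<integral>(E\<^sub>t + e)\<close>.\<close>


section \<open>Linear algebra\<close>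

text \<open>The exponent 3 is produced by the rescaled metrics: there the comparison principle
  applies with \<open>l = (\<theta>(s) / \<theta>(t))\<^sup>2\<close>, which is the squared ratio of
  the volumes, so dividing the inequality for \<T>/V by the square of the volume absorbs
  \<open>l\<close> and leaves V^3.

  The shift \<open>e\<close> in the test function stands in for strict positivity of
  \<open>E\<^sub>t\<close>: only \<open>E\<^sub>t \<ge> 0\<close> is established, by testing the
  equation with a truncation of \<open>- E\<^sub>t\<close>. The slope bound on the truncation enters
  because the weak form controls the pairing of d\<phi> with \<open>dE\<^sub>s\<close>, whereas
  Picone's identity produces the squared length of d\<phi>; slopes in [0,1] make the second at most
  the first. The price is an error of order \<open>e\<close> times the volume, which vanishes in the
  limit.

  Another obstacle is that \<open>vol_measure\<close> is a definite description. Before any integral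
  means something, a measure with the prescribed chart densities has to be glued together and shown
  to be unique, which rests on the change of variables formula between overlapping charts.\<close>

lemma quadratic_nonneg_imp:
  fixes a b c :: real
  assumes "\<And>t. 0 \<le> a + 2 * t * b + t\<^sup>2 * c"
  shows "b\<^sup>2 \<le> a * c"
proof (cases "c = 0")
  case True
  have "b = 0"
  proof (rule ccontr)
    assume "b \<noteq> 0"
    \<comment> \<open>At this point the polynomial takes the value -1.\<close>
    with assms[of "- (a + 1) / (2 * b)"] True show False by (simp add: field_simps)
  qed
  with True show ?thesis by simp
next
  case False
  have c: "0 \<le> c"
  proof (rule ccontr)
    assume "\<not> 0 \<le> c"
    then have neg: "c < 0" by simp
    \<comment> \<open>Makes \<open>t\<^sup>2 * c\<close> equal to
      \<open>- (\<bar>a\<bar> + 1)\<close>. Adding the inequalities at \<open>t\<close> and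
      \<open>- t\<close> cancels the linear term and leaves a negative number.\<close>
    define t where "t = sqrt ((\<bar>a\<bar> + 1) / (- c))"
    have "t\<^sup>2 = (\<bar>a\<bar> + 1) / (- c)"
      unfolding t_def using neg by (intro real_sqrt_pow2 divide_nonneg_pos) auto
    then have "t\<^sup>2 * c = - (\<bar>a\<bar> + 1)" using neg by (simp add: field_simps)
    with assms[of t] assms[of "- t"] show False by simp
  qed
  with False have "0 < c" by simp
  with assms[of "- b / c"] show ?thesis
    by (simp add: field_simps power2_eq_square)
qed

text \<open>Symmetry is kept apart so that the Ricci matrix qualifies through the sign of its
  quadratic form alone.\<close>

definition psd :: "real^'n^'n \<Rightarrow> bool" where
  "psd M \<longleftrightarrow> (\<forall>x. 0 \<le> x \<bullet> (M *v x))"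

definition sym_mat :: "real^'n^'n \<Rightarrow> bool" where
  "sym_mat M \<longleftrightarrow> transpose M = M"

definition pos_def :: "real^'n^'n \<Rightarrow> bool" where
  "pos_def M \<longleftrightarrow> sym_mat M \<and> (\<forall>x. x \<noteq> 0 \<longrightarrow> 0 < x \<bullet> (M *v x))"

lemma sym_mat_inner: "sym_mat M \<Longrightarrow> x \<bullet> (M *v y) = y \<bullet> (M *v x)"
  by (metis dot_lmul_matrix inner_commute sym_mat_def vector_transpose_matrix)

lemma sym_mat_nth: "sym_mat M \<Longrightarrow> M $ i $ j = M $ j $ i"
  by (simp add: sym_mat_def transpose_def vec_eq_iff)

lemma pos_def_psd: "pos_def M \<Longrightarrow> psd M"
  unfolding pos_def_def psd_def by (metis inner_zero_left less_eq_real_def)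

lemma psd_Cauchy_Schwarz:
  fixes M :: "real^'n^'n"
  assumes "psd M" "sym_mat M"
  shows "(x \<bullet> (M *v y))\<^sup>2 \<le> (x \<bullet> (M *v x)) * (y \<bullet> (M *v y))"
proof (rule quadratic_nonneg_imp)
  fix t
  have "0 \<le> (x + t *\<^sub>R y) \<bullet> (M *v (x + t *\<^sub>R y))"
    using assms(1) unfolding psd_def by blast
  also have "\<dots> = x \<bullet> (M *v x) + 2 * t * (x \<bullet> (M *v y)) + t\<^sup>2 * (y \<bullet> (M *v y))"
    using sym_mat_inner[OF assms(2), of x y]
    by (simp add: matrix_vector_right_distrib matrix_vector_mult_scaleR inner_simps
        power2_eq_square algebra_simps)
  finally show "0 \<le> x \<bullet> (M *v x) + 2 * t * (x \<bullet> (M *v y)) + t\<^sup>2 * (y \<bullet> (M *v y))" .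
qed

lemma inner_matrix_vector_sum:
  fixes M :: "real^'n^'n"
  shows "x \<bullet> (M *v y) = (\<Sum>i\<in>UNIV. \<Sum>j\<in>UNIV. M $ i $ j * x $ i * y $ j)"
  by (simp add: inner_vec_def matrix_vector_mult_def sum_distrib_left algebra_simps)

lemma matrix_vector_axis:
  fixes M :: "real^'n^'m"
  shows "(M *v axis k 1) $ i = M $ i $ k"
  by (metis column_def matrix_vector_mult_basis vec_lambda_beta)

text \<open>Symmetric Gaussian elimination writes \<open>M\<close> as a sum of matrices \<open>v v\<^sup>T\<close>, one for each
  index in the support \<open>I\<close>.\<close>

lemma sum_psd_mult_psd_nonneg_aux:
  fixes M P :: "real^'n^'n"
  assumes "finite I" "psd P" "psd M" "sym_mat M"
    and "\<And>i j. i \<notin> I \<Longrightarrow> M $ i $ j = 0"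
  shows "0 \<le> (\<Sum>i\<in>UNIV. \<Sum>j\<in>UNIV. M $ i $ j * P $ i $ j)"
  using assms(1,3-)
proof (induction I arbitrary: M rule: finite_induct)
  case empty
  then show ?case by simp
next
  case (insert k I)
  define d where "d = M $ k $ k"
  have ax: "x \<bullet> (M *v axis k 1) = (\<Sum>i\<in>UNIV. x $ i * M $ i $ k)" for x
    by (simp only: inner_vec_def matrix_vector_axis inner_real_def)
  have dk: "axis k 1 \<bullet> (M *v axis k 1) = d"
    by (simp add: inner_axis' matrix_vector_axis d_def)
  have d0: "0 \<le> d"
    using insert.prems(1) dk unfolding psd_def by metis
  show ?case
  proof (cases "d = 0")
    case True
    \<comment> \<open>A zero pivot of a semidefinite symmetric matrix forces its whole column to
      vanish, so the support already lies in \<open>I\<close>.\<close>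
    have col: "M $ j $ k = 0" for j
    proof -
      have "(axis j 1 \<bullet> (M *v axis k 1))\<^sup>2 \<le> (axis j 1 \<bullet> (M *v axis j 1)) * (axis k 1 \<bullet> (M *v axis k 1))"
        by (rule psd_Cauchy_Schwarz[OF insert.prems(1,2)])
      then show ?thesis using dk True by (simp add: inner_axis' matrix_vector_axis)
    qed
    have "M $ i $ j = 0" if "i \<notin> I" for i j
    proof (cases "i = k")
      case True
      then show ?thesis using col[of j] sym_mat_nth[OF insert.prems(2), of i j] by simp
    next
      case False
      then show ?thesis using insert.prems(3) that by simp
    qed
    then show ?thesis using insert.IH[OF insert.prems(1,2)] by blast
  next
    case False
    define m where "m = (\<chi> i. M $ i $ k)"
    \<comment> \<open>The Schur complement of the pivot \<open>d\<close>: its row and column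
      \<open>k\<close> vanish, and Cauchy-Schwarz against \<open>axis k 1\<close> says exactly that
      it is still semidefinite.\<close>
    define N where "N = (\<chi> i j. M $ i $ j - m $ i * m $ j / d)"
    have mx: "x \<bullet> (M *v axis k 1) = m \<bullet> x" for x
      unfolding ax by (simp add: m_def inner_vec_def mult.commute)
    have Nq: "x \<bullet> (N *v x) = x \<bullet> (M *v x) - (m \<bullet> x)\<^sup>2 / d" for x
    proof -
      have "(m \<bullet> x)\<^sup>2 = (\<Sum>i\<in>UNIV. \<Sum>j\<in>UNIV. m $ i * m $ j * x $ i * x $ j)"
        by (simp add: inner_vec_def power2_eq_square sum_product algebra_simps)
      then show ?thesis
        unfolding inner_matrix_vector_sum N_def
        by (simp add: algebra_simps sum_subtractf sum_divide_distrib)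
    qed
    have "psd N" unfolding psd_def
    proof
      fix x
      have "(m \<bullet> x)\<^sup>2 \<le> (x \<bullet> (M *v x)) * d"
        using psd_Cauchy_Schwarz[OF insert.prems(1,2), of x "axis k 1"] unfolding dk unfolding mx .
      then show "0 \<le> x \<bullet> (N *v x)" using False d0 by (simp add: Nq field_simps)
    qed
    moreover have "sym_mat N"
      using sym_mat_nth[OF insert.prems(2)]
      by (simp add: sym_mat_def N_def transpose_def vec_eq_iff mult.commute)
    moreover have "N $ i $ j = 0" if "i \<notin> I" for i j
    proof (cases "i = k")
      case True
      then show ?thesis using False sym_mat_nth[OF insert.prems(2), of k j]
        by (simp add: N_def m_def d_def)
    next
      case False
      then show ?thesis using that insert.prems(3)[of i] by (simp add: N_def m_def)
    qed
    ultimately have "0 \<le> (\<Sum>i\<in>UNIV. \<Sum>j\<in>UNIV. N $ i $ j * P $ i $ j)"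
      by (intro insert.IH) auto
    moreover have "0 \<le> (\<Sum>i\<in>UNIV. \<Sum>j\<in>UNIV. P $ i $ j * m $ i * m $ j)"
      using \<open>psd P\<close> unfolding psd_def inner_matrix_vector_sum by blast
    then have "0 \<le> (\<Sum>i\<in>UNIV. \<Sum>j\<in>UNIV. P $ i $ j * m $ i * m $ j) / d"
      using d0 by simp
    \<comment> \<open>\<open>M\<close> is \<open>N\<close> plus a rank one matrix, and the latter
      pairs with \<open>P\<close> to the quadratic form of \<open>P\<close> at \<open>m\<close>,
      divided by \<open>d\<close>.\<close>
    moreover have "(\<Sum>i\<in>UNIV. \<Sum>j\<in>UNIV. M $ i $ j * P $ i $ j) =
       (\<Sum>i\<in>UNIV. \<Sum>j\<in>UNIV. N $ i $ j * P $ i $ j) +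
       (\<Sum>i\<in>UNIV. \<Sum>j\<in>UNIV. P $ i $ j * m $ i * m $ j) / d"
    proof -
      have "M $ i $ j * P $ i $ j = N $ i $ j * P $ i $ j + P $ i $ j * m $ i * m $ j / d" for i j
        by (simp add: N_def algebra_simps)
      then show ?thesis by (simp only: sum.distrib sum_divide_distrib)
    qed
    ultimately show ?thesis by linarith
  qed
qed

lemma sum_psd_mult_psd_nonneg:
  fixes M P :: "real^'n^'n"
  assumes "psd P" "psd M" "sym_mat M"
  shows "0 \<le> (\<Sum>i\<in>UNIV. \<Sum>j\<in>UNIV. M $ i $ j * P $ i $ j)"
  by (rule sum_psd_mult_psd_nonneg_aux[of UNIV]) (use assms in auto)

section \<open>Inverses and determinants of positive definite matrices\<close>

lemma pos_def_invertible:
  fixes G :: "real^'n^'n"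
  assumes "pos_def G"
  shows "invertible G"
proof -
  have "\<forall>x. G *v x = 0 \<longrightarrow> x = 0"
    using assms unfolding pos_def_def by (metis inner_zero_right less_irrefl)
  then show ?thesis
    using matrix_left_invertible_ker invertible_left_inverse by blast
qed

lemma matrix_inv_mult:
  fixes G :: "real^'n^'n"
  assumes "invertible G"
  shows "G ** matrix_inv G = mat 1" "matrix_inv G ** G = mat 1"
  using someI_ex[OF assms[unfolded invertible_def]] by (simp_all add: matrix_inv_def)

lemma matrix_inv_mult_vector [simp]:
  fixes G :: "real^'n^'n"
  assumes "invertible G"
  shows "G *v (matrix_inv G *v x) = x" "matrix_inv G *v (G *v x) = x"
  using matrix_inv_mult[OF assms] by (simp_all add: matrix_vector_mul_assoc)

lemma sym_mat_matrix_inv: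
  fixes G :: "real^'n^'n"
  assumes "invertible G" "sym_mat G"
  shows "sym_mat (matrix_inv G)"
proof -
  have "transpose (matrix_inv G) ** G = mat 1"
    using arg_cong[OF matrix_inv_mult(1)[OF assms(1)], of transpose] assms(2)
    by (simp add: matrix_transpose_mul sym_mat_def transpose_mat)
  then have "transpose (matrix_inv G) ** (G ** matrix_inv G) = matrix_inv G"
    by (simp add: matrix_mul_assoc)
  then show ?thesis by (simp add: sym_mat_def matrix_inv_mult[OF assms(1)])
qed

lemma inner_matrix_inv:
  fixes G :: "real^'n^'n"
  assumes "pos_def G"
  shows "x \<bullet> (matrix_inv G *v y) = (matrix_inv G *v x) \<bullet> (G *v (matrix_inv G *v y))"
proof -
  have inv: "invertible G" and s: "sym_mat G"
    using assms pos_def_invertible pos_def_def by auto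
  show ?thesis
    using sym_mat_inner[OF sym_mat_matrix_inv[OF inv s], of x y] inv by (simp add: inner_commute)
qed

lemma pos_def_matrix_inv:
  fixes G :: "real^'n^'n"
  assumes "pos_def G"
  shows "pos_def (matrix_inv G)"
proof -
  have inv: "invertible G" and s: "sym_mat G"
    using assms pos_def_invertible pos_def_def by auto
  have "0 < x \<bullet> (matrix_inv G *v x)" if "x \<noteq> 0" for x
  proof -
    have "matrix_inv G *v x \<noteq> 0"
      using that matrix_inv_mult_vector(1)[OF inv, of x] by auto
    then show ?thesis
      unfolding inner_matrix_inv[OF assms] using assms unfolding pos_def_def by blast
  qed
  then show ?thesis using sym_mat_matrix_inv[OF inv s] unfolding pos_def_def by blast
qed

text \<open>The segment from the identity to \<open>G\<close> consists of positive definite, hence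
  invertible matrices, so the determinant cannot lose its sign along it.\<close>

lemma pos_def_det_pos:
  fixes G :: "real^'n^'n"
  assumes "pos_def G"
  shows "0 < det G"
proof (rule ccontr)
  assume neg: "\<not> 0 < det G"
  define f where "f = (\<lambda>t. det ((1 - t) *\<^sub>R mat 1 + t *\<^sub>R G))"
  have "continuous_on {0..1} f"
    unfolding f_def det_def by (intro continuous_intros)
  moreover have "f 1 \<le> 0" "0 \<le> f 0"
    using neg by (auto simp: f_def)
  ultimately obtain t where t: "0 \<le> t" "t \<le> 1" "f t = 0"
    using IVT2'[of f 1 0 0] by auto
  define H where "H = (1 - t) *\<^sub>R mat 1 + t *\<^sub>R G"
  have q: "x \<bullet> (H *v x) = (1 - t) * (x \<bullet> x) + t * (x \<bullet> (G *v x))" for x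
    by (simp add: H_def matrix_vector_mult_add_rdistrib scaleR_matrix_vector_assoc[symmetric]
        inner_add_right)
  have "pos_def H" unfolding pos_def_def
  proof (intro conjI allI impI)
    show "sym_mat H"
      using assms unfolding H_def pos_def_def sym_mat_def
      by (simp add: transpose_def vec_eq_iff mat_def)
    fix x :: "real^'n" assume x: "x \<noteq> 0"
    then have "0 < x \<bullet> (G *v x)" "0 < x \<bullet> x" using assms by (auto simp: pos_def_def)
    then show "0 < x \<bullet> (H *v x)"
      unfolding q using t
      by (cases "t = 0") (auto intro!: add_nonneg_pos mult_pos_pos)
  qed
  then have "det H \<noteq> 0" using pos_def_invertible invertible_det_nz by blast
  then show False using t(3) by (simp add: f_def H_def)
qed

text \<open>With \<open>w = matrix_inv H *v x\<close> and \<open>q = x \<bullet> w\<close>,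
  Cauchy-Schwarz for \<open>G\<close> between \<open>matrix_inv G *v x\<close> and \<open>w\<close>
  bounds \<open>q\<^sup>2\<close> by \<open>x \<bullet> (matrix_inv G *v x)\<close> times
  \<open>l * q\<close>; dividing by \<open>q\<close> gives the claim without any square root or
  diagonalization of matrices.\<close>

lemma matrix_inv_antimono:
  fixes G H :: "real^'n^'n"
  assumes G: "pos_def G" and H: "pos_def H"
    and le: "\<And>x. x \<bullet> (G *v x) \<le> l * (x \<bullet> (H *v x))"
  shows "x \<bullet> (matrix_inv H *v x) \<le> l * (x \<bullet> (matrix_inv G *v x))"
proof -
  define w where "w = matrix_inv H *v x"
  have iG: "invertible G" and iH: "invertible H" using G H pos_def_invertible by auto
  define q where "q = x \<bullet> w"
  have q: "q = w \<bullet> (H *v w)"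
    using iH by (simp add: w_def q_def inner_commute)
  show ?thesis
  proof (cases "x = 0")
    case False
    have qpos: "0 < q"
      using pos_def_matrix_inv[OF H] False unfolding q_def w_def pos_def_def by blast
    have "q = (matrix_inv G *v x) \<bullet> (G *v w)"
      using iG sym_mat_inner[of G "matrix_inv G *v x" w] G
      by (simp add: q_def pos_def_def inner_commute)
    then have "q\<^sup>2 \<le> ((matrix_inv G *v x) \<bullet> (G *v (matrix_inv G *v x))) * (w \<bullet> (G *v w))"
      using psd_Cauchy_Schwarz[OF pos_def_psd[OF G]] G unfolding pos_def_def by blast
    also have "(matrix_inv G *v x) \<bullet> (G *v (matrix_inv G *v x)) = x \<bullet> (matrix_inv G *v x)"
      by (simp add: inner_matrix_inv[OF G])
    also have "(x \<bullet> (matrix_inv G *v x)) * (w \<bullet> (G *v w)) \<le> (x \<bullet> (matrix_inv G *v x)) * (l * q)"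
      using le[of w] pos_def_psd[OF pos_def_matrix_inv[OF G]] unfolding q psd_def
      by (intro mult_left_mono) auto
    finally have "q * q \<le> (l * (x \<bullet> (matrix_inv G *v x))) * q"
      by (simp add: power2_eq_square algebra_simps)
    then have "q \<le> l * (x \<bullet> (matrix_inv G *v x))"
      using qpos by (rule mult_right_le_imp_le)
    then show ?thesis by (simp add: q_def w_def)
  qed simp
qed

text \<open>By Cauchy-Schwarz the inverse of \<open>G\<close> dominates the rank one matrix of
  \<open>v\<close> divided by \<open>v \<bullet> (G *v v)\<close>; pairing the difference with
  \<open>P\<close> gives a nonnegative number. This expresses that an eigenvalue is at most the
  trace.\<close>

lemma psd_le_trace:
  fixes G P :: "real^'n^'n"
  assumes G: "pos_def G" and P: "psd P"
  shows "v \<bullet> (P *v v) \<le> (\<Sum>i\<in>UNIV. \<Sum>j\<in>UNIV. matrix_inv G $ i $ j * P $ i $ j) * (v \<bullet> (G *v v))"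
proof (cases "v = 0")
  case False
  define d where "d = v \<bullet> (G *v v)"
  have d: "0 < d" using G False unfolding d_def pos_def_def by blast
  define M where "M = (\<chi> i j. matrix_inv G $ i $ j - v $ i * v $ j / d)"
  have inv: "invertible G" and sG: "sym_mat G" using G pos_def_invertible pos_def_def by auto
  have "psd M" unfolding psd_def
  proof
    fix x
    have "(v \<bullet> x)\<^sup>2 = (\<Sum>i\<in>UNIV. \<Sum>j\<in>UNIV. v $ i * v $ j * x $ i * x $ j)"
      by (simp add: inner_vec_def power2_eq_square sum_product algebra_simps)
    then have e: "x \<bullet> (M *v x) = x \<bullet> (matrix_inv G *v x) - (v \<bullet> x)\<^sup>2 / d"
      unfolding inner_matrix_vector_sum M_def
      by (simp add: algebra_simps sum_subtractf sum_divide_distrib)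
    have "v \<bullet> x = v \<bullet> (G *v (matrix_inv G *v x))" using inv by simp
    then have "(v \<bullet> x)\<^sup>2 \<le> d * (x \<bullet> (matrix_inv G *v x))"
      using psd_Cauchy_Schwarz[OF pos_def_psd[OF G] sG, of v "matrix_inv G *v x"]
      by (simp add: d_def inner_matrix_inv[OF G] inv)
    then show "0 \<le> x \<bullet> (M *v x)" using d by (simp add: e field_simps)
  qed
  moreover have "sym_mat M"
    using sym_mat_nth[OF sym_mat_matrix_inv[OF inv sG]]
    by (simp add: sym_mat_def M_def transpose_def vec_eq_iff mult.commute)
  ultimately have "0 \<le> (\<Sum>i\<in>UNIV. \<Sum>j\<in>UNIV. M $ i $ j * P $ i $ j)"
    using P sum_psd_mult_psd_nonneg by blast
  also have "\<dots> = (\<Sum>i\<in>UNIV. \<Sum>j\<in>UNIV. matrix_inv G $ i $ j * P $ i $ j) - (v \<bullet> (P *v v)) / d"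
    unfolding inner_matrix_vector_sum
    by (simp add: M_def algebra_simps sum_subtractf sum_divide_distrib)
  finally show ?thesis using d by (simp add: d_def[symmetric] field_simps)
qed simp

section \<open>Derivative of the determinant\<close>

lemma has_field_derivative_prod_within:
  fixes f :: "'i \<Rightarrow> real \<Rightarrow> real"
  assumes "\<And>i. i \<in> I \<Longrightarrow> (f i has_real_derivative f' i) (at t within S)"
  shows "((\<lambda>s. \<Prod>i\<in>I. f i s) has_real_derivative (\<Sum>i\<in>I. f' i * (\<Prod>j\<in>I - {i}. f j t))) (at t within S)"
  using assms
proof (induction I rule: infinite_finite_induct)
  case (insert x A)
  have eq: "insert x A - {y} = insert x (A - {y})" if "y \<in> A" for y
    using insert.hyps that by auto
  show ?case
    using insert.hyps
    by (auto intro!: derivative_eq_intros insert.prems insert.IH sum.cong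
             simp: sum_distrib_left sum_distrib_right eq)
qed auto

text \<open>Jacobi's formula. The Leibniz expansion is differentiated one row at a time, and
  Cramer's rule evaluates each determinant with a replaced row.\<close>

lemma has_real_derivative_det:
  fixes M :: "real \<Rightarrow> real^'n^'n" and D :: "real^'n^'n"
  assumes M': "\<And>i j. ((\<lambda>s. M s $ i $ j) has_real_derivative D $ i $ j) (at t within S)"
    and inv: "invertible (M t)"
  shows "((\<lambda>s. det (M s)) has_real_derivative
           det (M t) * (\<Sum>i\<in>UNIV. \<Sum>j\<in>UNIV. matrix_inv (M t) $ j $ i * D $ i $ j)) (at t within S)"
proof -
  define G where "G = M t"
  define R where "R k = (\<chi> i. if i = k then D $ i else G $ i)" for k
  have "((\<lambda>s. det (M s)) has_real_derivative (\<Sum>p | p permutes (UNIV::'n set). of_int (sign p) *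
      (\<Sum>k\<in>UNIV. D $ k $ p k * (\<Prod>j\<in>UNIV - {k}. G $ j $ p j)))) (at t within S)"
    unfolding det_def G_def
    by (intro DERIV_sum DERIV_cmult has_field_derivative_prod_within M')
  moreover have "(\<Sum>p | p permutes (UNIV::'n set). of_int (sign p) *
      (\<Sum>k\<in>UNIV. D $ k $ p k * (\<Prod>j\<in>UNIV - {k}. G $ j $ p j))) = (\<Sum>k\<in>UNIV. det (R k))"
  proof -
    have "D $ k $ p k * (\<Prod>j\<in>UNIV - {k}. G $ j $ p j) = (\<Prod>j\<in>UNIV. R k $ j $ p j)" for k and p :: "'n \<Rightarrow> 'n"
      by (subst prod.remove[of UNIV k]) (auto simp: R_def intro!: prod.cong)
    then show ?thesis
      unfolding det_def by (simp add: sum_distrib_left sum.swap[of _ UNIV])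
  qed
  moreover have "det (R k) = det G * (\<Sum>j\<in>UNIV. matrix_inv G $ j $ k * D $ k $ j)" for k
  proof -
    \<comment> \<open>The coordinates of the new row \<open>D $ k\<close> in the basis formed by the
      rows of \<open>G\<close>; replacing row \<open>k\<close> multiplies the determinant by the
      \<open>k\<close>-th of them.\<close>
    define x where "x = D $ k v* matrix_inv G"
    have "matrix_inv G ** G = mat 1" using matrix_inv_mult[OF inv] by (simp add: G_def)
    then have "x v* G = D $ k" by (simp add: x_def vector_matrix_mul_assoc)
    then have s: "(\<Sum>i\<in>UNIV. x $ i *s row i G) = D $ k"
      by (simp add: vec_eq_iff row_def vector_matrix_mult_def mult.commute)
    have "R k = (\<chi> i. if i = k then (\<Sum>i\<in>UNIV. x $ i *s row i G) else row i G)"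
      unfolding s by (simp add: R_def row_def vec_eq_iff)
    then have "det (R k) = x $ k * det G"
      by (simp add: cramer_lemma_transpose)
    also have "x $ k = (\<Sum>j\<in>UNIV. matrix_inv G $ j $ k * D $ k $ j)"
      by (simp add: x_def vector_matrix_mult_def mult.commute)
    finally show ?thesis by simp
  qed
  ultimately show ?thesis by (simp add: G_def sum_distrib_left)
qed


section \<open>Functions of class \<open>C\<^sup>1\<close>\<close>

definition grad :: "(real^'n \<Rightarrow> real) \<Rightarrow> real^'n \<Rightarrow> real^'n" where
  "grad f x = (\<chi> i. partial i f x)"

text \<open>\<open>grad\<close> is a total function and carries no information where the derivative
  fails to exist, hence the explicit derivative clause.\<close>

definition C1_on :: "(real^'n) set \<Rightarrow> (real^'n \<Rightarrow> real) \<Rightarrow> bool" where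
  "C1_on U f \<longleftrightarrow> (\<forall>x\<in>U. (f has_derivative (\<lambda>h. grad f x \<bullet> h)) (at x)) \<and> continuous_on U (grad f)"

lemma grad_nth [simp]: "grad f x $ i = partial i f x"
  by (simp add: grad_def)

lemma grad_eq:
  assumes "(f has_derivative (\<lambda>h. d \<bullet> h)) (at x)"
  shows "grad f x = d"
proof -
  have "frechet_derivative f (at x) = (\<lambda>h. d \<bullet> h)"
    using frechet_derivative_at[OF assms] by simp
  then show ?thesis by (simp add: grad_def partial_def vec_eq_iff inner_axis)
qed

lemma differentiable_has_grad:
  fixes f :: "real^'n \<Rightarrow> real"
  assumes "f differentiable (at x)"
  shows "(f has_derivative (\<lambda>h. grad f x \<bullet> h)) (at x)"
proof -
  have l: "linear (frechet_derivative f (at x))"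
    using assms frechet_derivative_works has_derivative_linear by blast
  have "frechet_derivative f (at x) h = grad f x \<bullet> h" for h
  proof -
    have "frechet_derivative f (at x) h = frechet_derivative f (at x) (\<Sum>i\<in>UNIV. h $ i *\<^sub>R axis i 1)"
      by (simp add: basis_expansion scalar_mult_eq_scaleR[symmetric])
    also have "\<dots> = grad f x \<bullet> h"
      using l by (simp add: linear_sum linear_scale inner_vec_def partial_def mult.commute)
    finally show ?thesis .
  qed
  then show ?thesis using assms frechet_derivative_works by (metis (no_types, lifting) ext)
qed

lemma C1_onI:
  assumes "\<And>x. x \<in> U \<Longrightarrow> (f has_derivative (\<lambda>h. D x \<bullet> h)) (at x)" "continuous_on U D"
  shows "C1_on U f"
proof -
  have "grad f x = D x" if "x \<in> U" for x using grad_eq assms(1) that by blast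
  then show ?thesis using assms by (auto simp: C1_on_def cong: continuous_on_cong_simp)
qed

lemma C1_onD:
  assumes "C1_on U f"
  shows "x \<in> U \<Longrightarrow> (f has_derivative (\<lambda>h. grad f x \<bullet> h)) (at x)" "continuous_on U (grad f)"
  using assms by (auto simp: C1_on_def)

lemma C1_on_continuous: "C1_on U f \<Longrightarrow> continuous_on U f"
  by (meson C1_onD(1) continuous_at_imp_continuous_on has_derivative_continuous)

lemma C1_on_continuous_partial: "C1_on U f \<Longrightarrow> continuous_on U (partial i f)"
  using continuous_on_component[OF C1_onD(2), of U f i] by simp

lemma C1_on_subset: "C1_on U f \<Longrightarrow> V \<subseteq> U \<Longrightarrow> C1_on V f"
  by (auto simp: C1_on_def intro: continuous_on_subset)

lemma C1_on_const: "C1_on U (\<lambda>x. c)"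
  by (rule C1_onI[where D = "\<lambda>x. 0"]) auto

lemma has_grad_cong:
  assumes "open U" "x \<in> U" "\<And>y. y \<in> U \<Longrightarrow> f y = g y"
    and "(f has_derivative (\<lambda>h. grad f x \<bullet> h)) (at x)"
  shows "(g has_derivative (\<lambda>h. grad f x \<bullet> h)) (at x)" "grad g x = grad f x"
proof -
  show "(g has_derivative (\<lambda>h. grad f x \<bullet> h)) (at x)"
    using has_derivative_transform_within_open assms by blast
  then show "grad g x = grad f x" by (rule grad_eq)
qed

text \<open>Valid also at points of non-differentiability: both functions have the same candidates
  for a derivative at \<open>x\<close>, so the choice inside \<open>frechet_derivative\<close> is
  the same.\<close>

lemma grad_cong:
  fixes f g :: "real^'n \<Rightarrow> real"
  assumes "open U" "x \<in> U" "\<And>y. y \<in> U \<Longrightarrow> f y = g y"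
  shows "grad g x = grad f x"
proof -
  have "(f has_derivative D) (at x) \<longleftrightarrow> (g has_derivative D) (at x)" for D
    using has_derivative_transform_within_open[of f D x UNIV U g]
      has_derivative_transform_within_open[of g D x UNIV U f] assms by auto
  then have "frechet_derivative f (at x) = frechet_derivative g (at x)"
    unfolding frechet_derivative_def by simp
  then show ?thesis by (simp add: grad_def partial_def)
qed

lemma C1_on_cong:
  assumes "open U" "\<And>y. y \<in> U \<Longrightarrow> f y = g y" "C1_on U f"
  shows "C1_on U g"
proof (rule C1_onI)
  show "(g has_derivative (\<lambda>h. grad f x \<bullet> h)) (at x)" if "x \<in> U" for x
    using has_grad_cong(1) assms that C1_onD(1) by blast
  show "continuous_on U (grad f)" using assms C1_onD by blast
qed

lemma C1_on_Un:
  assumes "open U" "open V" "C1_on U f" "C1_on V f"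
  shows "C1_on (U \<union> V) f"
  using assms unfolding C1_on_def by (auto intro: continuous_on_open_Un)

text \<open>\<open>U\<close> and the complement of \<open>K\<close> are open and cover the space,
  and \<open>f\<close> is of class \<open>C1_on\<close> on each of them.\<close>

lemma C1_on_zero_extension:
  assumes "open U" "closed K" "K \<subseteq> U" "C1_on U f" "\<And>x. x \<notin> K \<Longrightarrow> f x = 0"
  shows "C1_on UNIV f"
proof -
  have "C1_on (- K) f"
    by (rule C1_on_cong[OF _ _ C1_on_const[of _ 0]]) (use assms in auto)
  then have "C1_on (U \<union> - K) f"
    using assms by (intro C1_on_Un) auto
  moreover have "U \<union> - K = UNIV" using assms by auto
  ultimately show ?thesis by simp
qed

lemma C1_on_add: "C1_on U f \<Longrightarrow> C1_on U g \<Longrightarrow> C1_on U (\<lambda>x. f x + g x)"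
  by (rule C1_onI[where D = "\<lambda>x. grad f x + grad g x"])
    (auto simp: inner_add_left intro!: derivative_eq_intros continuous_intros dest: C1_onD)

lemma C1_on_mult:
  assumes "C1_on U f" "C1_on U g"
  shows "C1_on U (\<lambda>x. f x * g x)"
    and "x \<in> U \<Longrightarrow> grad (\<lambda>x. f x * g x) x = f x *\<^sub>R grad g x + g x *\<^sub>R grad f x"
proof -
  have D: "((\<lambda>x. f x * g x) has_derivative (\<lambda>h. (f x *\<^sub>R grad g x + g x *\<^sub>R grad f x) \<bullet> h)) (at x)"
    if "x \<in> U" for x
    using has_derivative_mult[OF C1_onD(1)[OF assms(1) that] C1_onD(1)[OF assms(2) that]]
    by (simp add: inner_add_left algebra_simps)
  show "C1_on U (\<lambda>x. f x * g x)"
    by (rule C1_onI[OF D]) (auto intro!: continuous_intros C1_on_continuous C1_onD(2) assms)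
  show "grad (\<lambda>x. f x * g x) x = f x *\<^sub>R grad g x + g x *\<^sub>R grad f x" if "x \<in> U"
    using grad_eq[OF D[OF that]] .
qed

lemma C1_on_sum: "(\<And>i. i \<in> I \<Longrightarrow> C1_on U (f i)) \<Longrightarrow> C1_on U (\<lambda>x. \<Sum>i\<in>I. f i x)"
  by (induction I rule: infinite_finite_induct) (auto intro: C1_on_const C1_on_add)

lemma C1_on_prod: "(\<And>i. i \<in> I \<Longrightarrow> C1_on U (f i)) \<Longrightarrow> C1_on U (\<lambda>x. \<Prod>i\<in>I. f i x)"
  by (induction I rule: infinite_finite_induct) (auto intro: C1_on_const C1_on_mult)

lemma C1_on_compose:
  assumes "C1_on U f" "f ` U \<subseteq> V"
    and "\<And>y. y \<in> V \<Longrightarrow> (\<phi> has_real_derivative \<phi>' y) (at y)" "continuous_on V \<phi>'"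
  shows "C1_on U (\<lambda>x. \<phi> (f x))"
    and "x \<in> U \<Longrightarrow> grad (\<lambda>x. \<phi> (f x)) x = \<phi>' (f x) *\<^sub>R grad f x"
proof -
  have D: "((\<lambda>x. \<phi> (f x)) has_derivative (\<lambda>h. (\<phi>' (f x) *\<^sub>R grad f x) \<bullet> h)) (at x)"
    if "x \<in> U" for x
  proof -
    have "(\<phi> has_derivative (*) (\<phi>' (f x))) (at (f x))"
      using assms(2,3) that by (auto simp: has_field_derivative_def)
    from has_derivative_compose[OF C1_onD(1)[OF assms(1) that] this]
    show ?thesis by (simp add: mult.commute)
  qed
  have "continuous_on U (\<lambda>x. \<phi>' (f x))"
    using continuous_on_compose2[OF assms(4) C1_on_continuous[OF assms(1)] assms(2)] .
  then show "C1_on U (\<lambda>x. \<phi> (f x))"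
    by (intro C1_onI[OF D]) (auto intro!: continuous_intros C1_onD(2) assms)
  show "grad (\<lambda>x. \<phi> (f x)) x = \<phi>' (f x) *\<^sub>R grad f x" if "x \<in> U"
    using grad_eq[OF D[OF that]] .
qed

lemma C1_on_inverse:
  assumes "C1_on U f" "\<And>x. x \<in> U \<Longrightarrow> f x \<noteq> 0"
  shows "C1_on U (\<lambda>x. inverse (f x))"
  by (rule C1_on_compose(1)[OF assms(1), where V = "- {0}" and \<phi>' = "\<lambda>y. - (inverse y * inverse y)"])
    (use assms(2) in \<open>auto intro!: derivative_eq_intros continuous_intros\<close>)

lemma C1_on_divide:
  assumes "C1_on U f" "C1_on U g" "\<And>x. x \<in> U \<Longrightarrow> g x \<noteq> 0"
  shows "C1_on U (\<lambda>x. f x / g x)"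
  unfolding divide_inverse by (intro C1_on_mult(1) C1_on_inverse assms)

lemma C1_on_det:
  fixes M :: "real^'n \<Rightarrow> real^'m^'m"
  assumes "\<And>i j. C1_on U (\<lambda>x. M x $ i $ j)"
  shows "C1_on U (\<lambda>x. det (M x))"
  unfolding det_def by (intro C1_on_sum C1_on_mult(1) C1_on_const C1_on_prod assms)

text \<open>By Cramer's rule each entry of the inverse is a quotient of determinants, and these are
  polynomials in the entries of \<open>M\<close>.\<close>

lemma C1_on_matrix_inv:
  fixes M :: "real^'n \<Rightarrow> real^'m^'m"
  assumes M: "\<And>i j. C1_on U (\<lambda>x. M x $ i $ j)" and inv: "\<And>x. x \<in> U \<Longrightarrow> invertible (M x)"
    and U: "open U"
  shows "C1_on U (\<lambda>x. matrix_inv (M x) $ i $ j)"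
proof -
  define N where "N x = (\<chi> a b. if b = i then axis j 1 $ a else M x $ a $ b)" for x
  have "C1_on U (\<lambda>x. det (N x) / det (M x))"
  proof (intro C1_on_divide C1_on_det M)
    show "C1_on U (\<lambda>x. N x $ a $ b)" for a b
      by (cases "b = i") (auto simp: N_def intro: M C1_on_const)
    show "det (M x) \<noteq> 0" if "x \<in> U" for x
      using inv[OF that] invertible_det_nz by blast
  qed
  moreover have "det (N x) / det (M x) = matrix_inv (M x) $ i $ j" if "x \<in> U" for x
  proof -
    have dx: "det (M x) \<noteq> 0"
      using inv[OF that] invertible_det_nz by blast
    have "M x *v (matrix_inv (M x) *v axis j 1) = axis j 1"
      using inv[OF that] by simp
    from this[unfolded cramer[OF dx]] show ?thesis
      by (metis (no_types, lifting) N_def matrix_vector_axis vec_lambda_beta)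
  qed
  ultimately show ?thesis by (rule C1_on_cong[OF U, rotated])
qed

section \<open>From \<open>Ck_on\<close> and \<open>smooth_on\<close> to
  \<open>C1_on\<close>\<close>

lemma Ck_on_continuous: "Ck_on k U f \<Longrightarrow> continuous_on U f"
  by (cases k) (auto intro!: continuous_at_imp_continuous_on differentiable_imp_continuous_within)

lemma Ck_on_Suc_imp_Ck_on_1: "Ck_on (Suc k) U f \<Longrightarrow> Ck_on 1 U f"
  by (auto simp: One_nat_def intro: Ck_on_continuous)

lemma Ck_on_1_C1_on:
  fixes f :: "real^'n \<Rightarrow> real"
  assumes "Ck_on 1 U f"
  shows "C1_on U f"
proof -
  have d: "\<And>x. x \<in> U \<Longrightarrow> f differentiable (at x)"
    and c: "continuous_on U (\<lambda>x. frechet_derivative f (at x) (axis i 1))" for i :: 'n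
    using assms by (auto simp: One_nat_def Basis_vec_def)
  have "continuous_on U (\<lambda>x. \<chi> i. frechet_derivative f (at x) (axis i 1))"
    by (intro continuous_on_vec_lambda c)
  then have "continuous_on U (grad f)"
    by (simp add: grad_def partial_def[abs_def] cong: continuous_on_cong)
  with d show ?thesis by (simp add: C1_on_def differentiable_has_grad)
qed

lemma Ck_on_2_C1_on:
  fixes f :: "real^'n \<Rightarrow> real"
  assumes "Ck_on 2 U f"
  shows "C1_on U f" "C1_on U (partial i f)"
proof -
  have *: "Ck_on (Suc (Suc 0)) U f" using assms by (simp only: numeral_2_eq_2)
  then show "C1_on U f" using Ck_on_Suc_imp_Ck_on_1 Ck_on_1_C1_on by blast
  have "axis i 1 \<in> (Basis :: (real^'n) set)" by simp
  then have "Ck_on (Suc 0) U (\<lambda>x. frechet_derivative f (at x) (axis i 1))"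
    using * by (simp only: Ck_on.simps(2)[of "Suc 0"])
  then have "Ck_on 1 U (partial i f)" by (simp only: partial_def[abs_def] One_nat_def)
  then show "C1_on U (partial i f)" by (rule Ck_on_1_C1_on)
qed

text \<open>On an open set the local extensions agree with \<open>f\<close> near the given point and
  therefore hand down their derivatives.\<close>

lemma smooth_on_open_Ck_1:
  assumes "smooth_on U f" "open U"
  shows "Ck_on 1 U f"
proof -
  have *: "f differentiable (at x) \<and> (\<forall>v\<in>Basis. continuous (at x) (\<lambda>x. frechet_derivative f (at x) v))"
    if "x \<in> U" for x
  proof -
    obtain W F where W: "open W" "x \<in> W" "\<And>k. Ck_on k W F" "\<And>y. y \<in> U \<inter> W \<Longrightarrow> F y = f y"
      using bspec[OF assms(1)[unfolded smooth_on_def] \<open>x \<in> U\<close>] by auto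
    have op: "open (U \<inter> W)" using W assms by auto
    have F: "\<And>y. y \<in> W \<Longrightarrow> F differentiable (at y)"
      "\<And>v. v \<in> Basis \<Longrightarrow> continuous_on W (\<lambda>x. frechet_derivative F (at x) v)"
      using W(3)[of 1] by (auto simp: One_nat_def)
    have f: "f differentiable (at y)" "frechet_derivative f (at y) = frechet_derivative F (at y)"
      if "y \<in> U \<inter> W" for y
    proof -
      have "(F has_derivative frechet_derivative F (at y)) (at y)"
        using F(1) that frechet_derivative_works by blast
      then have *: "(f has_derivative frechet_derivative F (at y)) (at y)"
        using has_derivative_transform_within_open op that W(4) by blast
      then show "f differentiable (at y)" by (auto simp: differentiable_def)
      show "frechet_derivative f (at y) = frechet_derivative F (at y)"
        using frechet_derivative_at[OF *] by simp
    qed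
    have "continuous_on (U \<inter> W) (\<lambda>x. frechet_derivative f (at x) v)" if "v \<in> Basis" for v
      using f(2) continuous_on_subset[OF F(2)[OF that], of "U \<inter> W"]
      by (subst continuous_on_cong[OF refl, where g = "\<lambda>x. frechet_derivative F (at x) v"]) auto
    then show ?thesis
      using f(1)[of x] op W(2) that by (auto simp: continuous_on_eq_continuous_at)
  qed
  then show ?thesis
    by (auto simp: One_nat_def intro!: continuous_at_imp_continuous_on)
qed

lemma Ck_on_1_linear:
  assumes "Ck_on 1 U f" "bounded_linear L"
  shows "Ck_on 1 U (\<lambda>x. L (f x))"
proof -
  have d: "((\<lambda>x. L (f x)) has_derivative (\<lambda>h. L (frechet_derivative f (at x) h))) (at x)" if "x \<in> U" for x
  proof -
    have "(f has_derivative frechet_derivative f (at x)) (at x)"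
      using assms(1) that frechet_derivative_works by (auto simp: One_nat_def)
    from bounded_linear.has_derivative[OF assms(2) this] show ?thesis .
  qed
  have "continuous_on U (\<lambda>x. L (frechet_derivative f (at x) v))" if "v \<in> Basis" for v
    using assms that by (intro bounded_linear.continuous_on[OF assms(2)]) (auto simp: One_nat_def)
  moreover have "frechet_derivative (\<lambda>x. L (f x)) (at x) v = L (frechet_derivative f (at x) v)"
    if "x \<in> U" for x v
    using frechet_derivative_at[OF d[OF that], symmetric] by simp
  moreover have "(\<lambda>x. L (f x)) differentiable (at x)" if "x \<in> U" for x
    using d[OF that] differentiableI by blast
  ultimately show ?thesis
    by (auto simp: One_nat_def cong: continuous_on_cong_simp)
qed

lemma C1_on_chain:
  fixes T :: "real^'n \<Rightarrow> real^'n" and f :: "real^'n \<Rightarrow> real"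
  assumes "Ck_on 1 U T" "C1_on V f" "T ` U \<subseteq> V"
  shows "C1_on U (f \<circ> T)"
    and "x \<in> U \<Longrightarrow> partial i (f \<circ> T) x = grad f (T x) \<bullet> frechet_derivative T (at x) (axis i 1)"
proof -
  have dT: "(T has_derivative frechet_derivative T (at x)) (at x)" if "x \<in> U" for x
    using assms(1) that frechet_derivative_works by (auto simp: One_nat_def)
  have cT: "continuous_on U (\<lambda>x. frechet_derivative T (at x) (axis i 1))" for i
    using assms(1) by (auto simp: One_nat_def)
  define D where "D x = (\<chi> i. grad f (T x) \<bullet> frechet_derivative T (at x) (axis i 1))" for x
  have d0: "((f \<circ> T) has_derivative (\<lambda>h. grad f (T x) \<bullet> frechet_derivative T (at x) h)) (at x)"
    if "x \<in> U" for x
    using diff_chain_at[OF dT[OF that] C1_onD(1)[OF assms(2)]] assms(3) that by (auto simp: o_def)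
  have "continuous_on U (\<lambda>x. grad f (T x))"
    by (rule continuous_on_compose2[OF C1_onD(2)[OF assms(2)] _ assms(3)])
      (rule Ck_on_continuous[OF assms(1)])
  then have "continuous_on U D"
    unfolding D_def by (intro continuous_on_vec_lambda continuous_on_inner cT)
  moreover have g: "(f \<circ> T) differentiable (at x)" "grad (f \<circ> T) x = D x" if "x \<in> U" for x
    using d0[OF that] frechet_derivative_at[OF d0[OF that], symmetric]
    by (auto simp: differentiable_def grad_def partial_def D_def vec_eq_iff)
  ultimately show "C1_on U (f \<circ> T)"
    using differentiable_has_grad[OF g(1)] by (intro C1_onI[where D = D]) simp_all
  show "partial i (f \<circ> T) x = grad f (T x) \<bullet> frechet_derivative T (at x) (axis i 1)" if "x \<in> U"
    using arg_cong[OF g(2)[OF that], of "\<lambda>v. v $ i"] by (simp add: D_def)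
qed

section \<open>Integrals of compactly supported functions\<close>

lemma integrable_continuous_compact_support:
  fixes f :: "'a::euclidean_space \<Rightarrow> real"
  assumes "compact K" "continuous_on UNIV f" "\<And>x. x \<notin> K \<Longrightarrow> f x = 0"
  shows "integrable lborel f"
proof -
  have "integrable lborel (\<lambda>x. indicator K x *\<^sub>R f x)"
    by (rule borel_integrable_compact) (use assms in \<open>auto intro: continuous_on_subset\<close>)
  moreover have "(\<lambda>x. indicator K x *\<^sub>R f x) = f"
    using assms(3) by (auto simp: indicator_def fun_eq_iff)
  ultimately show ?thesis by simp
qed

text \<open>By translation invariance all difference quotients of \<open>F\<close> have integral zero.\<close>

lemma integral_partial_compact_support:
  fixes F :: "real^'n \<Rightarrow> real"
  assumes F: "C1_on UNIV F" and K: "compact K" and supp: "\<And>x. x \<notin> K \<Longrightarrow> F x = 0"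
  shows "integrable lborel (partial i F)" "(\<integral>x. partial i F x \<partial>lborel) = 0"
proof -
  have g0: "grad F x = 0" if "x \<notin> K" for x
    using grad_cong[of "- K" x "\<lambda>x. 0" F] supp that K grad_eq[of "\<lambda>x. 0" 0 x]
    by (auto simp: compact_imp_closed open_Compl)
  have cg: "continuous_on UNIV (grad F)" using C1_onD(2)[OF F] .
  have cF: "continuous_on UNIV F" using C1_on_continuous[OF F] .
  have p0: "partial i F x = 0" if "x \<notin> K" for x
    using arg_cong[OF g0[OF that], of "\<lambda>v. v $ i"] by simp
  show int_p: "integrable lborel (partial i F)"
    by (rule integrable_continuous_compact_support[OF K C1_on_continuous_partial[OF F] p0])
  have int_F: "integrable lborel F"
    by (rule integrable_continuous_compact_support[OF K cF supp])
  obtain R where R: "\<And>x. x \<in> K \<Longrightarrow> norm x \<le> R"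
    using compact_imp_bounded[OF K] bounded_iff by blast
  have "compact (grad F ` K)"
    by (rule compact_continuous_image[OF continuous_on_subset[OF cg] K]) simp
  then obtain B0 where B0: "\<And>x. x \<in> K \<Longrightarrow> norm (grad F x) \<le> B0"
    using compact_imp_bounded bounded_iff by (metis (no_types, lifting) imageI)
  \<comment> \<open>For empty \<open>K\<close> the bound \<open>B0\<close> may be negative, which a
    Lipschitz constant must not be.\<close>
  define B where "B = max B0 0"
  have B: "norm (grad F x) \<le> B" "0 \<le> B" for x
    using B0[of x] g0[of x] by (cases "x \<in> K") (auto simp: B_def)
  have lip: "norm (F y - F x) \<le> B * norm (y - x)" for x y
  proof (rule differentiable_bound[of UNIV F "\<lambda>x h. grad F x \<bullet> h"])
    show "onorm (\<lambda>h. grad F x \<bullet> h) \<le> B" for x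
    proof (rule onorm_bound)
      show "norm (grad F x \<bullet> h) \<le> B * norm h" for h
        using Cauchy_Schwarz_ineq2[of "grad F x" h] mult_right_mono[OF B(1), of "norm h" x]
        by simp
    qed (rule B)
  qed (use C1_onD(1)[OF F] in auto)
  define e where "e = (axis i 1 :: real^'n)"
  have ne: "norm e = 1" by (simp add: e_def)
  define t where "t n = 1 / real (Suc n)" for n
  have t: "0 < t n" "t n \<le> 1" for n by (auto simp: t_def)
  define s where "s n x = (F (t n *\<^sub>R e + x) - F x) / t n" for n x
  have tr: "integrable lborel (\<lambda>x. F (c + x))" "(\<integral>x. F (c + x) \<partial>lborel) = (\<integral>x. F x \<partial>lborel)" for c
  proof -
    have m: "F \<in> borel_measurable borel" using cF by (simp add: borel_measurable_continuous_onI)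
    show "(\<integral>x. F (c + x) \<partial>lborel) = (\<integral>x. F x \<partial>lborel)"
      using integral_distr[of "(+) c" lborel borel F] m by (simp add: lborel_distr_plus)
    show "integrable lborel (\<lambda>x. F (c + x))"
      using integrable_distr_eq[of "(+) c" lborel borel F] m int_F by (simp add: lborel_distr_plus)
  qed
  have int_s: "(\<integral>x. s n x \<partial>lborel) = 0" for n
    unfolding s_def using tr[of "t n *\<^sub>R e"] int_F by simp
  have lim: "(\<lambda>n. s n x) \<longlonglongrightarrow> partial i F x" for x
  proof -
    have "(F has_derivative (\<lambda>h. grad F x \<bullet> h)) (at x)" using C1_onD(1)[OF F] by simp
    then have "((\<lambda>u. F (x + u *\<^sub>R e)) has_derivative (\<lambda>u. grad F x \<bullet> (u *\<^sub>R e))) (at 0)"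
      by (intro has_derivative_compose[where f = "\<lambda>u. x + u *\<^sub>R e" and g = F])
        (auto intro!: derivative_eq_intros)
    then have "((\<lambda>u. F (x + u *\<^sub>R e)) has_real_derivative partial i F x) (at 0)"
      by (simp add: has_field_derivative_def e_def inner_axis mult.commute[of _ "partial i F x"])
    then have "((\<lambda>h. (F (x + h *\<^sub>R e) - F x) / h) \<longlongrightarrow> partial i F x) (at 0)"
      by (simp add: DERIV_def)
    moreover have "filterlim t (at 0) sequentially"
      unfolding filterlim_at t_def using LIMSEQ_inverse_real_of_nat by (auto simp: inverse_eq_divide)
    ultimately show ?thesis
      unfolding s_def by (auto simp: add.commute dest: filterlim_compose)
  qed
  have "(\<lambda>n. \<integral>x. s n x \<partial>lborel) \<longlonglongrightarrow> (\<integral>x. partial i F x \<partial>lborel)"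
  \<comment> \<open>The increments \<open>t n\<close> are at most 1, so every difference quotient
    vanishes outside the ball of radius \<open>R + 1\<close>; on the ball the Lipschitz constant
    bounds it.\<close>
  proof (rule integral_dominated_convergence[where w = "\<lambda>x. indicator (cball 0 (R + 1)) x *\<^sub>R B"])
    show "integrable lborel (\<lambda>x::real^'n. indicator (cball 0 (R + 1)) x *\<^sub>R B)"
      by (rule borel_integrable_compact) auto
    show "AE x in lborel. (\<lambda>n. s n x) \<longlonglongrightarrow> partial i F x" using lim by simp
    show "AE x in lborel. norm (s n x) \<le> indicator (cball 0 (R + 1)) x *\<^sub>R B" for n
    proof (rule AE_I2)
      fix x :: "real^'n"
      show "norm (s n x) \<le> indicator (cball 0 (R + 1)) x *\<^sub>R B"
      proof (cases "x \<in> cball 0 (R + 1)")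
        case True
        have "norm (F (t n *\<^sub>R e + x) - F x) \<le> B * t n"
          using lip[of "t n *\<^sub>R e + x" x] t[of n] ne by simp
        then show ?thesis using True t[of n] by (simp add: s_def field_simps)
      next
        case False
        then have "R + 1 < norm x" by simp
        moreover have "norm x \<le> norm (t n *\<^sub>R e + x) + t n"
          using norm_triangle_ineq4[of "t n *\<^sub>R e + x" "t n *\<^sub>R e"] ne t[of n] by simp
        ultimately have "t n *\<^sub>R e + x \<notin> K" "x \<notin> K" using R t[of n] by fastforce+
        then show ?thesis using False supp by (simp add: s_def)
      qed
    qed
    show "s n \<in> borel_measurable lborel" for n
      unfolding s_def using tr(1)[of "t n *\<^sub>R e"] int_F by (auto dest!: borel_measurable_integrable)
  qed (use int_p in auto)
  then show "(\<integral>x. partial i F x \<partial>lborel) = 0"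
    by (simp add: int_s LIMSEQ_const_iff)
qed


section \<open>Charts, tangent vectors and metrics\<close>

locale atlas =
  fixes A :: "('m::{t2_space, second_countable_topology}, 'n::finite) chart set"
  assumes atlas: "smooth_atlas A"
begin

lemma chart_is_chart: "c \<in> A \<Longrightarrow> is_chart c"
  using atlas by (simp add: smooth_atlas_def)

lemma chart_open:
  assumes "c \<in> A"
  shows "open (dom c)" "open (coords c ` dom c)"
    and "homeomorphism (dom c) (coords c ` dom c) (coords c) (point c)"
  using chart_is_chart[OF assms] by (auto simp: is_chart_def)

lemma point_coords [simp]: "c \<in> A \<Longrightarrow> p \<in> dom c \<Longrightarrow> point c (coords c p) = p"
  using chart_open(3) by (meson homeomorphism_apply1)

lemma coords_point [simp]: "c \<in> A \<Longrightarrow> x \<in> coords c ` dom c \<Longrightarrow> coords c (point c x) = x"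
  using chart_open(3) by (meson homeomorphism_apply2)

lemma point_in_dom [simp]: "c \<in> A \<Longrightarrow> x \<in> coords c ` dom c \<Longrightarrow> point c x \<in> dom c"
  by auto

lemma coords_image_iff:
  "c \<in> A \<Longrightarrow> x \<in> coords c ` (dom c \<inter> V) \<longleftrightarrow> x \<in> coords c ` dom c \<and> point c x \<in> V"
  by force

lemma coords_image_open:
  assumes "c \<in> A" "open V"
  shows "open (coords c ` (dom c \<inter> V))"
proof -
  have "openin (top_of_set (coords c ` dom c)) (coords c ` (dom c \<inter> V))"
    using homeomorphism_imp_open_map[OF chart_open(3)[OF assms(1)]] assms(2)
    by (simp add: openin_open_Int)
  then show ?thesis using chart_open(2)[OF assms(1)] openin_open_trans by blast
qed

lemma continuous_coords: "c \<in> A \<Longrightarrow> continuous_on (dom c) (coords c)"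
  using chart_open(3) by (simp add: homeomorphism_def)

lemma continuous_point: "c \<in> A \<Longrightarrow> continuous_on (coords c ` dom c) (point c)"
  using chart_open(3) by (simp add: homeomorphism_def)

lemma charts_at_iff: "c \<in> charts_at A p \<longleftrightarrow> c \<in> A \<and> p \<in> dom c"
  by (auto simp: charts_at_def)

lemma chart_at: "chart_at A p \<in> charts_at A p"
proof -
  have "\<exists>c. c \<in> charts_at A p"
    using atlas by (auto simp: smooth_atlas_def charts_at_def)
  then show ?thesis unfolding chart_at_def by (rule someI_ex)
qed

section \<open>Transition maps and tangent vectors\<close>

lemma transition_coords [simp]:
  "c \<in> A \<Longrightarrow> p \<in> dom c \<Longrightarrow> transition c d (coords c p) = coords d p"
  by (simp add: transition_def)

lemma transition_Ck_1:
  assumes "c \<in> A" "d \<in> A"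
  shows "Ck_on 1 (coords c ` (dom c \<inter> dom d)) (transition c d)"
proof (rule smooth_on_open_Ck_1)
  show "smooth_on (coords c ` (dom c \<inter> dom d)) (transition c d)"
    using atlas assms by (auto simp: smooth_atlas_def compatible_def)
  show "open (coords c ` (dom c \<inter> dom d))"
    using assms chart_open coords_image_open by blast
qed

definition jac :: "('m, 'n) chart \<Rightarrow> ('m, 'n) chart \<Rightarrow> 'm \<Rightarrow> real^'n \<Rightarrow> real^'n" where
  "jac c d p = frechet_derivative (transition c d) (at (coords c p))"

lemma transition_has_derivative:
  assumes "c \<in> charts_at A p" "d \<in> charts_at A p"
  shows "(transition c d has_derivative jac c d p) (at (coords c p))"
proof -
  have "transition c d differentiable (at (coords c p))"
    using transition_Ck_1[of c d] assms by (auto simp: One_nat_def charts_at_iff)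
  then show ?thesis unfolding jac_def using frechet_derivative_works by blast
qed

lemma linear_jac: "c \<in> charts_at A p \<Longrightarrow> d \<in> charts_at A p \<Longrightarrow> linear (jac c d p)"
  using transition_has_derivative has_derivative_linear by blast

lemma jac_compose:
  assumes "c \<in> charts_at A p" "d \<in> charts_at A p" "e \<in> charts_at A p"
  shows "jac d e p (jac c d p w) = jac c e p w"
proof -
  have c: "c \<in> A" "p \<in> dom c" and d: "d \<in> A" "p \<in> dom d" using assms by (auto simp: charts_at_iff)
  have "(transition d e \<circ> transition c d has_derivative jac d e p \<circ> jac c d p) (at (coords c p))"
    using transition_has_derivative[OF assms(1,2)] transition_has_derivative[OF assms(2,3)] c
    by (intro diff_chain_at) auto
  then have "(transition c e has_derivative jac d e p \<circ> jac c d p) (at (coords c p))"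
  proof (rule has_derivative_transform_within_open)
    show "open (coords c ` (dom c \<inter> dom d))" using c d chart_open coords_image_open by blast
    show "coords c p \<in> coords c ` (dom c \<inter> dom d)" using c d by auto
    show "(transition d e \<circ> transition c d) x = transition c e x"
      if "x \<in> coords c ` (dom c \<inter> dom d)" for x
      using that c d by (auto simp: transition_def)
  qed
  then show ?thesis
    using has_derivative_unique[OF transition_has_derivative[OF assms(1,3)]] by (simp add: fun_eq_iff)
qed

lemma jac_self:
  assumes "c \<in> charts_at A p"
  shows "jac c c p w = w"
proof -
  have c: "c \<in> A" "p \<in> dom c" using assms by (auto simp: charts_at_iff)
  have "(transition c c has_derivative (\<lambda>h. h)) (at (coords c p))"
  proof (rule has_derivative_transform_within_open[OF has_derivative_ident])
    show "open (coords c ` dom c)" using c chart_open by blast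
  qed (use c in \<open>auto simp: transition_def\<close>)
  then show ?thesis
    using has_derivative_unique[OF transition_has_derivative[OF assms assms]] by (simp add: fun_eq_iff)
qed

text \<open>Inverse, on the tangent space, of taking the coordinates of a vector in
  \<open>c\<close>; see \<open>tvec_self\<close> and \<open>tangent_eq_tvec\<close>. The value 0 off
  \<open>charts_at A p\<close> follows the convention of \<open>tangent_space\<close>.\<close>

definition tvec :: "('m, 'n) chart \<Rightarrow> 'm \<Rightarrow> real^'n \<Rightarrow> ('m, 'n) tangent" where
  "tvec c p w = (\<lambda>e. if e \<in> charts_at A p then jac c e p w else 0)"

lemma coord_field_tvec: "coord_field A c i p = tvec c p (axis i 1)"
  by (simp add: coord_field_def tvec_def jac_def fun_eq_iff)

lemma tvec_tangent: "c \<in> charts_at A p \<Longrightarrow> tvec c p w \<in> tangent_space A p"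
  using jac_compose[of c p] by (auto simp: tangent_space_def tvec_def jac_def[symmetric])

lemma tvec_jac:
  assumes "c \<in> charts_at A p" "d \<in> charts_at A p"
  shows "tvec c p w = tvec d p (jac c d p w)"
  using jac_compose[OF assms] by (auto simp: tvec_def fun_eq_iff)

lemma tvec_self: "c \<in> charts_at A p \<Longrightarrow> tvec c p w c = w"
  by (simp add: tvec_def jac_self)

lemma tangent_eq_tvec:
  assumes "c \<in> charts_at A p" "v \<in> tangent_space A p"
  shows "v = tvec c p (v c)"
proof
  fix e
  show "v e = tvec c p (v c) e"
  proof (cases "e \<in> charts_at A p")
    case True
    with assms have "v e = frechet_derivative (transition c e) (at (coords c p)) (v c)"
      unfolding tangent_space_def by blast
    with True show ?thesis by (simp add: tvec_def jac_def)
  next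
    case False
    with assms have "v e = 0" unfolding tangent_space_def by blast
    with False show ?thesis by (simp add: tvec_def)
  qed
qed

lemma tvec_linear:
  assumes "c \<in> charts_at A p"
  shows "tvec c p (a *\<^sub>R u + b *\<^sub>R w) = (\<lambda>e. a *\<^sub>R tvec c p u e + b *\<^sub>R tvec c p w e)"
  using linear_jac[OF assms] by (auto simp: tvec_def fun_eq_iff linear_add linear_scale)

section \<open>Gram matrices of a metric\<close>

context
  fixes g :: "('m, 'n) metric"
  assumes g: "riemannian_metric A g"
begin

lemma metric_sym:
  "u \<in> tangent_space A p \<Longrightarrow> v \<in> tangent_space A p \<Longrightarrow> g p u v = g p v u"
  using g by (simp add: riemannian_metric_def inner_product_on_def)

lemma metric_bilinear:
  assumes c: "c \<in> charts_at A p"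
  shows "g p (tvec c p (a *\<^sub>R u + b *\<^sub>R v)) (tvec c p w) =
      a * g p (tvec c p u) (tvec c p w) + b * g p (tvec c p v) (tvec c p w)"
    and "g p (tvec c p w) (tvec c p (a *\<^sub>R u + b *\<^sub>R v)) =
      a * g p (tvec c p w) (tvec c p u) + b * g p (tvec c p w) (tvec c p v)"
proof -
  show *: "g p (tvec c p (a *\<^sub>R u + b *\<^sub>R v)) (tvec c p w) =
      a * g p (tvec c p u) (tvec c p w) + b * g p (tvec c p v) (tvec c p w)" for u v w
    unfolding tvec_linear[OF c] using g tvec_tangent[OF c]
    by (simp add: riemannian_metric_def inner_product_on_def)
  show "g p (tvec c p w) (tvec c p (a *\<^sub>R u + b *\<^sub>R v)) =
      a * g p (tvec c p w) (tvec c p u) + b * g p (tvec c p w) (tvec c p v)"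
    using * metric_sym tvec_tangent[OF c] by simp
qed

lemma metric_gram:
  assumes c: "c \<in> charts_at A p"
  shows "g p (tvec c p u) (tvec c p v) = u \<bullet> (gram A g c (coords c p) *v v)"
proof -
  have [simp]: "point c (coords c p) = p" using c by (simp add: charts_at_iff)
  have l1: "linear (\<lambda>u. g p (tvec c p u) (tvec c p w))" for w
    using metric_bilinear(1)[OF c, of 1 _ 1] metric_bilinear(1)[OF c, of _ _ 0]
    by (intro linearI) simp_all
  have l2: "linear (\<lambda>u. g p (tvec c p w) (tvec c p u))" for w
    using metric_bilinear(2)[OF c, of _ 1 _ 1] metric_bilinear(2)[OF c, of _ _ _ 0]
    by (intro linearI) simp_all
  have "g p (tvec c p u) (tvec c p v) =
      g p (tvec c p (\<Sum>i\<in>UNIV. u $ i *\<^sub>R axis i 1)) (tvec c p (\<Sum>j\<in>UNIV. v $ j *\<^sub>R axis j 1))"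
    by (simp add: basis_expansion scalar_mult_eq_scaleR[symmetric])
  also have "\<dots> = (\<Sum>i\<in>UNIV. u $ i * g p (tvec c p (axis i 1)) (tvec c p (\<Sum>j\<in>UNIV. v $ j *\<^sub>R axis j 1)))"
    using linear_sum[OF l1, of "\<lambda>i. u $ i *\<^sub>R axis i 1" UNIV] linear_scale[OF l1] by simp
  also have "\<dots> = (\<Sum>i\<in>UNIV. u $ i * (\<Sum>j\<in>UNIV. v $ j * g p (tvec c p (axis i 1)) (tvec c p (axis j 1))))"
    using linear_sum[OF l2, of _ "\<lambda>i. v $ i *\<^sub>R axis i 1" UNIV] linear_scale[OF l2] by simp
  also have "\<dots> = u \<bullet> (gram A g c (coords c p) *v v)"
    by (simp add: inner_matrix_vector_sum gram_def coord_field_tvec sum_distrib_left algebra_simps)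
  finally show ?thesis .
qed

lemma gram_pos_def:
  assumes c: "c \<in> charts_at A p"
  shows "pos_def (gram A g c (coords c p))"
  unfolding pos_def_def
proof (intro conjI allI impI)
  show "sym_mat (gram A g c (coords c p))"
    using metric_sym tvec_tangent[OF c] c
    by (simp add: sym_mat_def transpose_def vec_eq_iff gram_def coord_field_tvec charts_at_iff)
  fix w :: "real^'n" assume "w \<noteq> 0"
  then have "tvec c p w \<noteq> (\<lambda>c. 0)" using tvec_self[OF c, of w] by auto
  then have "0 < g p (tvec c p w) (tvec c p w)"
    using g tvec_tangent[OF c] by (simp add: riemannian_metric_def inner_product_on_def)
  then show "0 < w \<bullet> (gram A g c (coords c p) *v w)" by (simp add: metric_gram[OF c])
qed

lemma gram_pos_def': "c \<in> A \<Longrightarrow> x \<in> coords c ` dom c \<Longrightarrow> pos_def (gram A g c x)"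
  using gram_pos_def by (auto simp: charts_at_iff)

lemma vol_density_pos: "c \<in> A \<Longrightarrow> x \<in> coords c ` dom c \<Longrightarrow> 0 < vol_density A g c x"
  by (simp add: vol_density_def pos_def_det_pos gram_pos_def')

lemma gram_jac:
  assumes c: "c \<in> charts_at A p" and d: "d \<in> charts_at A p"
  shows "u \<bullet> (gram A g c (coords c p) *v v) = jac c d p u \<bullet> (gram A g d (coords d p) *v jac c d p v)"
  unfolding metric_gram[OF c, symmetric] metric_gram[OF d, symmetric] tvec_jac[OF c d] ..

text \<open>The two Gram matrices are congruent through the Jacobian matrix. The square is what lets
  \<open>vol_density\<close> pick up exactly the factor of the change of variables formula.\<close>

lemma det_gram_jac:
  assumes c: "c \<in> charts_at A p" and d: "d \<in> charts_at A p"
  shows "det (gram A g c (coords c p)) = (det (matrix (jac c d p)))\<^sup>2 * det (gram A g d (coords d p))"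
proof -
  define J where "J = matrix (jac c d p)"
  have J: "jac c d p w = J *v w" for w
    unfolding J_def using fun_cong[OF matrix_vector_mul(2)[OF linear_jac[OF c d]], of w] by simp
  have "gram A g c (coords c p) = transpose J ** gram A g d (coords d p) ** J"
  proof -
    have "u \<bullet> (gram A g c (coords c p) *v v) = u \<bullet> ((transpose J ** gram A g d (coords d p) ** J) *v v)" for u v
      unfolding gram_jac[OF c d] J
      using dot_lmul_matrix[of u "transpose J" "gram A g d (coords d p) *v (J *v v)"]
      by (simp add: vector_transpose_matrix matrix_vector_mul_assoc matrix_mul_assoc)
    then have "gram A g c (coords c p) *v v = (transpose J ** gram A g d (coords d p) ** J) *v v" for v
      using vector_eq_ldot by blast
    then show ?thesis by (simp add: matrix_eq)
  qed
  then show ?thesis by (simp add: det_mul det_transpose J_def power2_eq_square)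
qed

lemma gram_C1:
  assumes "c \<in> A"
  shows "C1_on (coords c ` dom c) (\<lambda>x. gram A g c x $ i $ j)"
proof -
  have "Ck_on 1 (coords c ` dom c) (gram A g c)"
    by (rule smooth_on_open_Ck_1) (use g assms chart_open(2) in \<open>auto simp: riemannian_metric_def\<close>)
  from Ck_on_1_linear[OF this bounded_linear_compose[OF bounded_linear_vec_nth bounded_linear_vec_nth]]
  show ?thesis using Ck_on_1_C1_on by blast
qed

lemma vol_density_C1:
  assumes "c \<in> A"
  shows "C1_on (coords c ` dom c) (vol_density A g c)"
proof -
  have "C1_on (coords c ` dom c) (\<lambda>x. det (gram A g c x))"
    by (intro C1_on_det gram_C1 assms)
  then show ?thesis
    unfolding vol_density_def[abs_def]
    by (rule C1_on_compose(1)[where V = "{0<..}" and \<phi>' = "\<lambda>y. inverse (sqrt y) / 2"])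
      (auto intro!: DERIV_real_sqrt continuous_intros pos_def_det_pos gram_pos_def' assms)
qed

lemma gram_inv_C1:
  assumes "c \<in> A"
  shows "C1_on (coords c ` dom c) (\<lambda>x. gram_inv A g c x $ i $ j)"
  unfolding gram_inv_def
  by (intro C1_on_matrix_inv gram_C1 assms pos_def_invertible gram_pos_def' chart_open)

end

section \<open>Functions of class C^1 on the manifold\<close>

definition C1m_on :: "'m set \<Rightarrow> ('m \<Rightarrow> real) \<Rightarrow> bool" where
  "C1m_on V f \<longleftrightarrow> (\<forall>c\<in>A. C1_on (coords c ` (dom c \<inter> V)) (f \<circ> point c))"

lemma C1m_onD: "C1m_on V f \<Longrightarrow> c \<in> A \<Longrightarrow> C1_on (coords c ` (dom c \<inter> V)) (f \<circ> point c)"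
  by (simp add: C1m_on_def)

lemma C1m_on_subset: "C1m_on V f \<Longrightarrow> W \<subseteq> V \<Longrightarrow> C1m_on W f"
  unfolding C1m_on_def by (meson C1_on_subset Int_mono image_mono order_refl)

lemma C1m_on_const: "C1m_on V (\<lambda>p. k)"
  by (simp add: C1m_on_def C1_on_const o_def)

lemma C1m_on_mult: "C1m_on V f \<Longrightarrow> C1m_on V h \<Longrightarrow> C1m_on V (\<lambda>p. f p * h p)"
  unfolding C1m_on_def o_def by (intro ballI C1_on_mult(1)) auto

lemma C1m_on_add: "C1m_on V f \<Longrightarrow> C1m_on V h \<Longrightarrow> C1m_on V (\<lambda>p. f p + h p)"
  unfolding C1m_on_def o_def by (intro ballI C1_on_add) auto

lemma C1m_on_sum: "(\<And>i. i \<in> I \<Longrightarrow> C1m_on V (f i)) \<Longrightarrow> C1m_on V (\<lambda>p. \<Sum>i\<in>I. f i p)"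
  unfolding C1m_on_def o_def by (intro ballI C1_on_sum) auto

lemma C1m_on_compose:
  assumes "C1m_on V f" "f ` V \<subseteq> W"
    and "\<And>y. y \<in> W \<Longrightarrow> (\<phi> has_real_derivative \<phi>' y) (at y)" "continuous_on W \<phi>'"
  shows "C1m_on V (\<lambda>p. \<phi> (f p))"
  unfolding C1m_on_def
proof
  fix c assume c: "c \<in> A"
  have "(f \<circ> point c) ` coords c ` (dom c \<inter> V) \<subseteq> W"
    using c assms(2) by auto
  from C1_on_compose(1)[OF C1m_onD[OF assms(1) c] this assms(3,4)]
  show "C1_on (coords c ` (dom c \<inter> V)) ((\<lambda>p. \<phi> (f p)) \<circ> point c)" by (simp add: o_def)
qed

lemma C1m_on_inverse:
  assumes "C1m_on V f" "\<And>x. x \<in> V \<Longrightarrow> f x \<noteq> 0"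
  shows "C1m_on V (\<lambda>x. inverse (f x))"
  by (rule C1m_on_compose[OF assms(1), where W = "- {0}" and \<phi>' = "\<lambda>y. - (inverse y * inverse y)"])
    (use assms(2) in \<open>auto intro!: derivative_eq_intros continuous_intros\<close>)

lemma C1m_on_cong:
  assumes "open V" "\<And>p. p \<in> V \<Longrightarrow> f p = h p" "C1m_on V f"
  shows "C1m_on V h"
  unfolding C1m_on_def
proof
  fix c assume c: "c \<in> A"
  show "C1_on (coords c ` (dom c \<inter> V)) (h \<circ> point c)"
    by (rule C1_on_cong[OF coords_image_open[OF c assms(1)] _ C1m_onD[OF assms(3) c]])
      (use assms(2) c in auto)
qed

lemma C1m_on_Un:
  assumes "open V" "open W" "C1m_on V f" "C1m_on W f"
  shows "C1m_on (V \<union> W) f"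
  unfolding C1m_on_def
proof
  fix c assume c: "c \<in> A"
  have "C1_on (coords c ` (dom c \<inter> V) \<union> coords c ` (dom c \<inter> W)) (f \<circ> point c)"
    using assms c by (intro C1_on_Un coords_image_open) (auto dest: C1m_onD)
  then show "C1_on (coords c ` (dom c \<inter> (V \<union> W))) (f \<circ> point c)"
    by (simp add: Int_Un_distrib image_Un)
qed

lemma C1m_on_zero_extension:
  assumes "open V" "closed K" "K \<subseteq> V" "C1m_on V f" "\<And>x. x \<notin> K \<Longrightarrow> f x = 0"
  shows "C1m_on UNIV f"
proof -
  have "C1m_on (- K) f"
    by (rule C1m_on_cong[OF _ _ C1m_on_const[of _ 0]]) (use assms in auto)
  then have "C1m_on (V \<union> - K) f"
    using assms by (intro C1m_on_Un) auto
  moreover have "V \<union> - K = UNIV" using assms by auto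
  ultimately show ?thesis by simp
qed

lemma C1m_on_continuous:
  assumes "open V" "C1m_on V f"
  shows "continuous_on V f"
proof (rule continuous_at_imp_continuous_on, intro ballI)
  fix p assume p: "p \<in> V"
  define c where "c = chart_at A p"
  have c: "c \<in> A" "p \<in> dom c" using chart_at[of p] by (auto simp: c_def charts_at_iff)
  have "continuous_on (dom c \<inter> V) ((f \<circ> point c) \<circ> coords c)"
    by (rule continuous_on_compose) (use continuous_on_subset[OF continuous_coords[OF c(1)]]
        C1_on_continuous[OF C1m_onD[OF assms(2) c(1)]] in auto)
  then have "continuous_on (dom c \<inter> V) f"
    by (rule continuous_on_eq) (use c in auto)
  then show "isCont f p"
    using p c assms(1) chart_open(1)[OF c(1)] by (simp add: continuous_on_eq_continuous_at open_Int)
qed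

text \<open>All other chart expressions of \<open>f\<close> arise from the one in \<open>c\<close>
  by composition with a transition map of class C^1.\<close>

lemma C1m_on_chart:
  assumes c: "c \<in> A" and V: "open V" "V \<subseteq> dom c" and f: "C1_on (coords c ` V) (f \<circ> point c)"
  shows "C1m_on V f"
  unfolding C1m_on_def
proof
  fix d assume d: "d \<in> A"
  have sub: "coords d ` (dom d \<inter> V) \<subseteq> coords d ` (dom d \<inter> dom c)" using V by auto
  have "C1_on (coords d ` (dom d \<inter> V)) ((f \<circ> point c) \<circ> transition d c)"
  proof (rule C1_on_chain(1)[OF _ f])
    show "Ck_on 1 (coords d ` (dom d \<inter> V)) (transition d c)"
      using transition_Ck_1[OF d c] sub by (auto simp: One_nat_def intro: continuous_on_subset)
    show "transition d c ` coords d ` (dom d \<inter> V) \<subseteq> coords c ` V"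
      using d by auto
  qed
  then show "C1_on (coords d ` (dom d \<inter> V)) (f \<circ> point d)"
    by (rule C1_on_cong[OF coords_image_open[OF d V(1)], rotated])
      (use V c d in \<open>auto simp: transition_def subset_eq\<close>)
qed

section \<open>Differentials and their pairing by the inverse metric\<close>

abbreviation gradc :: "('m, 'n) chart \<Rightarrow> ('m \<Rightarrow> real) \<Rightarrow> 'm \<Rightarrow> real^'n" where
  "gradc c f p \<equiv> grad (f \<circ> point c) (coords c p)"

lemma gradc_jac:
  assumes c: "c \<in> charts_at A p" and d: "d \<in> charts_at A p"
    and V: "open V" "p \<in> V" and f: "C1m_on V f"
  shows "gradc c f p \<bullet> w = gradc d f p \<bullet> jac c d p w"
proof -
  have cA: "c \<in> A" "p \<in> dom c" and dA: "d \<in> A" "p \<in> dom d" using c d by (auto simp: charts_at_iff)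
  have "(f \<circ> point c has_derivative (\<lambda>h. gradc c f p \<bullet> h)) (at (coords c p))"
    using C1_onD(1)[OF C1m_onD[OF f cA(1)]] cA V by auto
  moreover have "((f \<circ> point d) \<circ> transition c d has_derivative (\<lambda>h. gradc d f p \<bullet> h) \<circ> jac c d p) (at (coords c p))"
    using C1_onD(1)[OF C1m_onD[OF f dA(1)], of "coords d p"] dA cA V
    by (intro diff_chain_at transition_has_derivative[OF c d]) auto
  then have "(f \<circ> point c has_derivative (\<lambda>h. gradc d f p \<bullet> h) \<circ> jac c d p) (at (coords c p))"
  proof (rule has_derivative_transform_within_open)
    show "open (coords c ` (dom c \<inter> dom d))" using cA dA chart_open coords_image_open by blast
    show "coords c p \<in> coords c ` (dom c \<inter> dom d)" using cA dA by auto
    show "(f \<circ> point d \<circ> transition c d) x = (f \<circ> point c) x"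
      if "x \<in> coords c ` (dom c \<inter> dom d)" for x
      using that cA dA by (auto simp: transition_def)
  qed
  ultimately have "(\<lambda>h. gradc c f p \<bullet> h) = (\<lambda>h. gradc d f p \<bullet> h) \<circ> jac c d p"
    by (rule has_derivative_unique)
  then show ?thesis by (simp add: fun_eq_iff)
qed

text \<open>The inner product of the differentials df and dh induced by \<open>g\<close>. It is read
  off in the chosen chart; for C^1 functions every chart gives the same value by
  \<open>cometric_chart\<close>.\<close>

definition cometric :: "('m, 'n) metric \<Rightarrow> ('m \<Rightarrow> real) \<Rightarrow> ('m \<Rightarrow> real) \<Rightarrow> 'm \<Rightarrow> real" where
  "cometric g f h p = (let c = chart_at A p in
     gradc c f p \<bullet> (gram_inv A g c (coords c p) *v gradc c h p))"

text \<open>The vector \<open>w\<close> is the metric gradient of \<open>h\<close>. Testing against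
  all vectors shows that its image under the Jacobian solves the defining equation of the metric
  gradient in chart \<open>d\<close>, and differentials transform contragrediently by
  \<open>gradc_jac\<close>.\<close>

lemma cometric_chart:
  assumes g: "riemannian_metric A g" and d: "d \<in> charts_at A p"
    and V: "open V" "p \<in> V" and f: "C1m_on V f" and h: "C1m_on V h"
  shows "cometric g f h p = gradc d f p \<bullet> (gram_inv A g d (coords d p) *v gradc d h p)"
proof -
  define c where "c = chart_at A p"
  have c: "c \<in> charts_at A p" using chart_at by (simp add: c_def)
  define w where "w = gram_inv A g c (coords c p) *v gradc c h p"
  have ic: "invertible (gram A g c (coords c p))" and id: "invertible (gram A g d (coords d p))"
    using gram_pos_def[OF g] c d pos_def_invertible by blast+
  have cw: "gram A g c (coords c p) *v w = gradc c h p"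
    using ic by (simp add: w_def gram_inv_def)
  have "gram A g d (coords d p) *v jac c d p w = gradc d h p"
  proof -
    have "u \<bullet> (gram A g d (coords d p) *v jac c d p w) = u \<bullet> gradc d h p" for u
    proof -
      define u' where "u' = jac d c p u"
      have u: "jac c d p u' = u"
        unfolding u'_def using jac_compose[OF d c d] jac_self[OF d] by simp
      have "u \<bullet> (gram A g d (coords d p) *v jac c d p w) = u' \<bullet> (gram A g c (coords c p) *v w)"
        unfolding gram_jac[OF g c d] u ..
      also have "\<dots> = u \<bullet> gradc d h p"
        unfolding cw using gradc_jac[OF c d V h, of u'] by (simp add: u inner_commute)
      finally show ?thesis .
    qed
    then show ?thesis using vector_eq_ldot by blast
  qed
  then have "gram_inv A g d (coords d p) *v gradc d h p = jac c d p w"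
    using matrix_inv_mult_vector(2)[OF id, of "jac c d p w"] by (simp add: gram_inv_def)
  moreover have "cometric g f h p = gradc c f p \<bullet> w"
    by (simp add: cometric_def Let_def w_def c_def)
  ultimately show ?thesis using gradc_jac[OF c d V f] by simp
qed

end


section \<open>Change of variables\<close>

text \<open>The change of variables theorem of the library is restricted to well-ordered index types,
  so it is transported from the following well-ordered copy of the index type.\<close>

typedef 'a indexed = "UNIV :: 'a set"
  morphisms unindex Index by simp

lemma bij_unindex: "bij unindex"
  by (metis UNIV_I bijI' unindex_inject Index_inverse)

text \<open>Any injection into the naturals serves: only some well-order on the copy is wanted, and
  none of the transported results refers to it.\<close>

definition index_rank :: "'a::finite indexed \<Rightarrow> nat" where
  "index_rank i = (SOME f. inj f) (unindex i)"

lemma inj_index_rank: "inj (index_rank :: 'a::finite indexed \<Rightarrow> nat)"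
proof -
  have "\<exists>f :: 'a \<Rightarrow> nat. inj f"
    using finite_imp_inj_to_nat_seg[of "UNIV :: 'a set"] by auto
  then have "inj (SOME f :: 'a \<Rightarrow> nat. inj f)" by (rule someI_ex)
  then show ?thesis
    unfolding index_rank_def by (intro injI) (drule (1) injD, simp add: unindex_inject)
qed

instance indexed :: (finite) finite
proof
  have "finite (range (Index :: 'a \<Rightarrow> 'a indexed))" by simp
  moreover have "range (Index :: 'a \<Rightarrow> 'a indexed) = UNIV"
    by (metis UNIV_eq_I rangeI unindex_inverse)
  ultimately show "finite (UNIV :: 'a indexed set)" by simp
qed

instantiation indexed :: (finite) wellorder
begin

definition less_eq_indexed :: "'a indexed \<Rightarrow> 'a indexed \<Rightarrow> bool" where
  "less_eq_indexed i j \<longleftrightarrow> index_rank i \<le> index_rank j"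

definition less_indexed :: "'a indexed \<Rightarrow> 'a indexed \<Rightarrow> bool" where
  "less_indexed i j \<longleftrightarrow> index_rank i < index_rank j"

instance
proof
  fix x y z :: "'a indexed"
  show "x < y \<longleftrightarrow> x \<le> y \<and> \<not> y \<le> x" "x \<le> x" "x \<le> y \<Longrightarrow> y \<le> z \<Longrightarrow> x \<le> z" "x \<le> y \<or> y \<le> x"
    by (auto simp: less_eq_indexed_def less_indexed_def)
  show "x \<le> y \<Longrightarrow> y \<le> x \<Longrightarrow> x = y"
    by (rule injD[OF inj_index_rank]) (simp add: less_eq_indexed_def)
  fix P :: "'a indexed \<Rightarrow> bool" and a :: "'a indexed"
  assume "\<And>x. (\<And>y. y < x \<Longrightarrow> P y) \<Longrightarrow> P x"
  then show "P a"
    unfolding less_indexed_def by (rule measure_induct[of index_rank]) blast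
qed

end

text \<open>Conjugation by \<open>h\<close> is a sign preserving bijection between the permutations
  of the two index types.\<close>

lemma det_reindex:
  fixes M :: "real^'a^'a" and h :: "'b::finite \<Rightarrow> 'a"
  assumes h: "bij h"
  shows "det (\<chi> i j. M $ h i $ h j) = det M"
proof -
  have inj: "inj h" and sur: "surj h" using h by (auto simp: bij_def)
  have mp: "map_permutation UNIV h p = h \<circ> p \<circ> inv h" for p
    using sur by (simp add: map_permutation_def restrict_id_def fun_eq_iff)
  have mp': "map_permutation UNIV (inv h) p = inv h \<circ> p \<circ> h" for p
    using h by (simp add: map_permutation_def restrict_id_def fun_eq_iff bij_imp_bij_inv bij_is_surj inv_inv_eq)
  have "det (\<chi> i j. M $ h i $ h j) =
      (\<Sum>p | p permutes (UNIV :: 'b set). of_int (sign p) * (\<Prod>i\<in>UNIV. M $ h i $ h (p i)))"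
    by (simp add: det_def)
  also have "\<dots> = (\<Sum>q | q permutes (UNIV :: 'a set). of_int (sign q) * (\<Prod>i\<in>UNIV. M $ i $ q i))"
  proof (rule sum.reindex_bij_witness[where i = "map_permutation UNIV (inv h)" and j = "map_permutation UNIV h"])
    fix p :: "'b \<Rightarrow> 'b" assume "p \<in> {p. p permutes UNIV}"
    then have p: "p permutes UNIV" by simp
    show "map_permutation UNIV (inv h) (map_permutation UNIV h p) = p"
      unfolding mp mp' using inj by (simp add: fun_eq_iff)
    show "map_permutation UNIV h p \<in> {q. q permutes UNIV}"
      using map_permutation_permutes[OF h p] by simp
    have "(\<Prod>i\<in>UNIV. M $ h i $ h (p i)) = (\<Prod>i\<in>UNIV. M $ i $ map_permutation UNIV h p i)"
      using prod.reindex_bij_betw[OF h, of "\<lambda>i. M $ i $ map_permutation UNIV h p i"]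
      by (simp add: mp inj)
    then show "of_int (sign (map_permutation UNIV h p)) * (\<Prod>i\<in>UNIV. M $ i $ map_permutation UNIV h p i) =
        of_int (sign p) * (\<Prod>i\<in>UNIV. M $ h i $ h (p i))"
      using sign_map_permutation[of h UNIV p] inj p by simp
  next
    fix q :: "'a \<Rightarrow> 'a" assume "q \<in> {q. q permutes UNIV}"
    then have q: "q permutes UNIV" by simp
    show "map_permutation UNIV h (map_permutation UNIV (inv h) q) = q"
      unfolding mp mp' using sur by (simp add: fun_eq_iff surj_f_inv_f)
    show "map_permutation UNIV (inv h) q \<in> {p. p permutes UNIV}"
      using map_permutation_permutes[OF bij_imp_bij_inv[OF h] q] by simp
  qed
  finally show ?thesis by (simp add: det_def)
qed

text \<open>Bridges two languages: measures are compared by nonnegative integrals, which may be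
  infinite, while the change of variables theorem speaks of absolute integrability and values of
  integrals.\<close>

lemma set_nn_integral_eq_integral:
  fixes h :: "'a::euclidean_space \<Rightarrow> real"
  assumes m: "(\<lambda>x. indicator S x * h x) \<in> borel_measurable borel"
    and nn: "\<And>x. x \<in> S \<Longrightarrow> 0 \<le> h x"
  shows "(\<integral>\<^sup>+x\<in>S. ennreal (h x) \<partial>lborel) =
     (if h absolutely_integrable_on S then ennreal (integral S h) else \<infinity>)"
proof -
  have eq: "(\<integral>\<^sup>+x\<in>S. ennreal (h x) \<partial>lborel) = (\<integral>\<^sup>+x. ennreal (indicator S x * h x) \<partial>lborel)"
    by (intro nn_integral_cong) (auto simp: indicator_def)
  have pos: "0 \<le> indicator S x * h x" for x using nn by (auto simp: indicator_def)
  have iff: "h absolutely_integrable_on S \<longleftrightarrow> integrable lborel (\<lambda>x. indicator S x * h x)"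
    using integrable_completion[of "\<lambda>x. indicator S x * h x" lborel] m
    by (simp add: set_integrable_def)
  show ?thesis
  proof (cases "h absolutely_integrable_on S")
    case True
    then have "(\<integral>\<^sup>+x. ennreal (indicator S x * h x) \<partial>lborel) = ennreal (\<integral>x. indicator S x * h x \<partial>lborel)"
      using iff pos by (intro nn_integral_eq_integral) auto
    also have "(\<integral>x. indicator S x * h x \<partial>lborel) = integral S h"
      using set_lebesgue_integral_eq_integral(2)[OF True] m
      by (simp add: set_lebesgue_integral_def integral_completion)
    finally show ?thesis using True eq by simp
  next
    case False
    then have "\<not> integrable lborel (\<lambda>x. indicator S x * h x)" using iff by simp
    then have "(\<integral>\<^sup>+x. ennreal (indicator S x * h x) \<partial>lborel) = \<infinity>"
      using m pos by (simp add: integrable_iff_bounded less_top[symmetric])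
    then show ?thesis using False eq by simp
  qed
qed

lemma nn_integral_change_of_variables_wellorder:
  fixes T :: "real^'n::{finite,wellorder} \<Rightarrow> real^'n::_" and f :: "real^'n::_ \<Rightarrow> real"
  assumes S: "S \<in> sets borel"
    and T': "\<And>x. x \<in> S \<Longrightarrow> (T has_derivative T' x) (at x)" and inj: "inj_on T S"
    and nn: "\<And>y. y \<in> T ` S \<Longrightarrow> 0 \<le> f y"
    and m1: "(\<lambda>x. indicator S x * (\<bar>det (matrix (T' x))\<bar> * f (T x))) \<in> borel_measurable borel"
    and m2: "(\<lambda>y. indicator (T ` S) y * f y) \<in> borel_measurable borel"
  shows "(\<integral>\<^sup>+y\<in>T ` S. ennreal (f y) \<partial>lborel) =
    (\<integral>\<^sup>+x\<in>S. ennreal (\<bar>det (matrix (T' x))\<bar> * f (T x)) \<partial>lborel)"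
proof -
  let ?D = "\<lambda>x. \<bar>det (matrix (T' x))\<bar> * f (T x)"
  \<comment> \<open>The theorem is an equivalence for a prescribed value \<open>b\<close> and for
    vector-valued functions, here with values in \<open>real^1\<close>. Quantifying over
    \<open>b\<close> yields that integrability transfers in both directions and that the values
    agree.\<close>
  have key: "?D absolutely_integrable_on S \<and> integral S ?D = b \<longleftrightarrow>
      f absolutely_integrable_on (T ` S) \<and> integral (T ` S) f = b" for b
  proof -
    have S': "S \<in> sets lebesgue" using S by (simp add: sets_completionI_sets)
    have d: "(T has_derivative T' x) (at x within S)" if "x \<in> S" for x
      using T'[OF that] has_derivative_at_withinI by blast
    have "(\<lambda>x. \<bar>det (matrix (T' x))\<bar> *\<^sub>R (vec (f (T x)) :: real^1)) absolutely_integrable_on S \<and>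
        integral S (\<lambda>x. \<bar>det (matrix (T' x))\<bar> *\<^sub>R (vec (f (T x)) :: real^1)) = vec b \<longleftrightarrow>
        (\<lambda>x. vec (f x) :: real^1) absolutely_integrable_on (T ` S) \<and> integral (T ` S) (\<lambda>x. vec (f x) :: real^1) = vec b"
      by (rule has_absolute_integral_change_of_variables[OF S' d inj])
    then show ?thesis
      by (simp add: absolutely_integrable_on_1_iff integral_on_1_eq vec_eq_iff)
  qed
  have iff: "f absolutely_integrable_on (T ` S) \<longleftrightarrow> ?D absolutely_integrable_on S"
    using key by blast
  have eq: "integral (T ` S) f = integral S ?D" if "?D absolutely_integrable_on S"
    using key[of "integral S ?D"] that by simp
  have nn': "0 \<le> ?D x" if "x \<in> S" for x using nn that by simp
  show ?thesis
    unfolding set_nn_integral_eq_integral[OF m1 nn', simplified]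
      set_nn_integral_eq_integral[OF m2 nn, simplified] using iff eq by simp
qed

section \<open>Relabelling of coordinates\<close>

definition reindex :: "real^'n::finite \<Rightarrow> real^'n indexed" where
  "reindex x = (\<chi> i. x $ unindex i)"

definition unreindex :: "real^'n::finite indexed \<Rightarrow> real^'n" where
  "unreindex y = (\<chi> i. y $ Index i)"

lemma reindex_inverse [simp]: "unreindex (reindex x) = x" "reindex (unreindex y) = y"
  by (simp_all add: reindex_def unreindex_def Index_inverse unindex_inverse vec_eq_iff)

lemma linear_reindex: "linear reindex" "linear unreindex"
  by (auto intro!: linearI simp: reindex_def unreindex_def vec_eq_iff)

lemma measurable_reindex [measurable]: "reindex \<in> borel_measurable borel" "unreindex \<in> borel_measurable borel"
  using linear_reindex linear_continuous_on linear_linear borel_measurable_continuous_onI by metis+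

lemma emeasure_lborel_box_vec:
  fixes l u :: "real^'n"
  assumes "\<And>i. l $ i \<le> u $ i"
  shows "emeasure lborel (box l u) = (\<Prod>i\<in>UNIV. ennreal (u $ i - l $ i))"
proof -
  have "emeasure lborel (box l u) = ennreal (\<Prod>b\<in>Basis. (u - l) \<bullet> b)"
    by (rule emeasure_lborel_box) (use assms in \<open>auto simp: Basis_vec_def inner_axis\<close>)
  also have "(Basis :: (real^'n) set) = (\<lambda>i. axis i 1) ` UNIV"
    by (auto simp: Basis_vec_def)
  also have "(\<Prod>b\<in>(\<lambda>i. axis i 1) ` UNIV. (u - l) \<bullet> b) = (\<Prod>i\<in>UNIV. u $ i - l $ i)"
    by (subst prod.reindex) (auto simp: inj_def axis_eq_axis inner_axis)
  finally show ?thesis using assms by (simp add: prod_ennreal)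
qed

text \<open>Lebesgue measure is determined by the volumes of boxes, and relabelling maps boxes to
  boxes with the same side lengths.\<close>

lemma lborel_reindex: "distr lborel borel reindex = (lborel :: (real^'n::finite indexed) measure)"
proof (rule lborel_eqI[symmetric])
  fix l u :: "real^'n indexed"
  assume le: "\<And>b. b \<in> Basis \<Longrightarrow> l \<bullet> b \<le> u \<bullet> b"
  have le': "l $ i \<le> u $ i" for i using le[of "axis i 1"] by (simp add: inner_axis)
  have "reindex -` box l u = box (unreindex l) (unreindex u)"
    by (auto simp: mem_box_cart reindex_def unreindex_def) (metis Index_inverse UNIV_I unindex_inverse)+
  then have "emeasure (distr lborel borel reindex) (box l u) = emeasure lborel (box (unreindex l) (unreindex u))"
    by (simp add: emeasure_distr)
  also have "\<dots> = (\<Prod>i\<in>UNIV. ennreal (u $ Index i - l $ Index i))"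
    using le' by (subst emeasure_lborel_box_vec) (simp_all add: unreindex_def)
  also have "\<dots> = (\<Prod>i\<in>UNIV. ennreal (u $ i - l $ i))"
    by (rule prod.reindex_bij_witness[where i = unindex and j = Index])
      (simp_all add: Index_inverse unindex_inverse)
  also have "\<dots> = emeasure lborel (box l u)"
    using le' by (simp add: emeasure_lborel_box_vec)
  also have "\<dots> = ennreal (\<Prod>b\<in>Basis. (u - l) \<bullet> b)"
    using le by (rule emeasure_lborel_box)
  finally show "emeasure (distr lborel borel reindex) (box l u) = ennreal (\<Prod>b\<in>Basis. (u - l) \<bullet> b)" .
qed simp

lemma det_matrix_reindex:
  assumes "linear L"
  shows "det (matrix (reindex \<circ> L \<circ> unreindex)) = det (matrix L)"
proof -
  have ax: "unreindex (axis j 1) = axis (unindex j) 1" for j :: "'a indexed"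
    by (auto simp: unreindex_def axis_def vec_eq_iff Index_inverse unindex_inverse)
  have "matrix (reindex \<circ> L \<circ> unreindex) = (\<chi> i j. matrix L $ unindex i $ unindex j)"
    by (simp add: matrix_def reindex_def vec_eq_iff[where 'b = "'a indexed"]) (simp add: ax vec_eq_iff)
  then show ?thesis by (simp add: det_reindex bij_unindex)
qed

text \<open>\<open>T\<close> is conjugated by \<open>reindex\<close>, which preserves Lebesgue
  measure and the determinants of linear maps.\<close>

lemma nn_integral_change_of_variables:
  fixes T :: "real^'n \<Rightarrow> real^'n" and f :: "real^'n \<Rightarrow> real"
  assumes S: "S \<in> sets borel"
    and T': "\<And>x. x \<in> S \<Longrightarrow> (T has_derivative T' x) (at x)" and inj: "inj_on T S"
    and nn: "\<And>y. y \<in> T ` S \<Longrightarrow> 0 \<le> f y"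
    and m1: "(\<lambda>x. indicator S x * (\<bar>det (matrix (T' x))\<bar> * f (T x))) \<in> borel_measurable borel"
    and m2: "(\<lambda>y. indicator (T ` S) y * f y) \<in> borel_measurable borel"
  shows "(\<integral>\<^sup>+y\<in>T ` S. ennreal (f y) \<partial>lborel) =
    (\<integral>\<^sup>+x\<in>S. ennreal (\<bar>det (matrix (T' x))\<bar> * f (T x)) \<partial>lborel)"
proof -
  define D where "D x = \<bar>det (matrix (T' x))\<bar> * f (T x)" for x
  let ?S = "reindex ` S" and ?T = "reindex \<circ> T \<circ> unreindex"
  let ?T' = "\<lambda>y. reindex \<circ> T' (unreindex y) \<circ> unreindex"
  have ind: "indicator (reindex ` V) y = (indicator V (unreindex y) :: real)" for V :: "(real^'n) set" and y
    by (auto simp: indicator_def image_iff) (metis reindex_inverse)+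
  have TS: "?T ` ?S = reindex ` T ` S" by (force simp: image_iff)
  have tr: "(\<integral>\<^sup>+y\<in>reindex ` V. ennreal (h (unreindex y)) \<partial>lborel) = (\<integral>\<^sup>+x\<in>V. ennreal (h x) \<partial>lborel)"
    if m: "(\<lambda>x. indicator V x * h x) \<in> borel_measurable borel" for V :: "(real^'n) set" and h
  proof -
    have "(\<integral>\<^sup>+y\<in>reindex ` V. ennreal (h (unreindex y)) \<partial>lborel) =
        (\<integral>\<^sup>+y. ennreal (indicator V (unreindex y) * h (unreindex y)) \<partial>distr lborel borel reindex)"
      unfolding lborel_reindex
      by (intro nn_integral_cong) (auto simp: indicator_def split: if_splits; metis image_eqI reindex_inverse)
    also have "\<dots> = (\<integral>\<^sup>+x. ennreal (indicator V x * h x) \<partial>lborel)"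
      using measurable_compose[OF measurable_reindex(2) m] by (subst nn_integral_distr) auto
    also have "\<dots> = (\<integral>\<^sup>+x\<in>V. ennreal (h x) \<partial>lborel)"
      by (intro nn_integral_cong) (auto simp: indicator_def)
    finally show ?thesis .
  qed
  have det: "\<bar>det (matrix (?T' y))\<bar> * f (unreindex (?T y)) = D (unreindex y)" if "unreindex y \<in> S" for y
  proof -
    have "linear (T' (unreindex y))" using T'[OF that] by (rule has_derivative_linear)
    then show ?thesis by (simp add: D_def det_matrix_reindex)
  qed
  have "(\<integral>\<^sup>+y\<in>?T ` ?S. ennreal (f (unreindex y)) \<partial>lborel) =
      (\<integral>\<^sup>+y\<in>?S. ennreal (\<bar>det (matrix (?T' y))\<bar> * f (unreindex (?T y))) \<partial>lborel)"
  proof (rule nn_integral_change_of_variables_wellorder)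
    have "?S = unreindex -` S \<inter> space borel" by (force simp: image_iff)
    then show "?S \<in> sets borel" using measurable_sets[OF measurable_reindex(2)] S by simp
    show "(?T has_derivative ?T' y) (at y)" if "y \<in> ?S" for y
    proof -
      have a: "(unreindex has_derivative unreindex) (at y)"
        by (rule linear_imp_has_derivative[OF linear_reindex(2)])
      have b: "(T has_derivative T' (unreindex y)) (at (unreindex y))" using T' that by auto
      have c: "(reindex has_derivative reindex) (at ((T \<circ> unreindex) y))"
        by (rule linear_imp_has_derivative[OF linear_reindex(1)])
      show ?thesis
        using diff_chain_at[OF diff_chain_at[OF a b] c] by (simp only: o_assoc)
    qed
    show "inj_on ?T ?S"
      using inj by (auto simp: inj_on_def) (metis reindex_inverse(1))+
    show "0 \<le> f (unreindex y)" if "y \<in> ?T ` ?S" for y using nn that by auto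
    have "(\<lambda>y. indicator ?S y * (\<bar>det (matrix (?T' y))\<bar> * f (unreindex (?T y)))) =
        (\<lambda>y. (\<lambda>x. indicator S x * D x) (unreindex y))"
      using det by (auto simp: fun_eq_iff ind split: split_indicator)
    then show "(\<lambda>y. indicator ?S y * (\<bar>det (matrix (?T' y))\<bar> * f (unreindex (?T y)))) \<in> borel_measurable borel"
      using measurable_compose[OF measurable_reindex(2) m1] by (simp add: D_def)
    show "(\<lambda>y. indicator (?T ` ?S) y * f (unreindex y)) \<in> borel_measurable borel"
      unfolding TS ind using measurable_compose[OF measurable_reindex(2) m2] by simp
  qed
  also have "\<dots> = (\<integral>\<^sup>+y\<in>?S. ennreal (D (unreindex y)) \<partial>lborel)"
  proof (intro nn_integral_cong)
    fix y
    show "ennreal (\<bar>det (matrix (?T' y))\<bar> * f (unreindex (?T y))) * indicator ?S y =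
        ennreal (D (unreindex y)) * indicator ?S y"
      using det[of y] by (cases "y \<in> ?S") auto
  qed
  also have "\<dots> = (\<integral>\<^sup>+x\<in>S. ennreal (D x) \<partial>lborel)"
    by (rule tr) (use m1 in \<open>simp add: D_def\<close>)
  finally show ?thesis unfolding TS tr[OF m2] by (simp add: D_def)
qed


section \<open>The Riemannian measure\<close>

lemma borel_measurable_indicator_mult_continuous:
  fixes f :: "'a::topological_space \<Rightarrow> real"
  assumes "S \<in> sets borel" "S \<subseteq> U" "continuous_on U f"
  shows "(\<lambda>x. indicator S x * f x) \<in> borel_measurable borel"
proof -
  have "f \<in> borel_measurable (restrict_space borel S)"
    by (rule borel_measurable_continuous_on_restrict) (use assms continuous_on_subset in blast)
  then show ?thesis
    using assms(1) by (simp add: borel_measurable_restrict_space_iff)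
qed

lemma suminf_ennreal_swap:
  fixes f :: "nat \<Rightarrow> nat \<Rightarrow> ennreal"
  shows "(\<Sum>i. \<Sum>j. f i j) = (\<Sum>j. \<Sum>i. f i j)"
  using nn_integral_suminf[of "\<lambda>j i. f i j" "count_space UNIV"]
  by (simp add: nn_integral_count_space_nat)

context atlas
begin

text \<open>The image is a preimage under the continuous inverse \<open>point c\<close>.\<close>

lemma coords_image_borel:
  assumes c: "c \<in> A" and B: "B \<in> sets borel" "B \<subseteq> dom c"
  shows "coords c ` B \<in> sets borel"
proof -
  let ?U = "coords c ` dom c"
  have U: "?U \<in> sets borel" using chart_open(2)[OF c] by simp
  have "point c \<in> measurable (restrict_space borel ?U) borel"
    by (rule borel_measurable_continuous_on_restrict[OF continuous_point[OF c]])
  then have "point c -` B \<inter> space (restrict_space borel ?U) \<in> sets (restrict_space borel ?U)"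
    using B(1) by (rule measurable_sets)
  moreover have "point c -` B \<inter> space (restrict_space borel ?U) = coords c ` B"
    using c B(2) by (auto simp: space_restrict_space image_iff subset_eq)
  ultimately show ?thesis using U by (simp add: sets_restrict_space_iff)
qed

section \<open>Volume densities in charts\<close>

context
  fixes g :: "('m, 'n) metric"
  assumes g: "riemannian_metric A g"
begin

text \<open>Away from the image of the chart \<open>vol_density\<close> has no meaning, hence the
  indicator.\<close>

definition chart_measure :: "('m, 'n) chart \<Rightarrow> (real^'n) measure" where
  "chart_measure c = density lborel (\<lambda>x. ennreal (indicator (coords c ` dom c) x * vol_density A g c x))"

lemma vol_density_measurable:
  "c \<in> A \<Longrightarrow> (\<lambda>x. indicator (coords c ` dom c) x * vol_density A g c x) \<in> borel_measurable borel"
  by (rule borel_measurable_indicator_mult_continuous[where U = "coords c ` dom c"])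
    (use C1_on_continuous[OF vol_density_C1[OF g]] chart_open(2) in auto)

lemma emeasure_chart_measure:
  assumes c: "c \<in> A" and B: "B \<in> sets borel" "B \<subseteq> dom c"
  shows "emeasure (chart_measure c) (coords c ` B) = (\<integral>\<^sup>+x\<in>coords c ` B. ennreal (vol_density A g c x) \<partial>lborel)"
  unfolding chart_measure_def
proof (subst emeasure_density)
  show "(\<integral>\<^sup>+x\<in>coords c ` B. ennreal (indicator (coords c ` dom c) x * vol_density A g c x) \<partial>lborel) =
      (\<integral>\<^sup>+x\<in>coords c ` B. ennreal (vol_density A g c x) \<partial>lborel)"
    using B by (intro nn_integral_cong) (auto simp: indicator_def)
qed (use vol_density_measurable[OF c] coords_image_borel[OF assms] in auto)

text \<open>By \<open>det_gram_jac\<close> the densities differ by the absolute value of the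
  Jacobian determinant, which is the factor in the change of variables formula.\<close>

lemma chart_measure_compatible:
  assumes c: "c \<in> A" and d: "d \<in> A" and B: "B \<in> sets borel" "B \<subseteq> dom c" "B \<subseteq> dom d"
  shows "emeasure (chart_measure c) (coords c ` B) = emeasure (chart_measure d) (coords d ` B)"
proof -
  let ?S = "coords c ` B"
  define T' where "T' x = jac c d (point c x)" for x
  have TS: "transition c d ` ?S = coords d ` B" using c B by (auto simp: subset_eq image_iff)
  have dens: "vol_density A g c x = \<bar>det (matrix (T' x))\<bar> * vol_density A g d (transition c d x)"
    if "x \<in> ?S" for x
  proof -
    obtain p where p: "p \<in> B" "x = coords c p" using \<open>x \<in> ?S\<close> by blast
    then have "c \<in> charts_at A p" "d \<in> charts_at A p" "point c x = p" using B c d by (auto simp: charts_at_iff subset_eq)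
    then show ?thesis
      using p B c det_gram_jac[OF g, of c p d]
      by (auto simp: vol_density_def T'_def real_sqrt_mult subset_eq)
  qed
  have "(\<integral>\<^sup>+y\<in>transition c d ` ?S. ennreal (vol_density A g d y) \<partial>lborel) =
      (\<integral>\<^sup>+x\<in>?S. ennreal (\<bar>det (matrix (T' x))\<bar> * vol_density A g d (transition c d x)) \<partial>lborel)"
  proof (rule nn_integral_change_of_variables)
    show "?S \<in> sets borel" by (rule coords_image_borel[OF c B(1,2)])
    show "(transition c d has_derivative T' x) (at x)" if "x \<in> ?S" for x
      using that B c d transition_has_derivative by (auto simp: T'_def charts_at_iff subset_eq)
    show "inj_on (transition c d) ?S"
      using B c d by (auto simp: inj_on_def subset_eq) (metis point_coords)
    show "0 \<le> vol_density A g d y" if "y \<in> transition c d ` ?S" for y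
    proof -
      have "y \<in> coords d ` dom d" using that B(3) unfolding TS by auto
      from vol_density_pos[OF g d this] show ?thesis by simp
    qed
    have "(\<lambda>x. indicator ?S x * vol_density A g c x) \<in> borel_measurable borel"
      by (rule borel_measurable_indicator_mult_continuous[OF coords_image_borel[OF c B(1,2)] image_mono[OF B(2)]])
        (rule C1_on_continuous[OF vol_density_C1[OF g c]])
    moreover have "(\<lambda>x. indicator ?S x * vol_density A g c x) =
        (\<lambda>x. indicator ?S x * (\<bar>det (matrix (T' x))\<bar> * vol_density A g d (transition c d x)))"
      using dens by (auto simp: fun_eq_iff indicator_def)
    ultimately show "(\<lambda>x. indicator ?S x * (\<bar>det (matrix (T' x))\<bar> * vol_density A g d (transition c d x)))
        \<in> borel_measurable borel" by simp
    show "(\<lambda>y. indicator (transition c d ` ?S) y * vol_density A g d y) \<in> borel_measurable borel"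
      unfolding TS
      by (rule borel_measurable_indicator_mult_continuous[OF coords_image_borel[OF d B(1,3)] image_mono[OF B(3)]])
        (rule C1_on_continuous[OF vol_density_C1[OF g d]])
  qed
  also have "\<dots> = (\<integral>\<^sup>+x\<in>?S. ennreal (vol_density A g c x) \<partial>lborel)"
    using dens by (intro nn_integral_cong) (auto simp: indicator_def)
  finally show ?thesis
    unfolding TS emeasure_chart_measure[OF c B(1,2)] emeasure_chart_measure[OF d B(1,3)] by simp
qed

section \<open>Existence and uniqueness of the Riemannian measure\<close>

definition is_vol_measure :: "'m measure \<Rightarrow> bool" where
  "is_vol_measure \<mu> \<longleftrightarrow> sets \<mu> = sets borel \<and>
     (\<forall>c\<in>A. \<forall>B\<in>sets borel. B \<subseteq> dom c \<longrightarrow>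
        emeasure \<mu> B = (\<integral>\<^sup>+x\<in>coords c ` B. ennreal (vol_density A g c x) \<partial>lborel))"

lemma is_vol_measure_chart:
  assumes "is_vol_measure \<mu>" "c \<in> A" "B \<in> sets borel" "B \<subseteq> dom c"
  shows "emeasure \<mu> B = emeasure (chart_measure c) (coords c ` B)"
  using assms by (simp add: is_vol_measure_def emeasure_chart_measure)

text \<open>Second countability yields a countable subcover by chart domains (Lindelof), and
  subtracting the earlier domains makes it disjoint.\<close>

lemma disjoint_chart_cover:
  obtains ch :: "nat \<Rightarrow> ('m, 'n) chart" and D :: "nat \<Rightarrow> 'm set"
  where "\<And>i. ch i \<in> A" "\<And>i. D i \<subseteq> dom (ch i)" "\<And>i. D i \<in> sets borel" "disjoint_family D" "(\<Union>i. D i) = UNIV"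
proof -
  have op: "openin (top_of_set UNIV) S" if "S \<in> dom ` A" for S
    using that chart_open(1) by auto
  obtain F where F: "F \<subseteq> dom ` A" "countable F" "\<Union>F = \<Union>(dom ` A)"
    using Lindelof_openin[OF op] by blast
  then obtain C where C: "C \<subseteq> A" "countable C" "F = dom ` C"
    by (meson countable_subset_image)
  have cov: "(\<Union>c\<in>C. dom c) = UNIV" using F C atlas by (simp add: smooth_atlas_def)
  then have ne: "C \<noteq> {}" by auto
  define ch where "ch = from_nat_into C"
  have r: "range ch = C" using C ne by (simp add: ch_def)
  define D where "D = disjointed (\<lambda>i. dom (ch i))"
  have op: "open (dom (ch i))" for i using r C chart_open(1) by blast
  show thesis
  proof (rule that)
    show "ch i \<in> A" for i using r C by blast
    show "D i \<subseteq> dom (ch i)" for i by (auto simp: D_def disjointed_def)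
    show "D i \<in> sets borel" for i unfolding D_def disjointed_def using op by (intro sets.Diff sets.finite_UN) auto
    show "disjoint_family D" unfolding D_def by (rule disjoint_family_disjointed)
    show "(\<Union>i. D i) = UNIV" unfolding D_def UN_disjointed_eq using cov r by auto
  qed
qed

text \<open>Gives the definite description \<open>vol_measure\<close> its meaning. The measure is
  glued from the chart measures along a disjoint countable cover; countable additivity over the
  pieces also forces uniqueness.\<close>

lemma vol_measure_ex1: "\<exists>!\<mu>. is_vol_measure \<mu>"
proof -
  obtain ch :: "nat \<Rightarrow> ('m, 'n) chart" and D :: "nat \<Rightarrow> 'm set"
    where ch: "\<And>i. ch i \<in> A" and D: "\<And>i. D i \<subseteq> dom (ch i)" "\<And>i. D i \<in> sets borel"
      "disjoint_family D" "(\<Union>i. D i) = UNIV"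
    by (rule disjoint_chart_cover) metis
  define w where "w i B = emeasure (chart_measure (ch i)) (coords (ch i) ` (B \<inter> D i))" for i B
  define m where "m B = (\<Sum>i. w i B)" for B
  define \<mu> where "\<mu> = measure_of UNIV (sets borel) m"
  have csum: "(\<Sum>k. emeasure (chart_measure c) (coords c ` F k)) = emeasure (chart_measure c) (coords c ` (\<Union>k. F k))"
    if c: "c \<in> A" and F: "\<And>k. F k \<in> sets borel" "\<And>k. F k \<subseteq> dom c" "disjoint_family F" for c and F :: "nat \<Rightarrow> 'm set"
  proof -
    have "coords c ` F i \<inter> coords c ` F j = {}" if ij: "i \<noteq> j" for i j
    proof -
      have "inj_on (coords c) (dom c)"
        using c by (intro inj_on_inverseI[of _ "point c"]) simp
      then have "coords c ` F i \<inter> coords c ` F j = coords c ` (F i \<inter> F j)"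
        using F(2) inj_on_image_Int by blast
      also have "F i \<inter> F j = {}" using F(3) ij by (auto simp: disjoint_family_on_def)
      finally show ?thesis by simp
    qed
    then have "disjoint_family (\<lambda>k. coords c ` F k)" unfolding disjoint_family_on_def by blast
    moreover have "range (\<lambda>k. coords c ` F k) \<subseteq> sets (chart_measure c)"
      using coords_image_borel[OF c F(1,2)] by (auto simp: chart_measure_def)
    ultimately show ?thesis using suminf_emeasure[of "\<lambda>k. coords c ` F k"] by (simp add: image_UN)
  qed
  have "emeasure \<mu> B = m B" if "B \<in> sets borel" for B
    unfolding \<mu>_def
  proof (rule emeasure_measure_of_sigma)
    show "sigma_algebra UNIV (sets (borel :: 'm measure))"
      using sets.sigma_algebra_axioms[of "borel :: 'm measure"] by simp
    show "positive (sets borel) m" by (simp add: positive_def m_def w_def)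
    show "countably_additive (sets borel) m"
    proof (rule countably_additiveI)
      fix F :: "nat \<Rightarrow> 'm set"
      assume F: "range F \<subseteq> sets borel" "disjoint_family F"
      have "(\<Sum>k. w i (F k)) = w i (\<Union>k. F k)" for i
      proof -
        have "(\<Sum>k. w i (F k)) = emeasure (chart_measure (ch i)) (coords (ch i) ` (\<Union>k. F k \<inter> D i))"
          unfolding w_def
        proof (rule csum[OF ch])
          show "F k \<inter> D i \<in> sets borel" for k using F D(2) by auto
          show "F k \<inter> D i \<subseteq> dom (ch i)" for k using D(1) by blast
          show "disjoint_family (\<lambda>k. F k \<inter> D i)"
            using F(2) unfolding disjoint_family_on_def by blast
        qed
        also have "(\<Union>k. F k \<inter> D i) = (\<Union>k. F k) \<inter> D i" by blast
        finally show ?thesis by (simp add: w_def)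
      qed
      then show "(\<Sum>k. m (F k)) = m (\<Union>(range F))"
        unfolding m_def by (subst suminf_ennreal_swap) simp
    qed
  qed fact
  moreover have s\<mu>: "sets \<mu> = sets borel"
    unfolding \<mu>_def using sets.sigma_algebra_axioms[of "borel :: 'm measure"]
    by (simp add: sigma_algebra.sigma_sets_eq)
  \<comment> \<open>Compatibility of charts lets each piece be measured in \<open>c\<close> instead
    of its own chart, so the result does not depend on the chosen cover.\<close>
  moreover have "m B = emeasure (chart_measure c) (coords c ` B)"
    if c: "c \<in> A" and B: "B \<in> sets borel" "B \<subseteq> dom c" for c B
  proof -
    have "w i B = emeasure (chart_measure c) (coords c ` (B \<inter> D i))" for i
      unfolding w_def using c B(1) subset_trans[OF Int_lower1 B(2)] ch D(2) subset_trans[OF Int_lower2 D(1)]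
      by (intro chart_measure_compatible) auto
    then have "m B = (\<Sum>i. emeasure (chart_measure c) (coords c ` (B \<inter> D i)))" by (simp add: m_def)
    also have "\<dots> = emeasure (chart_measure c) (coords c ` (\<Union>i. B \<inter> D i))"
    proof (rule csum[OF c])
      show "B \<inter> D i \<in> sets borel" "B \<inter> D i \<subseteq> dom c" for i using B D(2) by auto
      show "disjoint_family (\<lambda>i. B \<inter> D i)"
        using D(3) unfolding disjoint_family_on_def by blast
    qed
    also have "(\<Union>i. B \<inter> D i) = B" using D(4) by blast
    finally show ?thesis .
  qed
  ultimately have "is_vol_measure \<mu>" by (simp add: is_vol_measure_def emeasure_chart_measure)
  moreover have "\<mu>1 = \<mu>2" if v: "is_vol_measure \<mu>1" "is_vol_measure \<mu>2" for \<mu>1 \<mu>2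
  proof (rule measure_eqI)
    show s: "sets \<mu>1 = sets \<mu>2" using v by (simp add: is_vol_measure_def)
    fix B assume "B \<in> sets \<mu>1"
    then have B: "B \<in> sets borel" using v by (simp add: is_vol_measure_def)
    \<comment> \<open>The right-hand side does not mention \<open>\<nu>\<close>, which is why any
      two candidates coincide.\<close>
    have "emeasure \<nu> B = (\<Sum>i. emeasure (chart_measure (ch i)) (coords (ch i) ` (B \<inter> D i)))"
      if \<nu>: "is_vol_measure \<nu>" for \<nu>
    proof -
      have "(\<Sum>i. emeasure \<nu> (B \<inter> D i)) = emeasure \<nu> (\<Union>i. B \<inter> D i)"
      proof (rule suminf_emeasure)
        show "range (\<lambda>i. B \<inter> D i) \<subseteq> sets \<nu>" using B D(2) \<nu> by (auto simp: is_vol_measure_def)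
        show "disjoint_family (\<lambda>i. B \<inter> D i)"
          using D(3) unfolding disjoint_family_on_def by blast
      qed
      moreover have "(\<Union>i. B \<inter> D i) = B" using D(4) by blast
      moreover have "emeasure \<nu> (B \<inter> D i) = emeasure (chart_measure (ch i)) (coords (ch i) ` (B \<inter> D i))" for i
        using B D(2) ch subset_trans[OF Int_lower2 D(1)] by (intro is_vol_measure_chart \<nu>) auto
      ultimately show ?thesis by simp
    qed
    then show "emeasure \<mu>1 B = emeasure \<mu>2 B" using v by simp
  qed
  ultimately show ?thesis by blast
qed

lemma vol_measure_is_vol: "is_vol_measure (vol_measure A g)"
  unfolding vol_measure_def is_vol_measure_def[symmetric] by (rule theI'[OF vol_measure_ex1])

lemma vol_measure_unique: "is_vol_measure \<mu> \<Longrightarrow> vol_measure A g = \<mu>"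
  using vol_measure_ex1 vol_measure_is_vol by blast

lemma sets_vol_measure [simp, measurable_cong]: "sets (vol_measure A g) = sets borel"
  using vol_measure_is_vol by (simp add: is_vol_measure_def)

lemma space_vol_measure [simp]: "space (vol_measure A g) = UNIV"
  using sets_eq_imp_space_eq[OF sets_vol_measure] by simp

text \<open>Used to turn vanishing almost everywhere into vanishing everywhere for continuous
  functions.\<close>

lemma emeasure_vol_measure_open_pos:
  assumes "open V" "V \<noteq> {}"
  shows "emeasure (vol_measure A g) V \<noteq> 0"
proof
  assume 0: "emeasure (vol_measure A g) V = 0"
  obtain p where p: "p \<in> V" using assms by auto
  define c where "c = chart_at A p"
  have c: "c \<in> A" "p \<in> dom c" using chart_at[of p] by (auto simp: c_def charts_at_iff)
  define S where "S = coords c ` (dom c \<inter> V)"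
  have S: "open S" "S \<noteq> {}" using coords_image_open[OF c(1) assms(1)] c p by (auto simp: S_def)
  have bV: "dom c \<inter> V \<in> sets borel" using chart_open(1)[OF c(1)] assms by auto
  have "emeasure (vol_measure A g) (dom c \<inter> V) \<le> emeasure (vol_measure A g) V"
    using assms by (intro emeasure_mono) auto
  then have "emeasure (vol_measure A g) (dom c \<inter> V) = 0" using 0 by simp
  then have "(\<integral>\<^sup>+x\<in>S. ennreal (vol_density A g c x) \<partial>lborel) = 0"
    using vol_measure_is_vol c(1) bV unfolding is_vol_measure_def S_def by simp
  also have "(\<integral>\<^sup>+x\<in>S. ennreal (vol_density A g c x) \<partial>lborel) =
      (\<integral>\<^sup>+x. ennreal (indicator S x * vol_density A g c x) \<partial>lborel)"
    by (intro nn_integral_cong) (auto simp: indicator_def)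
  finally have "AE x in lborel. ennreal (indicator S x * vol_density A g c x) = 0"
  proof (subst (asm) nn_integral_0_iff_AE)
    have "(\<lambda>x. indicator S x * vol_density A g c x) \<in> borel_measurable borel"
      by (rule borel_measurable_indicator_mult_continuous[where U = "coords c ` dom c"])
        (use S C1_on_continuous[OF vol_density_C1[OF g c(1)]] in \<open>auto simp: S_def\<close>)
    then show "(\<lambda>x. ennreal (indicator S x * vol_density A g c x)) \<in> borel_measurable lborel" by simp
  qed
  then have "AE x in lborel. x \<notin> S"
  proof (rule AE_mp, intro AE_I2 impI notI)
    fix x assume "ennreal (indicator S x * vol_density A g c x) = 0" "x \<in> S"
    moreover have "0 < vol_density A g c x"
      using \<open>x \<in> S\<close> by (intro vol_density_pos[OF g c(1)]) (auto simp: S_def)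
    ultimately show False by simp
  qed
  then have "emeasure lborel S = 0"
    using S(1) AE_iff_null[of lborel "\<lambda>x. x \<notin> S"] by (auto simp: null_sets_def)
  then have "negligible S" using S(1)
    by (simp add: negligible_iff_emeasure0 null_sets_def)
  then show False using open_not_negligible[OF S] by simp
qed

text \<open>Integration of a function supported in one chart. The coordinate integrand
  \<open>h\<close> is a separate function because its integrability will come from its form as a
  divergence.\<close>

lemma integral_chart:
  assumes c: "c \<in> A" and f: "f \<in> borel_measurable borel" "\<And>p. p \<notin> dom c \<Longrightarrow> f p = 0"
    and h: "integrable lborel h" "\<And>x. h x = (if x \<in> coords c ` dom c then vol_density A g c x * f (point c x) else 0)"
  shows "integrable (vol_measure A g) f" "(\<integral>p. f p \<partial>vol_measure A g) = (\<integral>x. h x \<partial>lborel)"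
proof -
  let ?U = "coords c ` dom c" and ?\<mu> = "vol_measure A g"
  \<comment> \<open>A version of \<open>point c\<close> that is measurable on the whole space; the
    value off the image does not matter, as \<open>chart_measure c\<close> has no mass
    there.\<close>
  define pt where "pt x = (if x \<in> ?U then point c x else undefined)" for x
  have U: "?U \<in> sets borel" using chart_open(2)[OF c] by simp
  have dc: "dom c \<in> sets borel" using chart_open(1)[OF c] by simp
  have pt: "pt \<in> measurable borel borel"
    unfolding pt_def
  proof (subst measurable_If_restrict_space_iff)
    show "point c \<in> restrict_space borel {x. x \<in> ?U} \<rightarrow>\<^sub>M borel \<and> (\<lambda>x. undefined) \<in> restrict_space borel {x. x \<notin> ?U} \<rightarrow>\<^sub>M borel"
      using borel_measurable_continuous_on_restrict[OF continuous_point[OF c]] by simp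
  qed (use U in simp_all)
  define N where "N = distr (chart_measure c) borel pt"
  have pt': "pt \<in> measurable (chart_measure c) borel" using pt by (simp add: chart_measure_def)
  \<comment> \<open>The volume measure restricted to the chart domain is the image of the chart
    measure. The rest transports the integral along this identity and unfolds the densities.\<close>
  have "density ?\<mu> (indicator (dom c)) = N"
  proof (rule measure_eqI)
    show "sets (density ?\<mu> (indicator (dom c))) = sets N" by (simp add: N_def)
    fix B assume "B \<in> sets (density ?\<mu> (indicator (dom c)))"
    then have B: "B \<in> sets borel" by simp
    have BU: "B \<inter> dom c \<in> sets borel" using B dc by auto
    have "emeasure (density ?\<mu> (indicator (dom c))) B = emeasure ?\<mu> (B \<inter> dom c)"
      using B dc by (subst emeasure_density)
        (auto simp: indicator_inter_arith[symmetric] mult.commute Int_commute)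
    also have "\<dots> = emeasure (chart_measure c) (coords c ` (B \<inter> dom c))"
      using is_vol_measure_chart[OF vol_measure_is_vol c BU] by simp
    also have "\<dots> = emeasure (chart_measure c) (pt -` B)"
    proof -
      have e: "ennreal (indicator ?U x * vol_density A g c x) * indicator (coords c ` (B \<inter> dom c)) x =
          ennreal (indicator ?U x * vol_density A g c x) * indicator (pt -` B) x" for x
      proof (cases "x \<in> ?U")
        case True
        then have "x \<in> coords c ` (B \<inter> dom c) \<longleftrightarrow> pt x \<in> B"
          using coords_image_iff[OF c, of x B] by (simp add: pt_def Int_commute)
        then show ?thesis by (simp add: indicator_def)
      qed simp
      have m: "pt -` B \<in> sets borel" using measurable_sets[OF pt B] by simp
      show ?thesis
        unfolding chart_measure_def using vol_density_measurable[OF c] m coords_image_borel[OF c BU]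
        by (simp add: emeasure_density e)
    qed
    also have "\<dots> = emeasure N B"
      unfolding N_def using B pt' by (subst emeasure_distr) (auto simp: chart_measure_def)
    finally show "emeasure (density ?\<mu> (indicator (dom c))) B = emeasure N B" .
  qed
  moreover have "(indicator (dom c) :: 'm \<Rightarrow> ennreal) = (\<lambda>p. ennreal (indicator (dom c) p))"
    by (auto simp: indicator_def)
  ultimately have N: "density ?\<mu> (\<lambda>p. ennreal (indicator (dom c) p)) = N" by simp
  have f1: "indicator (dom c) p * f p = f p" for p using f(2)[of p] by (auto simp: indicator_def)
  have f2: "indicator ?U x * vol_density A g c x * f (pt x) = h x" for x
    by (auto simp: h(2) pt_def indicator_def)
  have nn: "0 \<le> indicator ?U x * vol_density A g c x" for x
    using vol_density_pos[OF g c, of x] by (auto simp: indicator_def)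
  have fm: "f \<in> borel_measurable ?\<mu>" using f(1) by simp
  have fpt: "(\<lambda>x. f (pt x)) \<in> borel_measurable lborel"
    using measurable_compose[OF pt f(1)] by simp
  have iN: "integrable ?\<mu> f \<longleftrightarrow> integrable N f" "integral\<^sup>L ?\<mu> f = integral\<^sup>L N f"
    unfolding N[symmetric] using fm dc
    by (simp_all add: integrable_density integral_density f1)
  have iC: "integrable N f \<longleftrightarrow> integrable (chart_measure c) (\<lambda>x. f (pt x))"
    "integral\<^sup>L N f = (\<integral>x. f (pt x) \<partial>chart_measure c)"
    unfolding N_def using integrable_distr_eq[OF pt' f(1)] integral_distr[OF pt' f(1)] by auto
  have iL: "integrable (chart_measure c) (\<lambda>x. f (pt x)) \<longleftrightarrow> integrable lborel h"
    "(\<integral>x. f (pt x) \<partial>chart_measure c) = (\<integral>x. h x \<partial>lborel)"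
    unfolding chart_measure_def using fpt vol_density_measurable[OF c] nn
    by (simp_all add: integrable_density integral_density f2)
  show "integrable ?\<mu> f" "(\<integral>p. f p \<partial>?\<mu>) = (\<integral>x. h x \<partial>lborel)"
    using iN iC iL h(1) by auto
qed

end

text \<open>By uniqueness it is enough that the scaled measure obeys the chart formula of
  \<open>g'\<close>.\<close>

lemma vol_measure_scale:
  assumes g: "riemannian_metric A g" and g': "riemannian_metric A g'" and k: "0 \<le> k"
    and dens: "\<And>c x. c \<in> A \<Longrightarrow> x \<in> coords c ` dom c \<Longrightarrow> vol_density A g' c x = k * vol_density A g c x"
  shows "vol_measure A g' = density (vol_measure A g) (\<lambda>_. ennreal k)"
proof (rule vol_measure_unique[OF g'])
  have "emeasure (density (vol_measure A g) (\<lambda>_. ennreal k)) B =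
      (\<integral>\<^sup>+x\<in>coords c ` B. ennreal (vol_density A g' c x) \<partial>lborel)"
    if c: "c \<in> A" and B: "B \<in> sets borel" "B \<subseteq> dom c" for c B
  proof -
    have "emeasure (density (vol_measure A g) (\<lambda>_. ennreal k)) B = ennreal k * emeasure (vol_measure A g) B"
      using B sets_vol_measure[OF g] by (simp add: emeasure_density_const)
    also have "emeasure (vol_measure A g) B = (\<integral>\<^sup>+x\<in>coords c ` B. ennreal (vol_density A g c x) \<partial>lborel)"
      using vol_measure_is_vol[OF g] c B unfolding is_vol_measure_def[OF g] by blast
    also have "\<dots> = (\<integral>\<^sup>+x. ennreal (indicator (coords c ` B) x * vol_density A g c x) \<partial>lborel)"
      by (intro nn_integral_cong) (auto simp: indicator_def)
    also have "ennreal k * \<dots> = (\<integral>\<^sup>+x. ennreal k * ennreal (indicator (coords c ` B) x * vol_density A g c x) \<partial>lborel)"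
    proof (rule nn_integral_cmult[symmetric])
      have "(\<lambda>x. indicator (coords c ` B) x * vol_density A g c x) \<in> borel_measurable borel"
        by (rule borel_measurable_indicator_mult_continuous[OF coords_image_borel[OF c B] image_mono[OF B(2)]])
          (rule C1_on_continuous[OF vol_density_C1[OF g c]])
      then show "(\<lambda>x. ennreal (indicator (coords c ` B) x * vol_density A g c x)) \<in> borel_measurable lborel"
        by simp
    qed
    also have "\<dots> = (\<integral>\<^sup>+x\<in>coords c ` B. ennreal (vol_density A g' c x) \<partial>lborel)"
      using dens[OF c] B k by (intro nn_integral_cong) (auto simp: indicator_def ennreal_mult' subset_eq)
    finally show ?thesis .
  qed
  then show "is_vol_measure g' (density (vol_measure A g) (\<lambda>_. ennreal k))"
    unfolding is_vol_measure_def[OF g'] using sets_vol_measure[OF g] by simp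
qed

end


section \<open>The weak form of the torsion equation\<close>

lemma grad_sum:
  assumes "\<And>i. i \<in> I \<Longrightarrow> C1_on U (f i)" "x \<in> U"
  shows "grad (\<lambda>y. \<Sum>i\<in>I. f i y) x = (\<Sum>i\<in>I. grad (f i) x)"
proof (rule grad_eq)
  have "((\<lambda>y. \<Sum>i\<in>I. f i y) has_derivative (\<lambda>h. \<Sum>i\<in>I. grad (f i) x \<bullet> h)) (at x)"
    by (intro has_derivative_sum C1_onD(1)) (use assms in auto)
  moreover have "(\<lambda>h. \<Sum>i\<in>I. grad (f i) x \<bullet> h) = (\<bullet>) (\<Sum>i\<in>I. grad (f i) x)"
    by (simp add: fun_eq_iff inner_sum_left)
  ultimately show "((\<lambda>y. \<Sum>i\<in>I. f i y) has_derivative (\<bullet>) (\<Sum>i\<in>I. grad (f i) x)) (at x)"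
    by simp
qed

lemma grad_zero_open:
  fixes f :: "real^'n \<Rightarrow> real"
  assumes "open U" "x \<in> U" "\<And>y. y \<in> U \<Longrightarrow> f y = 0"
  shows "grad f x = 0"
  using grad_cong[of U x "\<lambda>_. 0" f] assms grad_eq[of "\<lambda>_. 0" 0 x] by simp

text \<open>Squaring makes the positive part continuously differentiable; bump functions and
  truncations are built from it.\<close>

lemma has_real_derivative_max0_square:
  "((\<lambda>u. (max 0 u)\<^sup>2) has_real_derivative 2 * max 0 y) (at (y::real))"
proof -
  consider "0 < y" | "y < 0" | "y = 0" by linarith
  then show ?thesis
  proof cases
    case 1
    have "((\<lambda>u. u\<^sup>2) has_real_derivative 2 * y) (at y)"
      by (auto intro!: derivative_eq_intros)
    then have "((\<lambda>u. (max 0 u)\<^sup>2) has_real_derivative 2 * y) (at y)"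
      by (rule has_field_derivative_transform_within_open[where S = "{0<..}"]) (use 1 in auto)
    then show ?thesis using 1 by simp
  next
    case 2
    have "((\<lambda>u. (max 0 u)\<^sup>2) has_real_derivative 0) (at y)"
      by (rule has_field_derivative_transform_within_open[where S = "{..<0}" and f = "\<lambda>_. 0"])
        (use 2 in auto)
    then show ?thesis using 2 by simp
  next
    case 3
    have "((\<lambda>h. (max 0 (0 + h))\<^sup>2 / h) \<longlongrightarrow> 0) (at (0::real))"
    proof (rule Lim_null_comparison)
      show "\<forall>\<^sub>F h in at (0::real). norm ((max 0 (0 + h))\<^sup>2 / h) \<le> \<bar>h\<bar>"
        by (rule always_eventually) (auto simp: max_def power2_eq_square)
      show "((\<lambda>h. \<bar>h\<bar>) \<longlongrightarrow> 0) (at (0::real))" by (auto intro!: tendsto_eq_intros)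
    qed
    then show ?thesis using 3 by (simp add: DERIV_def)
  qed
qed

section \<open>Bump functions and localization\<close>

context atlas
begin

text \<open>Test functions of class C^1 suffice, so the squared positive part of a radial quadratic
  polynomial in one chart serves as the bump.\<close>

lemma bump_function:
  assumes V: "open V" "p \<in> V"
  obtains c S and \<beta> :: "'m \<Rightarrow> real"
  where "c \<in> A" "compact S" "S \<subseteq> dom c \<inter> V" "C1m_on UNIV \<beta>" "\<And>q. 0 \<le> \<beta> q" "0 < \<beta> p" "\<And>q. q \<notin> S \<Longrightarrow> \<beta> q = 0"
proof -
  define c where "c = chart_at A p"
  have c: "c \<in> A" "p \<in> dom c" using chart_at[of p] by (auto simp: c_def charts_at_iff)
  define x0 where "x0 = coords c p"
  let ?U = "coords c ` (dom c \<inter> V)"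
  have "open ?U" "x0 \<in> ?U" using coords_image_open[OF c(1) V(1)] c V by (auto simp: x0_def)
  then obtain r where r: "0 < r" "cball x0 r \<subseteq> ?U" using open_contains_cball by blast
  define b where "b x = (max 0 (r\<^sup>2 - (x - x0) \<bullet> (x - x0)))\<^sup>2" for x
  have "((\<lambda>x. r\<^sup>2 - (x - x0) \<bullet> (x - x0)) has_derivative (\<lambda>h. (- 2 *\<^sub>R (x - x0)) \<bullet> h)) (at x)" for x
    by (auto intro!: derivative_eq_intros simp: inner_commute)
  then have "C1_on UNIV (\<lambda>x. r\<^sup>2 - (x - x0) \<bullet> (x - x0))"
    by (rule C1_onI) (intro continuous_intros)
  then have b: "C1_on UNIV b"
    unfolding b_def
    by (rule C1_on_compose(1)[where V = UNIV and \<phi>' = "\<lambda>y. 2 * max 0 y"])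
      (auto intro!: continuous_intros has_real_derivative_max0_square)
  have b0: "b x = 0" if "x \<notin> cball x0 r" for x
  proof -
    have "r < norm (x - x0)" using that by (simp add: dist_norm norm_minus_commute)
    then have "r\<^sup>2 < (norm (x - x0))\<^sup>2" using r(1) by (intro power_strict_mono) auto
    then show ?thesis by (simp add: b_def power2_norm_eq_inner max_def)
  qed
  define S where "S = point c ` cball x0 r"
  have sub: "cball x0 r \<subseteq> coords c ` dom c" using r by auto
  have S: "compact S" unfolding S_def
    by (rule compact_continuous_image[OF continuous_on_subset[OF continuous_point[OF c(1)] sub]]) simp
  have SV: "S \<subseteq> dom c \<inter> V" unfolding S_def using r(2) c by fastforce
  define \<beta> where "\<beta> q = (if q \<in> dom c then b (coords c q) else 0)" for q
  have \<beta>0: "\<beta> q = 0" if "q \<notin> S" for q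
  proof (cases "q \<in> dom c")
    case True
    then have "coords c q \<notin> cball x0 r" using that c(1) unfolding S_def by (metis image_eqI point_coords)
    then show ?thesis by (simp add: \<beta>_def b0)
  qed (simp add: \<beta>_def)
  have c\<beta>: "C1m_on (dom c) \<beta>"
  proof (rule C1m_on_chart[OF c(1) chart_open(1)[OF c(1)] order_refl])
    show "C1_on (coords c ` dom c) (\<beta> \<circ> point c)"
      by (rule C1_on_cong[OF chart_open(2)[OF c(1)] _ C1_on_subset[OF b]]) (use c in \<open>auto simp: \<beta>_def\<close>)
  qed
  have "C1m_on UNIV \<beta>"
    by (rule C1m_on_zero_extension[OF chart_open(1)[OF c(1)] compact_imp_closed[OF S] _ c\<beta> \<beta>0])
      (use SV in auto)
  moreover have "0 < \<beta> p" using r(1) c by (simp add: \<beta>_def b_def x0_def max_def)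
  moreover have "0 \<le> \<beta> q" for q by (simp add: \<beta>_def b_def)
  ultimately show thesis using that c(1) S SV \<beta>0 by blast
qed

lemma C2_on_C1m_on: "C2_on A V f \<Longrightarrow> C1m_on V f"
  unfolding C2_on_def C1m_on_def using Ck_on_2_C1_on(1) by blast

lemma gradc_zero:
  assumes "c \<in> charts_at A p" "open V" "p \<in> V" "\<And>q. q \<in> V \<Longrightarrow> f q = 0"
  shows "gradc c f p = 0"
proof (rule grad_zero_open)
  show "open (coords c ` (dom c \<inter> V))" using assms coords_image_open by (auto simp: charts_at_iff)
qed (use assms in \<open>auto simp: charts_at_iff\<close>)

lemma cometric_zero:
  assumes "open V" "p \<in> V" "\<And>q. q \<in> V \<Longrightarrow> f q = 0"
  shows "cometric g f h p = 0"
  using gradc_zero[OF chart_at assms] by (simp add: cometric_def)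

lemma cometric_sum:
  assumes "\<And>i. i \<in> I \<Longrightarrow> C1m_on UNIV (f i)"
  shows "cometric g (\<lambda>q. \<Sum>i\<in>I. f i q) h p = (\<Sum>i\<in>I. cometric g (f i) h p)"
proof -
  define c where "c = chart_at A p"
  have c: "c \<in> A" "p \<in> dom c" using chart_at[of p] by (auto simp: c_def charts_at_iff)
  have "gradc c (\<lambda>q. \<Sum>i\<in>I. f i q) p = (\<Sum>i\<in>I. gradc c (f i) p)"
    unfolding comp_def
    by (rule grad_sum[where U = "coords c ` (dom c \<inter> UNIV)"])
      (use C1m_onD[OF assms c(1)] c in \<open>auto simp: o_def\<close>)
  then show ?thesis by (simp add: cometric_def Let_def c_def inner_sum_left)
qed

section \<open>Integration by parts against test functions\<close>

context
  fixes g :: "('m, 'n) metric" and \<Omega> :: "'m set" and E :: "'m \<Rightarrow> real"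
  assumes g: "riemannian_metric A g" and \<Omega>: "open \<Omega>" and C2: "C2_on A \<Omega> E"
    and lap: "\<And>p. p \<in> \<Omega> \<Longrightarrow> has_laplacian A g E p (- 1)"
begin

text \<open>In coordinates the integrand times the density is the divergence of the compactly
  supported fields \<open>F i\<close>, and a divergence has integral zero. The difference stays
  under one integral because it is the difference that has divergence form.\<close>

lemma weak_form_chart:
  assumes c: "c \<in> A" and K: "compact K" "K \<subseteq> dom c \<inter> \<Omega>"
    and \<psi>: "C1m_on UNIV \<psi>" "\<And>q. q \<notin> K \<Longrightarrow> \<psi> q = 0"
  shows "integrable (vol_measure A g) (\<lambda>p. cometric g \<psi> E p - \<psi> p)"
    and "(\<integral>p. cometric g \<psi> E p - \<psi> p \<partial>vol_measure A g) = 0"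
proof -
  let ?W = "dom c \<inter> \<Omega>" and ?UU = "coords c ` dom c"
  define U where "U = coords c ` ?W"
  define \<psi>' where "\<psi>' = \<psi> \<circ> point c"
  define E' where "E' = E \<circ> point c"
  define \<rho> where "\<rho> = vol_density A g c"
  define Y where "Y i x = \<rho> x * (\<Sum>j\<in>UNIV. gram_inv A g c x $ i $ j * partial j E' x)" for i x
  \<comment> \<open>Outside \<open>U\<close> the coordinate expressions are meaningless; since
    \<open>\<psi>\<close> vanishes off \<open>K\<close>, cutting off at \<open>U\<close> keeps the
    field of class C^1 on the whole space.\<close>
  define F where "F i x = (if x \<in> U then \<psi>' x * Y i x else 0)" for i x
  define res where "res p = cometric g \<psi> E p - \<psi> p" for p
  define h where "h x = (\<Sum>i\<in>UNIV. partial i (F i) x)" for x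
  have oU: "open U" unfolding U_def by (rule coords_image_open[OF c \<Omega>])
  have oW: "open ?W" using chart_open(1)[OF c] \<Omega> by auto
  have UUU: "U \<subseteq> ?UU" by (auto simp: U_def)
  have cE: "C1_on U E'" "C1_on U (partial j E')" for j
    using C2 c Ck_on_2_C1_on unfolding C2_on_def U_def E'_def by blast+
  have c\<psi>: "C1_on U \<psi>'"
    using C1_on_subset[OF C1m_onD[OF \<psi>(1) c], of U] unfolding \<psi>'_def U_def by auto
  have c\<rho>: "C1_on U \<rho>" unfolding \<rho>_def by (rule C1_on_subset[OF vol_density_C1[OF g c] UUU])
  have cG: "C1_on U (\<lambda>x. gram_inv A g c x $ i $ j)" for i j
    by (rule C1_on_subset[OF gram_inv_C1[OF g c] UUU])
  have cY: "C1_on U (Y i)" for i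
    unfolding Y_def by (intro C1_on_mult(1) C1_on_sum cG cE c\<rho>)
  define K' where "K' = coords c ` K"
  have K': "compact K'" "K' \<subseteq> U"
    unfolding K'_def U_def using K
    by (auto intro!: compact_continuous_image continuous_on_subset[OF continuous_coords[OF c]])
  have F0: "F i x = 0" if "x \<notin> K'" for i x
  proof (cases "x \<in> U")
    case True
    then have "x \<in> ?UU" using UUU by auto
    then have "point c x \<notin> K" using that c unfolding K'_def by (metis coords_point image_eqI)
    then show ?thesis by (simp add: F_def \<psi>'_def \<psi>(2))
  qed (simp add: F_def)
  have cF: "C1_on UNIV (F i)" for i
  proof (rule C1_on_zero_extension[OF oU compact_imp_closed[OF K'(1)] K'(2) _ F0])
    show "C1_on U (F i)"
      by (rule C1_on_cong[OF oU _ C1_on_mult(1)[OF c\<psi> cY[of i]]]) (simp add: F_def)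
  qed
  have res0: "res p = 0" if "p \<notin> K" for p
    using cometric_zero[of "- K" p \<psi>] \<psi>(2) that K(1)
    by (auto simp: res_def compact_imp_closed open_Compl)
  have resU: "res p = grad \<psi>' (coords c p) \<bullet> (gram_inv A g c (coords c p) *v grad E' (coords c p)) - \<psi>' (coords c p)"
    if p: "p \<in> ?W" for p
    using cometric_chart[OF g _ \<Omega>, of c p \<psi> E] C1m_on_subset[OF \<psi>(1)] C2_on_C1m_on[OF C2] p c
    by (simp add: res_def charts_at_iff \<psi>'_def E'_def)
  have hU: "h x = \<rho> x * res (point c x)" if x: "x \<in> U" for x
  proof -
    have xUU: "x \<in> ?UU" "point c x \<in> ?W" "coords c (point c x) = x"
      using x c unfolding U_def by auto
    have \<rho>x: "0 < \<rho> x" unfolding \<rho>_def by (rule vol_density_pos[OF g c xUU(1)])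
    have "partial i (F i) x = \<psi>' x * partial i (Y i) x + Y i x * partial i \<psi>' x" for i
    proof -
      have "grad (F i) x = grad (\<lambda>x. \<psi>' x * Y i x) x"
        by (rule grad_cong[OF oU x]) (simp add: F_def)
      also have "\<dots> = \<psi>' x *\<^sub>R grad (Y i) x + Y i x *\<^sub>R grad \<psi>' x"
        by (rule C1_on_mult(2)[OF c\<psi> cY x])
      finally show ?thesis by (metis grad_nth real_scaleR_def vector_add_component vector_scaleR_component)
    qed
    then have "h x = \<psi>' x * (\<Sum>i\<in>UNIV. partial i (Y i) x) + (\<Sum>i\<in>UNIV. Y i x * partial i \<psi>' x)"
      by (simp add: h_def sum.distrib sum_distrib_left)
    \<comment> \<open>The equation \<open>\<Delta>E = -1\<close>, multiplied by the density.\<close>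
    also have "(\<Sum>i\<in>UNIV. partial i (Y i) x) = - \<rho> x"
    proof -
      have "(\<Sum>i\<in>UNIV. partial i (Y i) x) / \<rho> x = - 1"
        using lap[of "point c x"] xUU c
        unfolding has_laplacian_def Y_def[abs_def] E'_def \<rho>_def by (auto simp: charts_at_iff)
      then show ?thesis using \<rho>x by (simp add: field_simps)
    qed
    also have "(\<Sum>i\<in>UNIV. Y i x * partial i \<psi>' x) = \<rho> x * (grad \<psi>' x \<bullet> (gram_inv A g c x *v grad E' x))"
      by (simp add: Y_def inner_vec_def matrix_vector_mult_def sum_distrib_left sum_distrib_right mult_ac)
    finally show ?thesis unfolding resU[OF xUU(2)] xUU(3) by (simp add: algebra_simps)
  qed
  \<comment> \<open>Inside \<open>U\<close> this is the computation above; outside, both sides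
    vanish because the supports lie in \<open>K\<close> and its image \<open>K'\<close>.\<close>
  have h_eq: "h x = (if x \<in> ?UU then vol_density A g c x * res (point c x) else 0)" for x
  proof (cases "x \<in> U")
    case True
    then show ?thesis using hU UUU by (auto simp: \<rho>_def)
  next
    case False
    then have "x \<notin> K'" using K' by auto
    have "grad (F i) x = 0" for i
      by (rule grad_zero_open[of "- K'"]) (use \<open>x \<notin> K'\<close> F0 K'(1) in \<open>auto simp: compact_imp_closed open_Compl\<close>)
    then have h0: "h x = 0" by (simp add: h_def grad_nth[symmetric] del: grad_nth)
    show ?thesis
    proof (cases "x \<in> ?UU")
      case True
      then have "point c x \<notin> ?W"
        using False c unfolding U_def by (metis coords_point image_eqI)
      then have "point c x \<notin> K" using K by auto
      then show ?thesis using h0 res0 by simp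
    qed (use h0 in simp)
  qed
  have ih: "integrable lborel h" "(\<integral>x. h x \<partial>lborel) = 0"
    unfolding h_def using integral_partial_compact_support[OF cF K'(1) F0]
    by (simp_all add: Bochner_Integration.integral_sum)
  have m: "res \<in> borel_measurable borel"
  proof -
    have cc: "continuous_on ?W (coords c)" by (rule continuous_on_subset[OF continuous_coords[OF c]]) simp
    have comp: "continuous_on ?W (\<lambda>p. k (coords c p))" if "continuous_on U k" for k :: "real^'n \<Rightarrow> 'z::topological_space"
      by (rule continuous_on_compose2[OF that cc]) (auto simp: U_def)
    have "continuous_on U (\<lambda>x. gram_inv A g c x *v grad E' x)"
      unfolding matrix_vector_mult_def
      by (intro continuous_on_vec_lambda continuous_on_sum continuous_on_mult C1_on_continuous[OF cG]
          continuous_on_component C1_onD(2)[OF cE(1)])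
    then have "continuous_on U (\<lambda>x. grad \<psi>' x \<bullet> (gram_inv A g c x *v grad E' x) - \<psi>' x)"
      by (intro continuous_on_diff continuous_on_inner C1_onD(2)[OF c\<psi>] C1_on_continuous[OF c\<psi>])
    from comp[OF this] have "continuous_on ?W res"
      by (rule continuous_on_eq) (simp add: resU)
    then have "(\<lambda>p. indicator ?W p * res p) \<in> borel_measurable borel"
      using oW by (intro borel_measurable_indicator_mult_continuous[OF _ order_refl]) auto
    moreover have "(\<lambda>p. indicator ?W p * res p) = res"
      using res0 K by (auto simp: indicator_def fun_eq_iff)
    ultimately show ?thesis by simp
  qed
  have z: "res p = 0" if "p \<notin> dom c" for p using res0 K that by auto
  show "integrable (vol_measure A g) (\<lambda>p. cometric g \<psi> E p - \<psi> p)"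
    "(\<integral>p. cometric g \<psi> E p - \<psi> p \<partial>vol_measure A g) = 0"
    using integral_chart[OF g c m z ih(1) h_eq] ih(2) unfolding res_def by simp_all
qed

text \<open>A partition of unity over \<open>K\<close> splits \<psi> into finitely many pieces
  supported in single charts, and the claim is linear in \<psi>.\<close>

lemma weak_form:
  assumes K: "compact K" "K \<subseteq> \<Omega>" and \<psi>: "C1m_on UNIV \<psi>" "\<And>q. q \<notin> K \<Longrightarrow> \<psi> q = 0"
  shows "integrable (vol_measure A g) (\<lambda>p. cometric g \<psi> E p - \<psi> p)"
    and "(\<integral>p. cometric g \<psi> E p - \<psi> p \<partial>vol_measure A g) = 0"
proof -
  \<comment> \<open>Packs chart, support and bump function into one triple so that a single choice
    yields all three as functions of \<open>p\<close>.\<close>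
  define bump where "bump p t \<longleftrightarrow> (case t of (c, S, \<beta>) \<Rightarrow> c \<in> A \<and> compact S \<and> S \<subseteq> dom c \<inter> \<Omega> \<and>
      C1m_on UNIV \<beta> \<and> (\<forall>q. 0 \<le> \<beta> q) \<and> 0 < \<beta> p \<and> (\<forall>q. q \<notin> S \<longrightarrow> \<beta> q = 0))"
    for p and t :: "('m, 'n) chart \<times> 'm set \<times> ('m \<Rightarrow> real)"
  have "\<exists>t. bump p t" if pK: "p \<in> K" for p
  proof -
    have "p \<in> \<Omega>" using pK K by auto
    then show ?thesis by (rule bump_function[OF \<Omega>]) (auto simp: bump_def)
  qed
  then obtain t where t: "\<And>p. p \<in> K \<Longrightarrow> bump p (t p)" by metis
  define c where "c p = fst (t p)" for p
  define S where "S p = fst (snd (t p))" for p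
  define \<beta> where "\<beta> p = snd (snd (t p))" for p
  have \<beta>:
    "\<And>p. p \<in> K \<Longrightarrow> c p \<in> A" "\<And>p. p \<in> K \<Longrightarrow> compact (S p)" "\<And>p. p \<in> K \<Longrightarrow> S p \<subseteq> dom (c p) \<inter> \<Omega>"
    "\<And>p. p \<in> K \<Longrightarrow> C1m_on UNIV (\<beta> p)" "\<And>p q. p \<in> K \<Longrightarrow> 0 \<le> \<beta> p q" "\<And>p. p \<in> K \<Longrightarrow> 0 < \<beta> p p"
    "\<And>p q. p \<in> K \<Longrightarrow> q \<notin> S p \<Longrightarrow> \<beta> p q = 0"
    using t unfolding bump_def c_def S_def \<beta>_def by (auto simp: case_prod_beta)
  have opn: "open {q. 0 < \<beta> p q}" if "p \<in> K" for p
    using C1m_on_continuous[OF open_UNIV \<beta>(4)[OF that]] by (intro open_Collect_less continuous_on_const)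
  obtain P where P: "P \<subseteq> K" "finite P" "K \<subseteq> (\<Union>p\<in>P. {q. 0 < \<beta> p q})"
  proof (rule compactE_image[OF K(1), of K "\<lambda>p. {q. 0 < \<beta> p q}"])
    show "K \<subseteq> (\<Union>p\<in>K. {q. 0 < \<beta> p q})" using \<beta>(6) by auto
  qed (use opn in auto)
  define \<sigma> where "\<sigma> q = (\<Sum>p\<in>P. \<beta> p q)" for q
  have c\<sigma>: "C1m_on UNIV \<sigma>" unfolding \<sigma>_def using P \<beta>(4) by (intro C1m_on_sum) auto
  have \<sigma>K: "0 < \<sigma> q" if "q \<in> K" for q
  proof -
    obtain p where p: "p \<in> P" "0 < \<beta> p q" using P(3) \<open>q \<in> K\<close> by auto
    then show ?thesis unfolding \<sigma>_def using P \<beta>(5) by (intro sum_pos2[of P p]) auto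
  qed
  \<comment> \<open>Dividing by the sum of the bumps makes the pieces
    \<open>\<beta> p * \<psi>'\<close> add up to \<psi>. Where \<open>\<sigma>\<close> vanishes
    \<open>inverse\<close> returns 0, which is harmless since \<psi> is 0 off
    \<open>K\<close>.\<close>
  define \<psi>' where "\<psi>' q = \<psi> q * inverse (\<sigma> q)" for q
  have o: "open {q. 0 < \<sigma> q}"
    using C1m_on_continuous[OF open_UNIV c\<sigma>] by (intro open_Collect_less continuous_on_const)
  have c\<psi>': "C1m_on UNIV \<psi>'"
  proof (rule C1m_on_zero_extension[OF o compact_imp_closed[OF K(1)]])
    show "C1m_on {q. 0 < \<sigma> q} \<psi>'" unfolding \<psi>'_def
      by (intro C1m_on_mult C1m_on_inverse C1m_on_subset[OF \<psi>(1)] C1m_on_subset[OF c\<sigma>]) auto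
  qed (use \<sigma>K \<psi>(2) in \<open>auto simp: \<psi>'_def\<close>)
  define f where "f p q = \<beta> p q * \<psi>' q" for p q
  have cf: "C1m_on UNIV (f p)" if "p \<in> P" for p
    unfolding f_def using that P \<beta>(4) by (intro C1m_on_mult c\<psi>') auto
  have \<psi>_eq: "\<psi> = (\<lambda>q. \<Sum>p\<in>P. f p q)"
  proof
    fix q
    have "(\<Sum>p\<in>P. f p q) = \<sigma> q * \<psi>' q" by (simp add: f_def \<sigma>_def sum_distrib_right)
    then show "\<psi> q = (\<Sum>p\<in>P. f p q)" using \<sigma>K[of q] \<psi>(2)[of q] by (cases "q \<in> K") (auto simp: \<psi>'_def)
  qed
  have eq: "cometric g \<psi> E q - \<psi> q = (\<Sum>p\<in>P. cometric g (f p) E q - f p q)" for q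
    using cometric_sum[of P f g E q, OF cf] by (simp add: \<psi>_eq[symmetric] sum_subtractf) (simp add: \<psi>_eq)
  have part: "integrable (vol_measure A g) (\<lambda>q. cometric g (f p) E q - f p q)"
    "(\<integral>q. cometric g (f p) E q - f p q \<partial>vol_measure A g) = 0" if p: "p \<in> P" for p
  proof -
    have pK: "p \<in> K" using p P by auto
    have cS: "compact (S p \<inter> K)" using \<beta>(2)[OF pK] K(1) by (simp add: compact_Int)
    have sub: "S p \<inter> K \<subseteq> dom (c p) \<inter> \<Omega>" using \<beta>(3)[OF pK] by auto
    have z: "f p q = 0" if "q \<notin> S p \<inter> K" for q
      using that \<beta>(7)[OF pK, of q] \<psi>(2)[of q] by (auto simp: f_def \<psi>'_def)
    show "integrable (vol_measure A g) (\<lambda>q. cometric g (f p) E q - f p q)"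
      "(\<integral>q. cometric g (f p) E q - f p q \<partial>vol_measure A g) = 0"
      using weak_form_chart[OF \<beta>(1)[OF pK] cS sub cf[OF p] z] by auto
  qed
  show "integrable (vol_measure A g) (\<lambda>p. cometric g \<psi> E p - \<psi> p)"
    unfolding eq by (intro Bochner_Integration.integrable_sum part)
  show "(\<integral>p. cometric g \<psi> E p - \<psi> p \<partial>vol_measure A g) = 0"
    unfolding eq using part by (subst Bochner_Integration.integral_sum) auto
qed

end

end


section \<open>Comparison of torsional rigidities\<close>

text \<open>A C^1 substitute for the positive part of \<open>u - e\<close>: it vanishes for
  \<open>u \<le> e\<close>, which gives compact support, its slope lies in [0,1], and it loses at
  most \<open>2 * e\<close> against \<open>u\<close>.\<close>

definition trunc :: "real \<Rightarrow> real \<Rightarrow> real" where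
  "trunc e u = sqrt (e\<^sup>2 + (max 0 (u - e))\<^sup>2) - e"

definition trunc' :: "real \<Rightarrow> real \<Rightarrow> real" where
  "trunc' e u = max 0 (u - e) / sqrt (e\<^sup>2 + (max 0 (u - e))\<^sup>2)"

context
  fixes e :: real
  assumes e: "0 < e"
begin

lemma trunc_radicand_pos: "0 < e\<^sup>2 + (max 0 (u - e))\<^sup>2"
  using e by (simp add: add_pos_nonneg)

lemma has_real_derivative_trunc: "(trunc e has_real_derivative trunc' e u) (at u)"
proof -
  have "((\<lambda>u. (max 0 (u - e))\<^sup>2) has_real_derivative 2 * max 0 (u - e) * 1) (at u)"
    by (rule DERIV_chain2[OF has_real_derivative_max0_square]) (auto intro!: derivative_eq_intros)
  then have d: "((\<lambda>u. e\<^sup>2 + (max 0 (u - e))\<^sup>2) has_real_derivative 2 * max 0 (u - e)) (at u)"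
    using DERIV_add[OF DERIV_const[of "e\<^sup>2"]] by fastforce
  have s: "((\<lambda>u. sqrt (e\<^sup>2 + (max 0 (u - e))\<^sup>2)) has_real_derivative
      inverse (sqrt (e\<^sup>2 + (max 0 (u - e))\<^sup>2)) / 2 * (2 * max 0 (u - e))) (at u)"
    by (rule DERIV_chain2[OF DERIV_real_sqrt[OF trunc_radicand_pos] d])
  have eq: "inverse y / 2 * (2 * m) - 0 = m / y" for y m :: real by (simp add: inverse_eq_divide)
  have "((\<lambda>u. sqrt (e\<^sup>2 + (max 0 (u - e))\<^sup>2) - e) has_real_derivative
      inverse (sqrt (e\<^sup>2 + (max 0 (u - e))\<^sup>2)) / 2 * (2 * max 0 (u - e)) - 0) (at u)"
    by (rule DERIV_diff[OF s DERIV_const])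
  then have "((\<lambda>u. sqrt (e\<^sup>2 + (max 0 (u - e))\<^sup>2) - e) has_real_derivative trunc' e u) (at u)"
    unfolding eq trunc'_def .
  moreover have "trunc e = (\<lambda>u. sqrt (e\<^sup>2 + (max 0 (u - e))\<^sup>2) - e)"
    by (simp add: trunc_def fun_eq_iff)
  ultimately show ?thesis by simp
qed

lemma continuous_on_trunc': "continuous_on V (trunc' e)"
  unfolding trunc'_def[abs_def] using trunc_radicand_pos
  by (intro continuous_intros) (metis less_irrefl real_sqrt_eq_0_iff)

lemma trunc'_bounds: "0 \<le> trunc' e u" "trunc' e u \<le> 1"
proof -
  show "0 \<le> trunc' e u" by (simp add: trunc'_def)
  have "max 0 (u - e) \<le> sqrt (e\<^sup>2 + (max 0 (u - e))\<^sup>2)"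
    by (rule real_le_rsqrt) simp
  then show "trunc' e u \<le> 1" using trunc_radicand_pos[of u] by (simp add: trunc'_def)
qed

lemma trunc_zero: "u \<le> e \<Longrightarrow> trunc e u = 0"
  using e by (simp add: trunc_def)

lemma trunc_ge: "u - 2 * e \<le> trunc e u" "0 \<le> trunc e u"
proof -
  have "max 0 (u - e) \<le> sqrt (e\<^sup>2 + (max 0 (u - e))\<^sup>2)"
    by (rule real_le_rsqrt) simp
  moreover have "u - e \<le> max 0 (u - e)" by simp
  ultimately show "u - 2 * e \<le> trunc e u" unfolding trunc_def by linarith
  have "e \<le> sqrt (e\<^sup>2 + (max 0 (u - e))\<^sup>2)" by (rule real_le_rsqrt) simp
  then show "0 \<le> trunc e u" by (simp add: trunc_def)
qed

lemma trunc_pos: "e < u \<Longrightarrow> 0 < trunc e u"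
proof -
  assume "e < u"
  then have "sqrt (e\<^sup>2) < sqrt (e\<^sup>2 + (max 0 (u - e))\<^sup>2)" by (intro real_sqrt_less_mono) auto
  then show ?thesis using e by (simp add: trunc_def)
qed

end

text \<open>The gradient of Picone's test function, with \<open>f\<close>, \<open>v\<close> and
  \<open>d\<close> in the roles of the truncation, the second torsion function and the
  shift.\<close>

lemma has_grad_square_over:
  fixes f v :: "real^'n \<Rightarrow> real"
  assumes f: "(f has_derivative (\<lambda>h. a \<bullet> h)) (at x)" and v: "(v has_derivative (\<lambda>h. z \<bullet> h)) (at x)"
    and nz: "v x + d \<noteq> 0" "l \<noteq> 0"
  shows "((\<lambda>x. f x * f x * inverse (l * (v x + d))) has_derivative
     (\<lambda>h. ((2 * f x / (l * (v x + d))) *\<^sub>R a - (f x * f x / (l * (v x + d)\<^sup>2)) *\<^sub>R z) \<bullet> h)) (at x)"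
proof -
  have "((\<lambda>y. inverse (l * (y + d))) has_real_derivative - 1 / (l * (v x + d)\<^sup>2)) (at (v x))"
  proof -
    have "((\<lambda>y. l * (y + d)) has_real_derivative l) (at (v x))"
      by (auto intro!: derivative_eq_intros)
    from DERIV_inverse_fun[OF this] nz
    have "((\<lambda>y. inverse (l * (y + d))) has_real_derivative
        - (l * inverse ((l * (v x + d)) ^ Suc (Suc 0)))) (at (v x))" by simp
    moreover have "- (l * inverse ((l * w) ^ Suc (Suc 0))) = - 1 / (l * w\<^sup>2)" for w
      using nz(2) by (simp add: field_simps power2_eq_square)
    ultimately show ?thesis by (simp only:)
  qed
  then have "((\<lambda>y. inverse (l * (y + d))) has_derivative (*) (- 1 / (l * (v x + d)\<^sup>2))) (at (v x))"
    by (simp add: has_field_derivative_def)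
  note d = has_derivative_mult[OF has_derivative_mult[OF f f] has_derivative_compose[OF v this]]
  have "F * F * (- 1 / (l * y\<^sup>2) * Q) + (F * P + P * F) * inverse (l * y) =
      2 * F / (l * y) * P - F * F / (l * y\<^sup>2) * Q" for F P Q y :: real
    by (simp add: field_simps)
  with d show ?thesis by (simp add: inner_diff_left)
qed

section \<open>Truncations on the manifold\<close>

context atlas
begin

lemma gradc_trunc:
  assumes c: "c \<in> charts_at A p" and V: "open V" "p \<in> V" and f: "C1m_on V f"
    and \<phi>: "\<And>y. (\<phi> has_real_derivative \<phi>' y) (at y)" "continuous_on UNIV \<phi>'"
  shows "gradc c (\<lambda>q. if q \<in> V then \<phi> (f q) else 0) p = \<phi>' (f p) *\<^sub>R gradc c f p"
proof -
  have cA: "c \<in> A" "p \<in> dom c" using c by (auto simp: charts_at_iff)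
  let ?U = "coords c ` (dom c \<inter> V)"
  have pU: "coords c p \<in> ?U" using cA V by auto
  have "gradc c (\<lambda>q. if q \<in> V then \<phi> (f q) else 0) p = grad (\<lambda>x. \<phi> ((f \<circ> point c) x)) (coords c p)"
    by (rule grad_cong[OF coords_image_open[OF cA(1) V(1)] pU]) (use cA in auto)
  also have "\<dots> = \<phi>' ((f \<circ> point c) (coords c p)) *\<^sub>R gradc c f p"
    by (rule C1_on_compose(2)[OF C1m_onD[OF f cA(1)] _ \<phi> pU]) simp
  finally show ?thesis using cA by simp
qed

lemma C1m_on_trunc:
  assumes V: "open V" and K: "closed K" "K \<subseteq> V" and f: "C1m_on V f"
    and \<phi>: "\<And>y. (\<phi> has_real_derivative \<phi>' y) (at y)" "continuous_on UNIV \<phi>'"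
    and z: "\<And>p. p \<in> V \<Longrightarrow> p \<notin> K \<Longrightarrow> \<phi> (f p) = 0"
  shows "C1m_on UNIV (\<lambda>q. if q \<in> V then \<phi> (f q) else 0)"
proof (rule C1m_on_zero_extension[OF V K])
  show "C1m_on V (\<lambda>q. if q \<in> V then \<phi> (f q) else 0)"
    by (rule C1m_on_cong[OF V _ C1m_on_compose[OF f subset_UNIV \<phi>]]) auto
qed (use z in auto)

section \<open>Torsion functions of a domain\<close>

context
  fixes \<Omega> :: "'m set"
  assumes dom: "smooth_precompact_domain A \<Omega>"
begin

lemma domain_facts: "open \<Omega>" "compact (closure \<Omega>)"
  using dom by (auto simp: smooth_precompact_domain_def)

text \<open>Zero boundary values exclude frontier points from the set where \<open>f\<close> is at
  least \<open>e\<close>. Truncations at height \<open>e\<close> thus have compact support inside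
  \<Omega>.\<close>

lemma superlevel_compact:
  assumes f: "continuous_on (closure \<Omega>) f" "\<And>p. p \<in> frontier \<Omega> \<Longrightarrow> f p = 0" and e: "0 < (e :: real)"
  shows "compact {p \<in> closure \<Omega>. e \<le> f p}" "{p \<in> closure \<Omega>. e \<le> f p} \<subseteq> \<Omega>"
proof -
  have "closed {p \<in> closure \<Omega>. e \<le> f p}"
    using f(1) by (intro continuous_on_closed_Collect_le) auto
  then have "compact (closure \<Omega> \<inter> {p \<in> closure \<Omega>. e \<le> f p})"
    using domain_facts(2) compact_Int_closed by blast
  moreover have "closure \<Omega> \<inter> {p \<in> closure \<Omega>. e \<le> f p} = {p \<in> closure \<Omega>. e \<le> f p}" by auto
  ultimately show "compact {p \<in> closure \<Omega>. e \<le> f p}" by simp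
  show "{p \<in> closure \<Omega>. e \<le> f p} \<subseteq> \<Omega>"
  proof
    fix p assume p: "p \<in> {p \<in> closure \<Omega>. e \<le> f p}"
    show "p \<in> \<Omega>"
    proof (rule ccontr)
      assume "p \<notin> \<Omega>"
      then have "p \<in> frontier \<Omega>" using p domain_facts(1) by (simp add: frontier_def interior_open)
      then show False using f(2) p e by auto
    qed
  qed
qed

lemma torsion_facts:
  assumes "torsion_function A g \<Omega> E"
  shows "C2_on A \<Omega> E" "continuous_on (closure \<Omega>) E" "\<And>p. p \<in> \<Omega> \<Longrightarrow> has_laplacian A g E p (- 1)"
    "\<And>p. p \<in> frontier \<Omega> \<Longrightarrow> E p = 0" "C1m_on \<Omega> E"
  using assms C2_on_C1m_on by (auto simp: torsion_function_def)

text \<open>Weak maximum principle. Tested with a truncation \<psi> of \<open>- E\<close>, the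
  equation says that \<psi> minus the pairing of d\<psi> with dE integrates to zero; both
  contributions are nonnegative, so \<psi> vanishes.\<close>

lemma torsion_nonneg:
  assumes g: "riemannian_metric A g" and E: "torsion_function A g \<Omega> E" and p: "p \<in> \<Omega>"
  shows "0 \<le> E p"
proof (rule field_le_epsilon)
  fix e :: real assume e: "0 < e"
  note T = torsion_facts[OF E]
  let ?\<mu> = "vol_measure A g"
  define f where "f q = - 1 * E q" for q
  define K where "K = {q \<in> closure \<Omega>. e \<le> f q}"
  have cf: "continuous_on (closure \<Omega>) f" unfolding f_def by (intro continuous_intros T)
  have K: "compact K" "K \<subseteq> \<Omega>"
    unfolding K_def by (rule superlevel_compact[OF cf _ e]; simp add: f_def T)+
  have f1: "C1m_on \<Omega> f" unfolding f_def by (intro C1m_on_mult C1m_on_const T)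
  define \<psi> where "\<psi> q = (if q \<in> \<Omega> then trunc e (f q) else 0)" for q
  have z: "trunc e (f q) = 0" if "q \<in> \<Omega>" "q \<notin> K" for q
    using that closure_subset[of \<Omega>] by (intro trunc_zero[OF e]) (auto simp: K_def)
  have \<psi>: "C1m_on UNIV \<psi>" unfolding \<psi>_def
    by (rule C1m_on_trunc[OF domain_facts(1) compact_imp_closed[OF K(1)] K(2) f1
          has_real_derivative_trunc[OF e] continuous_on_trunc'[OF e] z])
  have \<psi>0: "\<psi> q = 0" if "q \<notin> K" for q using z that by (simp add: \<psi>_def)
  have nn: "0 \<le> \<psi> q" for q using trunc_ge(2)[OF e] by (simp add: \<psi>_def)
  note W = weak_form[OF g domain_facts(1) T(1,3) K \<psi> \<psi>0]
  have le: "cometric g \<psi> E q \<le> 0" for q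
  proof (cases "q \<in> \<Omega>")
    case True
    define c where "c = chart_at A q"
    have c: "c \<in> charts_at A q" using chart_at by (simp add: c_def)
    have cA: "c \<in> A" "q \<in> dom c" using c by (auto simp: charts_at_iff)
    have gf: "gradc c f q = - gradc c E q"
    proof -
      have "((\<lambda>x. - (E \<circ> point c) x) has_derivative (\<lambda>h. - (gradc c E q \<bullet> h))) (at (coords c q))"
        by (rule has_derivative_minus[OF C1_onD(1)[OF C1m_onD[OF T(5) cA(1)]]]) (use cA True in auto)
      then show ?thesis by (intro grad_eq) (simp add: f_def o_def inner_minus_left)
    qed
    have "gradc c \<psi> q = trunc' e (f q) *\<^sub>R (- gradc c E q)"
      unfolding \<psi>_def gf[symmetric]
      by (rule gradc_trunc[OF c domain_facts(1) True f1 has_real_derivative_trunc[OF e] continuous_on_trunc'[OF e]])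
    then have "cometric g \<psi> E q = - (trunc' e (f q) * (gradc c E q \<bullet> (gram_inv A g c (coords c q) *v gradc c E q)))"
      by (simp add: cometric_def c_def[symmetric] Let_def)
    moreover have "0 \<le> gradc c E q \<bullet> (gram_inv A g c (coords c q) *v gradc c E q)"
      using pos_def_psd[OF pos_def_matrix_inv[OF gram_pos_def[OF g c]]] by (simp add: psd_def gram_inv_def)
    ultimately show ?thesis using trunc'_bounds(1)[OF e, of "f q"] by simp
  next
    case False
    then have "q \<in> - K" using K by auto
    then show ?thesis using cometric_zero[of "- K" q \<psi> g E] \<psi>0 K(1)
      by (auto simp: compact_imp_closed open_Compl)
  qed
  have I: "(\<integral>q. \<psi> q - cometric g \<psi> E q \<partial>?\<mu>) = 0" "integrable ?\<mu> (\<lambda>q. \<psi> q - cometric g \<psi> E q)"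
    using W Bochner_Integration.integral_minus[of ?\<mu> "\<lambda>q. cometric g \<psi> E q - \<psi> q"]
      Bochner_Integration.integrable_minus[of ?\<mu> "\<lambda>q. cometric g \<psi> E q - \<psi> q"] by simp_all
  have d: "0 \<le> \<psi> q - cometric g \<psi> E q" for q using nn[of q] le[of q] by linarith
  have "AE q in ?\<mu>. \<psi> q - cometric g \<psi> E q = 0"
    using integral_nonneg_eq_0_iff_AE[OF I(2) AE_I2[OF d]] I(1) by simp
  then have AE: "AE q in ?\<mu>. \<not> 0 < \<psi> q"
  proof (rule AE_mp, intro AE_I2 impI)
    fix q assume "\<psi> q - cometric g \<psi> E q = 0"
    then show "\<not> 0 < \<psi> q" using le[of q] by linarith
  qed
  \<comment> \<open>An open null set is empty, so \<psi> vanishes everywhere and not only almost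
    everywhere.\<close>
  have o: "open {q. 0 < \<psi> q}"
    using C1m_on_continuous[OF open_UNIV \<psi>] by (intro open_Collect_less continuous_on_const)
  then have "{q \<in> space ?\<mu>. \<not> \<not> 0 < \<psi> q} \<in> sets ?\<mu>"
    using space_vol_measure[OF g] sets_vol_measure[OF g] by simp
  then have "emeasure ?\<mu> {q. 0 < \<psi> q} = 0"
    using AE AE_iff_null[of ?\<mu> "\<lambda>q. \<not> 0 < \<psi> q"] space_vol_measure[OF g] by (simp add: null_sets_def)
  then have "{q. 0 < \<psi> q} = {}" using emeasure_vol_measure_open_pos[OF g o] by blast
  then have "\<not> 0 < \<psi> p" by blast
  then have "\<not> e < f p" using trunc_pos[OF e, of "f p"] p by (auto simp: \<psi>_def)
  then show "0 \<le> E p + e" by (simp add: f_def)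
qed

text \<open>The measure is a parameter because the torsion functions of two metrics will be
  integrated against the same measure.\<close>

lemma torsion_integrable:
  assumes g: "riemannian_metric A g" and E: "torsion_function A g \<Omega> E"
    and \<mu>: "sets \<mu> = sets borel" "emeasure \<mu> \<Omega> < \<infinity>"
  shows "set_integrable \<mu> \<Omega> E"
proof -
  note T = torsion_facts[OF E]
  have "compact (E ` closure \<Omega>)" by (rule compact_continuous_image[OF T(2) domain_facts(2)])
  then obtain B where B: "\<And>p. p \<in> closure \<Omega> \<Longrightarrow> norm (E p) \<le> B"
    using compact_imp_bounded bounded_iff by (metis (no_types, lifting) imageI)
  have "(\<lambda>p. indicator \<Omega> p * E p) \<in> borel_measurable borel"
    by (rule borel_measurable_indicator_mult_continuous[OF _ closure_subset T(2)])
      (use domain_facts(1) in auto)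
  then have m: "(\<lambda>p. indicator \<Omega> p *\<^sub>R E p) \<in> borel_measurable \<mu>"
    by (simp cong: measurable_cong_sets add: measurable_cong_sets[OF \<mu>(1) refl])
  have \<Omega>: "\<Omega> \<in> sets \<mu>" using domain_facts(1) \<mu>(1) by simp
  show ?thesis unfolding set_integrable_def
  proof (rule Bochner_Integration.integrable_bound[OF _ m])
    show "integrable \<mu> (\<lambda>p. indicator \<Omega> p *\<^sub>R B)"
      using \<mu>(2) \<Omega> by (intro integrable_scaleR_left integrable_real_indicator) auto
    show "AE p in \<mu>. norm (indicator \<Omega> p *\<^sub>R E p) \<le> norm (indicator \<Omega> p *\<^sub>R B)"
      using B closure_subset[of \<Omega>] by (auto simp: indicator_def intro!: AE_I2) (smt (verit) subset_eq)
  qed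
qed

text \<open>Both weak forms are brought to the measure of \<open>gs\<close> and subtracted. The
  bound on the metrics enters in reversed order through the inverse Gram matrices.\<close>

lemma torsion_comparison:
  assumes s: "riemannian_metric A gs" and t: "riemannian_metric A gt"
    and Es: "torsion_function A gs \<Omega> Es" and Et: "torsion_function A gt \<Omega> Et"
    and k: "0 < k" "vol_measure A gt = density (vol_measure A gs) (\<lambda>_. ennreal k)"
    and l: "0 < l" "\<And>p v. v \<in> tangent_space A p \<Longrightarrow> gs p v v \<le> l * gt p v v"
    and fin: "emeasure (vol_measure A gs) \<Omega> < \<infinity>"
  shows "(LINT p:\<Omega>|vol_measure A gs. Es p) \<le> l * (LINT p:\<Omega>|vol_measure A gs. Et p)"
proof -
  define \<mu> where "\<mu> = vol_measure A gs"
  note Ts = torsion_facts[OF Es] and Tt = torsion_facts[OF Et]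
  have sets\<mu>: "sets \<mu> = sets borel" using sets_vol_measure[OF s] by (simp add: \<mu>_def)
  define vol where "vol = measure \<mu> \<Omega>"
  have \<Omega>: "\<Omega> \<in> sets \<mu>" using domain_facts(1) sets\<mu> by simp
  have iS: "set_integrable \<mu> \<Omega> Es" by (rule torsion_integrable[OF s Es sets\<mu>]) (use fin in \<open>simp add: \<mu>_def\<close>)
  have it: "set_integrable \<mu> \<Omega> Et" by (rule torsion_integrable[OF t Et sets\<mu>]) (use fin in \<open>simp add: \<mu>_def\<close>)
  have i1: "integrable \<mu> (\<lambda>p. indicator \<Omega> p * w)" for w :: real
    using fin \<Omega> by (intro integrable_mult_left integrable_real_indicator) (auto simp: \<mu>_def)
  have key: "(LINT p:\<Omega>|\<mu>. Es p) - l * (LINT p:\<Omega>|\<mu>. Et p) \<le> e * ((2 + l) * vol)" if e: "0 < e" for e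
  proof -
    define K where "K = {q \<in> closure \<Omega>. e \<le> Es q}"
    have K: "compact K" "K \<subseteq> \<Omega>"
      unfolding K_def by (rule superlevel_compact[OF Ts(2) _ e]; simp add: Ts)+
    define \<phi> where "\<phi> q = (if q \<in> \<Omega> then trunc e (Es q) else 0)" for q
    have z: "trunc e (Es q) = 0" if "q \<in> \<Omega>" "q \<notin> K" for q
      using that closure_subset[of \<Omega>] by (intro trunc_zero[OF e]) (auto simp: K_def)
    have \<phi>: "C1m_on UNIV \<phi>" unfolding \<phi>_def
      by (rule C1m_on_trunc[OF domain_facts(1) compact_imp_closed[OF K(1)] K(2) Ts(5)
            has_real_derivative_trunc[OF e] continuous_on_trunc'[OF e] z])
    have \<phi>0: "\<phi> q = 0" if "q \<notin> K" for q using z that by (simp add: \<phi>_def)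
    have Etpos: "0 < Et q + e" if "q \<in> \<Omega>" for q
      using torsion_nonneg[OF t Et that] e by simp
    \<comment> \<open>Picone's test function for the equation of \<open>Et\<close>. The shift keeps
      the denominator positive where \<open>Et\<close> may vanish, and the factor \<open>l\<close>
      matches the constant in the comparison of the inverse metrics.\<close>
    define \<psi> where "\<psi> q = \<phi> q * \<phi> q * inverse (l * (Et q + e))" for q
    have \<psi>0: "\<psi> q = 0" if "q \<notin> K" for q using \<phi>0[OF that] by (simp add: \<psi>_def)
    have \<psi>: "C1m_on UNIV \<psi>"
    proof (rule C1m_on_zero_extension[OF domain_facts(1) compact_imp_closed[OF K(1)] K(2) _ \<psi>0])
      show "C1m_on \<Omega> \<psi>"
        unfolding \<psi>_def using Etpos l(1)
        by (intro C1m_on_mult C1m_on_inverse C1m_on_subset[OF \<phi>] C1m_on_add C1m_on_const Tt(5)) force+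
    qed
    define Ds where "Ds q = cometric gs \<phi> Es q - \<phi> q" for q
    define Dt where "Dt q = cometric gt \<psi> Et q - \<psi> q" for q
    have Ds: "integrable \<mu> Ds" "(\<integral>q. Ds q \<partial>\<mu>) = 0"
      using weak_form[OF s domain_facts(1) Ts(1,3) K \<phi> \<phi>0] by (simp_all add: Ds_def[abs_def] \<mu>_def)
    \<comment> \<open>The weak form for \<open>gt\<close> uses the measure of \<open>gt\<close>; as
      the integral is zero, the constant density \<open>k\<close> can be divided out.\<close>
    have Dt: "integrable \<mu> Dt" "(\<integral>q. Dt q \<partial>\<mu>) = 0"
    proof -
      have d: "integrable (density \<mu> (\<lambda>_. ennreal k)) Dt" "(\<integral>q. Dt q \<partial>density \<mu> (\<lambda>_. ennreal k)) = 0"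
        using weak_form[OF t domain_facts(1) Tt(1,3) K \<psi> \<psi>0] by (simp_all add: Dt_def[abs_def] \<mu>_def k(2))
      then have m: "Dt \<in> borel_measurable \<mu>"
        using borel_measurable_integrable by fastforce
      have "integrable \<mu> (\<lambda>q. k * Dt q)" "(\<integral>q. k * Dt q \<partial>\<mu>) = 0"
        using d m k(1) integrable_density[of Dt \<mu> "\<lambda>_. k"] integral_density[of Dt \<mu> "\<lambda>_. k"] by simp_all
      then show "integrable \<mu> Dt" "(\<integral>q. Dt q \<partial>\<mu>) = 0" using k(1) by simp_all
    qed
    \<comment> \<open>The estimate is made pointwise because integrability is at hand for the
      differences \<open>Ds\<close> and \<open>Dt\<close>, not for the gradient terms by
      themselves.\<close>
    have pt: "indicator \<Omega> q * Es q - l * (indicator \<Omega> q * Et q) - indicator \<Omega> q * (e * (2 + l)) \<le> Ds q - Dt q" for q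
    proof (cases "q \<in> \<Omega>")
      case True
      define c where "c = chart_at A q"
      have c: "c \<in> charts_at A q" using chart_at by (simp add: c_def)
      have cA: "c \<in> A" "q \<in> dom c" using c by (auto simp: charts_at_iff)
      define Ms where "Ms = gram_inv A gs c (coords c q)"
      define Mt where "Mt = gram_inv A gt c (coords c q)"
      define \<xi> where "\<xi> = gradc c Es q"
      define \<zeta> where "\<zeta> = gradc c Et q"
      define r where "r = trunc' e (Es q)"
      define u where "u = Et q + e"
      have u: "0 < u" using Etpos[OF True] by (simp add: u_def)
      have r: "0 \<le> r" "r \<le> 1" unfolding r_def by (rule trunc'_bounds[OF e])+
      have Ms: "pos_def Ms" and Mt: "pos_def Mt"
        unfolding Ms_def Mt_def gram_inv_def by (intro pos_def_matrix_inv gram_pos_def s t c)+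
      have MtMs: "\<xi> \<bullet> (Mt *v \<xi>) \<le> l * (\<xi> \<bullet> (Ms *v \<xi>))"
        unfolding Ms_def Mt_def gram_inv_def
      proof (rule matrix_inv_antimono[OF gram_pos_def[OF s c] gram_pos_def[OF t c]])
        show "x \<bullet> (gram A gs c (coords c q) *v x) \<le> l * (x \<bullet> (gram A gt c (coords c q) *v x))" for x
          using l(2)[OF tvec_tangent[OF c], of x] by (simp add: metric_gram[OF s c] metric_gram[OF t c])
      qed
      have g\<phi>: "gradc c \<phi> q = r *\<^sub>R \<xi>"
        unfolding \<phi>_def r_def \<xi>_def
        by (rule gradc_trunc[OF c domain_facts(1) True Ts(5) has_real_derivative_trunc[OF e] continuous_on_trunc'[OF e]])
      have g\<psi>: "gradc c \<psi> q = (2 * \<phi> q / (l * u)) *\<^sub>R (r *\<^sub>R \<xi>) - (\<phi> q * \<phi> q / (l * u\<^sup>2)) *\<^sub>R \<zeta>"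
      proof -
        have p: "point c (coords c q) = q" using cA by simp
        have 1: "(\<phi> \<circ> point c has_derivative (\<lambda>h. (r *\<^sub>R \<xi>) \<bullet> h)) (at (coords c q))"
          unfolding g\<phi>[symmetric] by (rule C1_onD(1)[OF C1m_onD[OF \<phi> cA(1)]]) (use cA in auto)
        have 2: "(Et \<circ> point c has_derivative (\<lambda>h. \<zeta> \<bullet> h)) (at (coords c q))"
          unfolding \<zeta>_def by (rule C1_onD(1)[OF C1m_onD[OF Tt(5) cA(1)]]) (use cA True in auto)
        have "(\<psi> \<circ> point c has_derivative (\<lambda>h. ((2 * \<phi> q / (l * u)) *\<^sub>R (r *\<^sub>R \<xi>) - (\<phi> q * \<phi> q / (l * u\<^sup>2)) *\<^sub>R \<zeta>) \<bullet> h)) (at (coords c q))"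
          using has_grad_square_over[OF 1 2, of e l] u l(1) p by (simp add: \<psi>_def[abs_def] u_def o_def)
        then show ?thesis by (rule grad_eq)
      qed
      have cs: "cometric gs \<phi> Es q = r * (\<xi> \<bullet> (Ms *v \<xi>))"
        using g\<phi> by (simp add: cometric_def c_def[symmetric] Let_def Ms_def \<xi>_def)
      define a where "a = r *\<^sub>R \<xi>"
      have ct: "cometric gt \<psi> Et q = 2 * \<phi> q / (l * u) * (a \<bullet> (Mt *v \<zeta>)) - \<phi> q * \<phi> q / (l * u\<^sup>2) * (\<zeta> \<bullet> (Mt *v \<zeta>))"
        unfolding cometric_def c_def[symmetric] Let_def g\<psi>
        by (simp add: Mt_def \<zeta>_def a_def inner_diff_left)
      \<comment> \<open>Picone's identity: expanding this square gives the squared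
        \<open>gt\<close>-length of d\<phi> minus \<open>l\<close> times the pairing of d\<psi> with
        dEt.\<close>
      have "0 \<le> (a - (\<phi> q / u) *\<^sub>R \<zeta>) \<bullet> (Mt *v (a - (\<phi> q / u) *\<^sub>R \<zeta>))"
        using pos_def_psd[OF Mt] unfolding psd_def by blast
      also have "\<dots> = a \<bullet> (Mt *v a) - 2 * (\<phi> q / u) * (a \<bullet> (Mt *v \<zeta>)) + (\<phi> q / u)\<^sup>2 * (\<zeta> \<bullet> (Mt *v \<zeta>))"
        using sym_mat_inner[of Mt \<zeta> a] Mt
        by (simp add: pos_def_def matrix_vector_mult_diff_distrib matrix_vector_mult_scaleR inner_simps
            power2_eq_square algebra_simps)
      also have "\<dots> = a \<bullet> (Mt *v a) - l * cometric gt \<psi> Et q"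
        unfolding ct using l(1) u by (simp add: field_simps power2_eq_square)
      finally have "l * cometric gt \<psi> Et q \<le> r\<^sup>2 * (\<xi> \<bullet> (Mt *v \<xi>))"
        by (simp add: a_def matrix_vector_mult_scaleR power2_eq_square)
      also have "\<dots> \<le> r\<^sup>2 * (l * (\<xi> \<bullet> (Ms *v \<xi>)))"
        using MtMs by (intro mult_left_mono) auto
      \<comment> \<open>The slope bound \<open>r \<le> 1\<close> turns the squared length of d\<phi>
        into the pairing of d\<phi> with dEs.\<close>
      also have "\<dots> \<le> r * (l * (\<xi> \<bullet> (Ms *v \<xi>)))"
        using r l(1) pos_def_psd[OF Ms] unfolding psd_def power2_eq_square
        by (intro mult_right_mono mult_nonneg_nonneg) (auto simp: mult_left_le)
      finally have "cometric gt \<psi> Et q \<le> cometric gs \<phi> Es q"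
        using l(1) unfolding cs by (simp add: mult.left_commute)
      moreover have "2 * \<phi> q - l * u \<le> \<psi> q"
      proof -
        \<comment> \<open>Expanding the square of \<open>\<phi> q - l * u\<close> replaces the
          quotient in \<psi> by a lower bound that is linear in \<phi> and \<open>u\<close>.\<close>
        have "(2 * \<phi> q - l * u) * (l * u) \<le> \<phi> q * \<phi> q"
          using zero_le_power2[of "\<phi> q - l * u"] by (simp add: power2_eq_square algebra_simps)
        then have "2 * \<phi> q - l * u \<le> \<phi> q * \<phi> q / (l * u)"
          using l(1) u by (subst pos_le_divide_eq) auto
        then show ?thesis by (simp add: \<psi>_def u_def divide_inverse)
      qed
      moreover have "Es q - 2 * e \<le> \<phi> q" using trunc_ge(1)[OF e] True by (simp add: \<phi>_def)
      ultimately have "Es q - 2 * e - l * u \<le> Ds q - Dt q" by (simp add: Ds_def Dt_def)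
      then show ?thesis using True by (simp add: u_def algebra_simps)
    next
      case False
      then have "q \<in> - K" using K by auto
      moreover have "open (- K)" using K(1) by (simp add: compact_imp_closed open_Compl)
      ultimately have "Ds q = 0" "Dt q = 0"
        using cometric_zero[of "- K" q \<phi>] cometric_zero[of "- K" q \<psi>] \<phi>0 \<psi>0 by (auto simp: Ds_def Dt_def)
      then show ?thesis using False by simp
    qed
    have is': "integrable \<mu> (\<lambda>q. indicator \<Omega> q * Es q)" and it': "integrable \<mu> (\<lambda>q. indicator \<Omega> q * Et q)"
      using iS it by (simp_all add: set_integrable_def)
    have "(\<integral>q. indicator \<Omega> q * Es q - l * (indicator \<Omega> q * Et q) - indicator \<Omega> q * (e * (2 + l)) \<partial>\<mu>)
        \<le> (\<integral>q. Ds q - Dt q \<partial>\<mu>)"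
      by (intro integral_mono Bochner_Integration.integrable_diff integrable_mult_right is' it' i1 Ds Dt pt)
    also have "\<dots> = 0" using Ds Dt by simp
    also have "(\<integral>q. indicator \<Omega> q * Es q - l * (indicator \<Omega> q * Et q) - indicator \<Omega> q * (e * (2 + l)) \<partial>\<mu>) =
        (LINT p:\<Omega>|\<mu>. Es p) - l * (LINT p:\<Omega>|\<mu>. Et p) - vol * (e * (2 + l))"
      using is' it' i1 \<Omega> by (simp add: set_lebesgue_integral_def vol_def)
    finally show ?thesis by (simp add: algebra_simps)
  qed
  have "0 \<le> (2 + l) * vol" using l(1) by (simp add: vol_def)
  have "(LINT p:\<Omega>|\<mu>. Es p) - l * (LINT p:\<Omega>|\<mu>. Et p) \<le> 0"
  proof (rule field_le_epsilon)
    fix d :: real assume d: "0 < d"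
    \<comment> \<open>The added 1 keeps the denominator positive even for zero volume.\<close>
    have "(LINT p:\<Omega>|\<mu>. Es p) - l * (LINT p:\<Omega>|\<mu>. Et p) \<le> d / ((2 + l) * vol + 1) * ((2 + l) * vol)"
      using d \<open>0 \<le> (2 + l) * vol\<close> by (intro key divide_pos_pos) auto
    also have "\<dots> \<le> d" using d \<open>0 \<le> (2 + l) * vol\<close> by (simp add: field_simps)
    finally show "(LINT p:\<Omega>|\<mu>. Es p) - l * (LINT p:\<Omega>|\<mu>. Et p) \<le> 0 + d" by simp
  qed
  then show ?thesis by (simp add: \<mu>_def)
qed

end

end


section \<open>Ricci flow\<close>

text \<open>Derivatives are taken within \<open>S\<close> to admit the one-sided time derivative of
  the flow at 0.\<close>

lemma mono_of_derivative_within: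
  fixes f :: "real \<Rightarrow> real"
  assumes "\<And>x. x \<in> {a..b} \<Longrightarrow> (f has_real_derivative f' x) (at x within S)"
    and "{a..b} \<subseteq> S" "\<And>x. x \<in> {a..b} \<Longrightarrow> 0 \<le> f' x" "a \<le> b"
  shows "f a \<le> f b"
proof (cases "a = b")
  case False
  then have ab: "a < b" using assms by simp
  have "\<exists>x\<in>{a<..<b}. f b - f a = f' x * (b - a)"
  proof (rule mvt_simple[OF ab])
    fix x assume "a \<le> x" "x \<le> b"
    then show "(f has_derivative (*) (f' x)) (at x within {a..b})"
      using assms(1)[of x] assms(2) has_derivative_subset by (auto simp: has_field_derivative_def)
  qed
  then obtain x where x: "x \<in> {a<..<b}" "f b - f a = f' x * (b - a)" by blast
  have "0 \<le> f' x * (b - a)" using x(1) assms(3) ab by (intro mult_nonneg_nonneg) auto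
  with x show ?thesis by simp
qed simp

context atlas
begin

context
  fixes Tmax :: ereal and T0 :: real and g :: "real \<Rightarrow> ('m, 'n) metric" and b :: "real \<Rightarrow> real"
  assumes flow: "ricci_flow A Tmax g"
    and scal: "\<And>t p. t \<in> time_interval Tmax \<Longrightarrow> scalar_curvature A (g t) p = b t"
begin

abbreviation "J \<equiv> time_interval Tmax"

section \<open>Metric and volume along the flow\<close>

lemma flow_metric: "t \<in> J \<Longrightarrow> riemannian_metric A (g t)"
  using flow by (simp add: ricci_flow_def)

lemma flow_derivative:
  "t \<in> J \<Longrightarrow> u \<in> tangent_space A p \<Longrightarrow> v \<in> tangent_space A p \<Longrightarrow>
    ((\<lambda>s. g s p u v) has_real_derivative - 2 * ricci A (g t) p u v) (at t within J)"
  using flow by (simp add: ricci_flow_def)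

lemma interval_subset: "t' \<in> J \<Longrightarrow> 0 \<le> t \<Longrightarrow> {t..t'} \<subseteq> J"
  by (auto simp: time_interval_def) (meson ereal_less_eq(3) order_le_less_trans)

definition ricci_matrix :: "real \<Rightarrow> 'm \<Rightarrow> real^'n^'n" where
  "ricci_matrix t p = (\<chi> i j. ricci_coeff A (g t) (chart_at A p) i j (coords (chart_at A p) p))"

text \<open>Uses the chart in which \<open>ricci\<close> and \<open>scalar_curvature\<close> are
  computed, so curvature never has to be carried to another chart.\<close>

definition gram_at :: "real \<Rightarrow> 'm \<Rightarrow> real^'n^'n" where
  "gram_at t p = gram A (g t) (chart_at A p) (coords (chart_at A p) p)"

lemma ricci_tvec:
  "ricci A (g t) p (tvec (chart_at A p) p u) (tvec (chart_at A p) p v) = u \<bullet> (ricci_matrix t p *v v)"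
  by (simp add: ricci_def Let_def tvec_self[OF chart_at] inner_matrix_vector_sum ricci_matrix_def)

lemma gram_at_tvec:
  "t \<in> J \<Longrightarrow> g t p (tvec (chart_at A p) p u) (tvec (chart_at A p) p v) = u \<bullet> (gram_at t p *v v)"
  unfolding gram_at_def by (rule metric_gram[OF flow_metric chart_at])

lemma gram_at_pos_def: "t \<in> J \<Longrightarrow> pos_def (gram_at t p)"
  unfolding gram_at_def by (rule gram_pos_def[OF flow_metric chart_at])

lemma scal_matrix:
  assumes "t \<in> J"
  shows "(\<Sum>i\<in>UNIV. \<Sum>j\<in>UNIV. matrix_inv (gram_at t p) $ i $ j * ricci_matrix t p $ i $ j) = b t"
  using scal[OF assms, of p]
  by (simp add: scalar_curvature_def Let_def gram_at_def ricci_matrix_def gram_inv_def)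

lemma gram_at_derivative:
  assumes t: "t \<in> J"
  shows "((\<lambda>s. gram_at s p $ i $ j) has_real_derivative - 2 * ricci_matrix t p $ i $ j) (at t within J)"
proof -
  define c where "c = chart_at A p"
  have c: "c \<in> charts_at A p" using chart_at by (simp add: c_def)
  have "((\<lambda>s. g s p (tvec c p (axis i 1)) (tvec c p (axis j 1))) has_real_derivative
      - 2 * ricci A (g t) p (tvec c p (axis i 1)) (tvec c p (axis j 1))) (at t within J)"
    by (intro flow_derivative t tvec_tangent c)
  moreover have "ricci A (g t) p (tvec c p (axis i 1)) (tvec c p (axis j 1)) = ricci_matrix t p $ i $ j"
    unfolding c_def ricci_tvec by (simp add: inner_axis' matrix_vector_axis)
  moreover have "g s p (tvec c p (axis i 1)) (tvec c p (axis j 1)) = gram_at s p $ i $ j" for s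
    using c by (simp add: gram_at_def gram_def coord_field_tvec c_def[symmetric] charts_at_iff)
  ultimately show ?thesis by simp
qed

text \<open>Jacobi's formula: the trace of the inverse metric against \<open>-2 Ric\<close> is -2
  times the scalar curvature, which is \<open>b t\<close> at every point.\<close>

lemma det_gram_derivative:
  assumes t: "t \<in> J"
  shows "((\<lambda>s. det (gram_at s p)) has_real_derivative - 2 * b t * det (gram_at t p)) (at t within J)"
proof -
  have inv: "invertible (gram_at t p)" using gram_at_pos_def[OF t] pos_def_invertible by blast
  have D: "((\<lambda>s. gram_at s p $ i $ j) has_real_derivative ((- 2) *\<^sub>R ricci_matrix t p) $ i $ j) (at t within J)" for i j
    using gram_at_derivative[OF t, of p i j] by simp
  have "(\<Sum>i\<in>UNIV. \<Sum>j\<in>UNIV. matrix_inv (gram_at t p) $ j $ i * ((- 2) *\<^sub>R ricci_matrix t p) $ i $ j) = - 2 * b t"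
  proof -
    have "sym_mat (matrix_inv (gram_at t p))"
      using gram_at_pos_def[OF t] inv by (intro sym_mat_matrix_inv) (auto simp: pos_def_def)
    then have e: "matrix_inv (gram_at t p) $ j $ i * ((- 2) *\<^sub>R ricci_matrix t p) $ i $ j =
        - 2 * (matrix_inv (gram_at t p) $ i $ j * ricci_matrix t p $ i $ j)" for i j
      using sym_mat_nth[of "matrix_inv (gram_at t p)" i j] by simp
    show ?thesis unfolding e sum_distrib_left[symmetric] scal_matrix[OF t] ..
  qed
  with has_real_derivative_det[OF D inv] show ?thesis by (simp add: mult.commute)
qed

text \<open>The function \<theta> of the overview. Here \<open>undefined\<close> is an arbitrary
  base point; by \<open>det_gram_ratio\<close> the ratios of values at two times are the same for
  all points.\<close>

definition vol_factor :: "real \<Rightarrow> real" where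
  "vol_factor t = sqrt (det (gram_at t undefined))"

lemma vol_factor_pos: "t \<in> J \<Longrightarrow> 0 < vol_factor t"
  using gram_at_pos_def by (simp add: vol_factor_def pos_def_det_pos)

lemma vol_factor_derivative:
  assumes t: "t \<in> J"
  shows "(vol_factor has_real_derivative - b t * vol_factor t) (at t within J)"
proof -
  let ?D = "\<lambda>s. det (gram_at s undefined)"
  have D: "0 < ?D t" using gram_at_pos_def[OF t] by (simp add: pos_def_det_pos)
  have "((\<lambda>s. sqrt (?D s)) has_real_derivative inverse (sqrt (?D t)) / 2 * (- 2 * b t * ?D t)) (at t within J)"
    by (rule DERIV_chain2[OF DERIV_real_sqrt[OF D] det_gram_derivative[OF t]])
  moreover have "inverse (sqrt (?D t)) / 2 * (- 2 * b t * ?D t) = - b t * sqrt (?D t)"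
  proof -
    have "?D t = sqrt (?D t) * sqrt (?D t)" "sqrt (?D t) \<noteq> 0" using D by auto
    then show ?thesis by (simp add: field_simps)
  qed
  ultimately show ?thesis unfolding vol_factor_def[abs_def] by (simp only:)
qed

text \<open>All the functions \<open>t \<mapsto> det (gram_at t p)\<close> solve the same linear differential equation.\<close>

lemma det_gram_ratio:
  assumes s: "s \<in> J" and t: "t \<in> J"
  shows "det (gram_at t p) * det (gram_at s q) = det (gram_at s p) * det (gram_at t q)"
proof -
  have pos: "0 < det (gram_at r p)" if "r \<in> J" for r p
    using gram_at_pos_def[OF that] by (simp add: pos_def_det_pos)
  have conv: "convex J"
    unfolding time_interval_def
    by (rule is_interval_convex) (auto simp: is_interval_1 intro: order_le_less_trans[of _ "ereal _"])
  \<comment> \<open>Both determinants have logarithmic derivative \<open>- 2 * b r\<close>, which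
    cancels in the quotient.\<close>
  have D: "((\<lambda>r. det (gram_at r p) / det (gram_at r q)) has_real_derivative 0) (at r within J)"
    if r: "r \<in> J" for r
  proof -
    have "det (gram_at r q) \<noteq> 0" using pos[OF r, of q] by simp
    from DERIV_divide[OF det_gram_derivative[OF r, of p] det_gram_derivative[OF r, of q] this]
    show ?thesis by (simp add: mult.commute mult.left_commute)
  qed
  obtain C where "\<And>r. r \<in> J \<Longrightarrow> det (gram_at r p) / det (gram_at r q) = C"
    using has_field_derivative_zero_constant[OF conv D] by blast
  then have "det (gram_at t p) / det (gram_at t q) = det (gram_at s p) / det (gram_at s q)"
    using s t by simp
  then show ?thesis using pos[OF s, of q] pos[OF t, of q] by (simp add: field_simps)
qed

text \<open>Passing from \<open>chart_at A p\<close> to \<open>c\<close> costs a Jacobian factor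
  that does not depend on time and drops out of the ratio.\<close>

lemma vol_density_flow:
  assumes s: "s \<in> J" and t: "t \<in> J" and c: "c \<in> A" and x: "x \<in> coords c ` dom c"
  shows "vol_density A (g t) c x = vol_factor t / vol_factor s * vol_density A (g s) c x"
proof -
  obtain p where p: "p \<in> dom c" "x = coords c p" using x by auto
  have cp: "c \<in> charts_at A p" using c p by (simp add: charts_at_iff)
  define k where "k = \<bar>det (matrix (jac c (chart_at A p) p))\<bar>"
  have v: "vol_density A (g r) c x = k * sqrt (det (gram_at r p))" if "r \<in> J" for r
    using det_gram_jac[OF flow_metric[OF that] cp chart_at]
    by (simp add: vol_density_def p(2) gram_at_def k_def real_sqrt_mult)
  have "sqrt (det (gram_at t p)) * vol_factor s = sqrt (det (gram_at s p)) * vol_factor t"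
    unfolding vol_factor_def real_sqrt_mult[symmetric] det_gram_ratio[OF s t, of p undefined] ..
  then show ?thesis using vol_factor_pos[OF s] by (simp add: v[OF s] v[OF t] field_simps)
qed

lemma vol_measure_flow:
  assumes s: "s \<in> J" and t: "t \<in> J"
  shows "vol_measure A (g t) = density (vol_measure A (g s)) (\<lambda>_. ennreal (vol_factor t / vol_factor s))"
  using vol_factor_pos[OF s] vol_factor_pos[OF t]
  by (intro vol_measure_scale[OF flow_metric[OF s] flow_metric[OF t]] vol_density_flow[OF s t]) auto

section \<open>Signed Ricci curvature and monotone metrics\<close>

lemma ricci_psd:
  assumes "\<And>v. v \<in> tangent_space A p \<Longrightarrow> 0 \<le> ricci A (g t) p v v"
  shows "psd (ricci_matrix t p)"
  unfolding psd_def ricci_tvec[symmetric] using assms tvec_tangent[OF chart_at] by blast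

lemma ricci_psd_minus:
  assumes "\<And>v. v \<in> tangent_space A p \<Longrightarrow> ricci A (g t) p v v \<le> 0"
  shows "psd (- ricci_matrix t p)"
  unfolding psd_def
proof
  fix w
  have "w \<bullet> (- ricci_matrix t p *v w) = - ricci A (g t) p (tvec (chart_at A p) p w) (tvec (chart_at A p) p w)"
    unfolding ricci_tvec by (simp add: matrix_vector_mult_def inner_vec_def sum_negf)
  then show "0 \<le> w \<bullet> (- ricci_matrix t p *v w)"
    using assms[OF tvec_tangent[OF chart_at]] by simp
qed

text \<open>Since the eigenvalues of the Ricci tensor have one sign, each of them is bounded by
  their sum, the scalar curvature.\<close>

lemma ricci_le_scal:
  assumes t: "t \<in> J" and v: "v \<in> tangent_space A p"
    and ric: "\<And>v. v \<in> tangent_space A p \<Longrightarrow> 0 \<le> ricci A (g t) p v v"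
  shows "ricci A (g t) p v v \<le> b t * g t p v v"
proof -
  have "v = tvec (chart_at A p) p (v (chart_at A p))" by (rule tangent_eq_tvec[OF chart_at v])
  then obtain w where w: "v = tvec (chart_at A p) p w" by blast
  show ?thesis
    unfolding w ricci_tvec gram_at_tvec[OF t]
    using psd_le_trace[OF gram_at_pos_def[OF t, of p] ricci_psd[OF ric], of w] scal_matrix[OF t, of p] by simp
qed

lemma scal_le_ricci:
  assumes t: "t \<in> J" and v: "v \<in> tangent_space A p"
    and ric: "\<And>v. v \<in> tangent_space A p \<Longrightarrow> ricci A (g t) p v v \<le> 0"
  shows "b t * g t p v v \<le> ricci A (g t) p v v"
proof -
  have "v = tvec (chart_at A p) p (v (chart_at A p))" by (rule tangent_eq_tvec[OF chart_at v])
  then obtain w where w: "v = tvec (chart_at A p) p w" by blast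
  \<comment> \<open>The trace bound is applied to minus the Ricci matrix, which reverses the
    resulting inequality.\<close>
  have "w \<bullet> (- ricci_matrix t p *v w) = - (w \<bullet> (ricci_matrix t p *v w))"
    by (simp add: matrix_vector_mult_def inner_vec_def sum_negf)
  then show ?thesis
    unfolding w ricci_tvec gram_at_tvec[OF t]
    using psd_le_trace[OF gram_at_pos_def[OF t, of p] ricci_psd_minus[OF ric], of w] scal_matrix[OF t, of p]
    by (simp add: sum_negf)
qed

text \<open>As \<open>\<theta>' = - b \<theta>\<close>, the factor
  \<open>1 / \<theta>\<^sup>2\<close> grows at relative rate 2b, which adds the term
  \<open>b g\<close> to \<open>- Ric\<close>.\<close>

lemma rescaled_metric_derivative:
  assumes t: "t \<in> J" and v: "v \<in> tangent_space A p"
  shows "((\<lambda>s. g s p v v / (vol_factor s)\<^sup>2) has_real_derivative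
     2 * (b t * g t p v v - ricci A (g t) p v v) / (vol_factor t)\<^sup>2) (at t within J)"
proof -
  have 0: "vol_factor t \<noteq> 0" using vol_factor_pos[OF t] by simp
  have "((\<lambda>s. (vol_factor s)\<^sup>2) has_real_derivative 2 * vol_factor t * (- b t * vol_factor t)) (at t within J)"
    using DERIV_power[OF vol_factor_derivative[OF t], of 2] by (simp add: mult_ac)
  from DERIV_divide[OF flow_derivative[OF t v v] this]
  have "((\<lambda>s. g s p v v / (vol_factor s)\<^sup>2) has_real_derivative
      (- 2 * ricci A (g t) p v v * (vol_factor t)\<^sup>2 - g t p v v * (2 * vol_factor t * (- b t * vol_factor t))) /
      ((vol_factor t)\<^sup>2 * (vol_factor t)\<^sup>2)) (at t within J)" using 0 by simp
  moreover have "(- 2 * R * y\<^sup>2 - G * (2 * y * (- B * y))) / (y\<^sup>2 * y\<^sup>2) = 2 * (B * G - R) / y\<^sup>2"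
    if "y \<noteq> 0" for R G B y :: real
    using that by (simp add: field_simps power2_eq_square)
  ultimately show ?thesis using 0 by simp
qed

text \<open>Up to positive factors the derivatives are \<open>- Ric\<close> and
  \<open>b g - Ric\<close>; when Ric has a sign these have opposite signs.\<close>

lemma metric_monotone:
  assumes v: "v \<in> tangent_space A p" and t: "0 \<le> t" "t \<le> t'" "t' \<in> J"
  shows "(\<And>s v. s \<in> {t..t'} \<Longrightarrow> v \<in> tangent_space A p \<Longrightarrow> ricci A (g s) p v v \<le> 0) \<Longrightarrow>
      g t p v v \<le> g t' p v v \<and> g t' p v v / (vol_factor t')\<^sup>2 \<le> g t p v v / (vol_factor t)\<^sup>2"
    and "(\<And>s v. s \<in> {t..t'} \<Longrightarrow> v \<in> tangent_space A p \<Longrightarrow> 0 \<le> ricci A (g s) p v v) \<Longrightarrow>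
      g t' p v v \<le> g t p v v \<and> g t p v v / (vol_factor t)\<^sup>2 \<le> g t' p v v / (vol_factor t')\<^sup>2"
proof -
  have sub: "{t..t'} \<subseteq> J" by (rule interval_subset[OF t(3,1)])
  note D = flow_derivative[OF subsetD[OF sub] v v]
  note R = rescaled_metric_derivative[OF subsetD[OF sub] v]
  show "g t p v v \<le> g t' p v v \<and> g t' p v v / (vol_factor t')\<^sup>2 \<le> g t p v v / (vol_factor t)\<^sup>2"
    if ric: "\<And>s v. s \<in> {t..t'} \<Longrightarrow> v \<in> tangent_space A p \<Longrightarrow> ricci A (g s) p v v \<le> 0"
  proof
    show "g t p v v \<le> g t' p v v"
      by (rule mono_of_derivative_within[OF D sub _ t(2)]) (use ric[OF _ v] in auto)
    have "- (g t p v v / (vol_factor t)\<^sup>2) \<le> - (g t' p v v / (vol_factor t')\<^sup>2)"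
    proof (rule mono_of_derivative_within[OF DERIV_minus[OF R] sub _ t(2)])
      fix s assume s: "s \<in> {t..t'}"
      have "b s * g s p v v \<le> ricci A (g s) p v v"
        using scal_le_ricci[OF subsetD[OF sub s] v] ric s by blast
      then have "2 * (b s * g s p v v - ricci A (g s) p v v) / (vol_factor s)\<^sup>2 \<le> 0"
        by (intro divide_nonpos_nonneg) auto
      then show "0 \<le> - (2 * (b s * g s p v v - ricci A (g s) p v v) / (vol_factor s)\<^sup>2)" by simp
    qed auto
    then show "g t' p v v / (vol_factor t')\<^sup>2 \<le> g t p v v / (vol_factor t)\<^sup>2" by simp
  qed
  show "g t' p v v \<le> g t p v v \<and> g t p v v / (vol_factor t)\<^sup>2 \<le> g t' p v v / (vol_factor t')\<^sup>2"
    if ric: "\<And>s v. s \<in> {t..t'} \<Longrightarrow> v \<in> tangent_space A p \<Longrightarrow> 0 \<le> ricci A (g s) p v v"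
  proof
    have "- g t p v v \<le> - g t' p v v"
      by (rule mono_of_derivative_within[OF DERIV_minus[OF D] sub _ t(2)]) (use ric[OF _ v] in auto)
    then show "g t' p v v \<le> g t p v v" by simp
    show "g t p v v / (vol_factor t)\<^sup>2 \<le> g t' p v v / (vol_factor t')\<^sup>2"
    proof (rule mono_of_derivative_within[OF R sub _ t(2)])
      fix s assume s: "s \<in> {t..t'}"
      have "ricci A (g s) p v v \<le> b s * g s p v v"
        using ricci_le_scal[OF subsetD[OF sub s] v] ric s by blast
      then show "0 \<le> 2 * (b s * g s p v v - ricci A (g s) p v v) / (vol_factor s)\<^sup>2"
        by (intro divide_nonneg_nonneg) auto
    qed auto
  qed
qed

section \<open>Comparison of rigidity quotients\<close>

context
  fixes \<Omega> :: "'m set" and E :: "real \<Rightarrow> 'm \<Rightarrow> real"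
  assumes dom: "smooth_precompact_domain A \<Omega>"
begin

abbreviation "Trs t \<equiv> torsional_rigidity A (g t) \<Omega> (E t)"
abbreviation "Vol t \<equiv> volume A (g t) \<Omega>"

lemma volume_flow:
  assumes s: "s \<in> J" and t: "t \<in> J"
  shows "Vol t = vol_factor t / vol_factor s * Vol s"
proof -
  have "0 \<le> vol_factor t / vol_factor s" using vol_factor_pos[OF s] vol_factor_pos[OF t] by simp
  moreover have "\<Omega> \<in> sets (vol_measure A (g s))"
    using domain_facts(1)[OF dom] sets_vol_measure[OF flow_metric[OF s]] by simp
  ultimately show ?thesis
    unfolding volume_def vol_measure_flow[OF s t] measure_def
    by (simp add: emeasure_density_const enn2real_mult)
qed

text \<open>Going from the measure of \<open>g s\<close> to that of \<open>g t\<close> multiplies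
  rigidity and volume by the same constant. In the quotient it cancels, so both sides can be
  integrated against one measure.\<close>

lemma rigidity_comparison:
  assumes s: "s \<in> J" "torsion_function A (g s) \<Omega> (E s)" and t: "t \<in> J" "torsion_function A (g t) \<Omega> (E t)"
    and l: "0 < l" "\<And>p v. v \<in> tangent_space A p \<Longrightarrow> g s p v v \<le> l * g t p v v"
  shows "Trs s / Vol s \<le> l * (Trs t / Vol t)"
proof (cases "Vol s = 0")
  \<comment> \<open>This covers infinite measure as well, where \<open>measure\<close> is 0: then
    both volumes are 0 and so are both quotients. In the other case the measure of \<Omega> is
    finite.\<close>
  case True
  then show ?thesis using volume_flow[OF s(1) t(1)] by simp
next
  case False
  define k where "k = vol_factor t / vol_factor s"
  define \<mu> where "\<mu> = vol_measure A (g s)"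
  have k: "0 < k" using vol_factor_pos[OF s(1)] vol_factor_pos[OF t(1)] by (simp add: k_def)
  have sets\<mu>: "sets \<mu> = sets borel" using sets_vol_measure[OF flow_metric[OF s(1)]] by (simp add: \<mu>_def)
  have fin: "emeasure \<mu> \<Omega> < \<infinity>"
    using False by (auto simp: volume_def measure_def \<mu>_def less_top[symmetric])
  have \<mu>t: "vol_measure A (g t) = density \<mu> (\<lambda>_. ennreal k)"
    unfolding \<mu>_def k_def by (rule vol_measure_flow[OF s(1) t(1)])
  have le: "Trs s \<le> l * (LINT p:\<Omega>|\<mu>. E t p)"
    unfolding torsional_rigidity_def \<mu>_def
    by (rule torsion_comparison[OF dom flow_metric[OF s(1)] flow_metric[OF t(1)] s(2) t(2) k])
      (use \<mu>t l fin in \<open>auto simp: \<mu>_def\<close>)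
  have "Trs t = k * (LINT p:\<Omega>|\<mu>. E t p)"
  proof -
    have "(\<lambda>p. indicator \<Omega> p *\<^sub>R E t p) \<in> borel_measurable \<mu>"
      using torsion_integrable[OF dom flow_metric[OF t(1)] t(2) sets\<mu> fin]
      unfolding set_integrable_def by (rule borel_measurable_integrable)
    then show ?thesis
      unfolding torsional_rigidity_def \<mu>t set_lebesgue_integral_def
      using k by (subst integral_density) auto
  qed
  moreover have "Vol t = k * Vol s" unfolding k_def by (rule volume_flow[OF s(1) t(1)])
  ultimately have "Trs t / Vol t = (LINT p:\<Omega>|\<mu>. E t p) / Vol s" using k by simp
  moreover have "0 \<le> Vol s" by (simp add: volume_def)
  ultimately show ?thesis using divide_right_mono[OF le, of "Vol s"] by simp
qed

text \<open>The comparison constant \<open>k\<^sup>2\<close> is the squared ratio of the volumes, so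
  it disappears on division by the squared volume, at the cost of two more powers of the volume in
  the denominator.\<close>

lemma rigidity_comparison_cube:
  assumes s: "s \<in> J" "torsion_function A (g s) \<Omega> (E s)" and t: "t \<in> J" "torsion_function A (g t) \<Omega> (E t)"
    and le: "\<And>p v. v \<in> tangent_space A p \<Longrightarrow> g s p v v / (vol_factor s)\<^sup>2 \<le> g t p v v / (vol_factor t)\<^sup>2"
  shows "Trs s / Vol s ^ 3 \<le> Trs t / Vol t ^ 3"
proof -
  define k where "k = vol_factor s / vol_factor t"
  have k: "0 < k" using vol_factor_pos[OF s(1)] vol_factor_pos[OF t(1)] by (simp add: k_def)
  have V: "Vol s = k * Vol t" unfolding k_def by (rule volume_flow[OF t(1) s(1)])
  have "Trs s / Vol s \<le> k\<^sup>2 * (Trs t / Vol t)"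
  proof (rule rigidity_comparison[OF s t])
    show "0 < k\<^sup>2" using k by simp
    show "g s p v v \<le> k\<^sup>2 * g t p v v" if "v \<in> tangent_space A p" for p v
      using le[OF that] vol_factor_pos[OF s(1)] by (simp add: k_def power_divide field_simps)
  qed
  then have "Trs s / Vol s / (Vol s)\<^sup>2 \<le> k\<^sup>2 * (Trs t / Vol t) / (Vol s)\<^sup>2"
    by (rule divide_right_mono) simp
  moreover have "k\<^sup>2 * (Trs t / Vol t) / (Vol s)\<^sup>2 = Trs t / Vol t ^ 3"
    using k by (cases "Vol t = 0") (simp_all add: V power2_eq_square power3_eq_cube)
  moreover have "Trs s / Vol s / (Vol s)\<^sup>2 = Trs s / Vol s ^ 3"
    by (simp add: power2_eq_square power3_eq_cube)
  ultimately show ?thesis by (simp only:)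
qed

end

end

end

theorem corollary5p5:
  fixes A :: "('m::{t2_space, second_countable_topology}, 'n::finite) chart set"
    and Tmax :: ereal and T0 :: real
    and g :: "real \<Rightarrow> ('m, 'n) metric"
    and b :: "real \<Rightarrow> real"
    and \<Omega> :: "'m set"
    and E :: "real \<Rightarrow> 'm \<Rightarrow> real"
  assumes "smooth_atlas A"
    and "ricci_flow A Tmax g"
    and "\<forall>t\<in>time_interval Tmax. \<forall>p. scalar_curvature A (g t) p = b t"
    and "ereal T0 < Tmax"
    and "smooth_precompact_domain A \<Omega>"
    and "\<forall>t\<in>{0..T0}. torsion_function A (g t) \<Omega> (E t)"
  shows
    "((\<forall>t\<in>{0..T0}. \<forall>p. \<forall>v\<in>tangent_space A p. ricci A (g t) p v v \<le> 0) \<longrightarrow>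
        mono_on {0..T0} (\<lambda>t. torsional_rigidity A (g t) \<Omega> (E t) / volume A (g t) \<Omega>) \<and>
        antimono_on {0..T0} (\<lambda>t. torsional_rigidity A (g t) \<Omega> (E t) / volume A (g t) \<Omega> ^ 3)) \<and>
     ((\<forall>t\<in>{0..T0}. \<forall>p. \<forall>v\<in>tangent_space A p. ricci A (g t) p v v \<ge> 0) \<longrightarrow>
        antimono_on {0..T0} (\<lambda>t. torsional_rigidity A (g t) \<Omega> (E t) / volume A (g t) \<Omega>) \<and>
        mono_on {0..T0} (\<lambda>t. torsional_rigidity A (g t) \<Omega> (E t) / volume A (g t) \<Omega> ^ 3))"
proof -
  interpret atlas A by unfold_locales (rule assms(1))
  have scal: "scalar_curvature A (g t) p = b t" if "t \<in> time_interval Tmax" for t p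
    using assms(3) that by blast
  have J: "t \<in> time_interval Tmax" if "t \<in> {0..T0}" for t
    using that assms(4) by (auto simp: time_interval_def intro: order_le_less_trans[of _ "ereal T0"])
  have E: "torsion_function A (g t) \<Omega> (E t)" if "t \<in> {0..T0}" for t
    using assms(6) that by blast
  \<comment> \<open>No order between \<open>s\<close> and \<open>t\<close> is imposed: nonpositive
    curvature uses this in the direction of time, nonnegative curvature with the two times
    exchanged, and the converse holds for \<open>C3\<close>.\<close>
  have C: "torsional_rigidity A (g s) \<Omega> (E s) / volume A (g s) \<Omega> \<le> torsional_rigidity A (g t) \<Omega> (E t) / volume A (g t) \<Omega>"
    if "s \<in> {0..T0}" "t \<in> {0..T0}" "\<And>p v. v \<in> tangent_space A p \<Longrightarrow> g s p v v \<le> g t p v v" for s t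
  proof -
    have "torsional_rigidity A (g s) \<Omega> (E s) / volume A (g s) \<Omega> \<le> 1 * (torsional_rigidity A (g t) \<Omega> (E t) / volume A (g t) \<Omega>)"
      by (rule rigidity_comparison[OF assms(2) scal assms(5) J E J E]) (use that in simp_all)
    then show ?thesis by simp
  qed
  have C3: "torsional_rigidity A (g s) \<Omega> (E s) / volume A (g s) \<Omega> ^ 3 \<le> torsional_rigidity A (g t) \<Omega> (E t) / volume A (g t) \<Omega> ^ 3"
    if "s \<in> {0..T0}" "t \<in> {0..T0}" "\<And>p v. v \<in> tangent_space A p \<Longrightarrow>
      g s p v v / (vol_factor g s)\<^sup>2 \<le> g t p v v / (vol_factor g t)\<^sup>2" for s t
    by (rule rigidity_comparison_cube[OF assms(2) scal assms(5) J E J E]) (use that in simp_all)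
  show ?thesis
  proof (intro conjI impI monotone_onI)
    fix s t assume ric: "\<forall>t\<in>{0..T0}. \<forall>p. \<forall>v\<in>tangent_space A p. ricci A (g t) p v v \<le> 0"
      and s: "s \<in> {0..T0}" and t: "t \<in> {0..T0}" and st: "s \<le> t"
    have m: "g s p v v \<le> g t p v v \<and> g t p v v / (vol_factor g t)\<^sup>2 \<le> g s p v v / (vol_factor g s)\<^sup>2"
      if "v \<in> tangent_space A p" for p v
      by (rule metric_monotone(1)[OF assms(2) scal that _ st J[OF t]]) (use s t ric in auto)
    show "torsional_rigidity A (g s) \<Omega> (E s) / volume A (g s) \<Omega> \<le> torsional_rigidity A (g t) \<Omega> (E t) / volume A (g t) \<Omega>"
      using C[OF s t] m by blast
    show "torsional_rigidity A (g t) \<Omega> (E t) / volume A (g t) \<Omega> ^ 3 \<le> torsional_rigidity A (g s) \<Omega> (E s) / volume A (g s) \<Omega> ^ 3"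
      using C3[OF t s] m by blast
  next
    fix s t assume ric: "\<forall>t\<in>{0..T0}. \<forall>p. \<forall>v\<in>tangent_space A p. 0 \<le> ricci A (g t) p v v"
      and s: "s \<in> {0..T0}" and t: "t \<in> {0..T0}" and st: "s \<le> t"
    have m: "g t p v v \<le> g s p v v \<and> g s p v v / (vol_factor g s)\<^sup>2 \<le> g t p v v / (vol_factor g t)\<^sup>2"
      if "v \<in> tangent_space A p" for p v
      by (rule metric_monotone(2)[OF assms(2) scal that _ st J[OF t]]) (use s t ric in auto)
    show "torsional_rigidity A (g t) \<Omega> (E t) / volume A (g t) \<Omega> \<le> torsional_rigidity A (g s) \<Omega> (E s) / volume A (g s) \<Omega>"
      using C[OF t s] m by blast
    show "torsional_rigidity A (g s) \<Omega> (E s) / volume A (g s) \<Omega> ^ 3 \<le> torsional_rigidity A (g t) \<Omega> (E t) / volume A (g t) \<Omega> ^ 3"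
      using C3[OF s t] m by blast
  qed
qed

end
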